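(* Let $M$ be a compact connected Riemannian manifold, $f:M\to M$ a diffeomorphism of class at least $C^1$, and $W$ a one-dimensional $f$-invariant, uniformly expanding foliation of $M$ with oriented $C^1$ leaves. If $W$ carries a unique non-trivial homology $h_W\in H_1(M,\mathbb{R})$, then the geometric expansion $\chi(x,r)$ of $f$ on $W$ is independent of $x\in M$ and of $r>0$. Moreover, if $\lambda_W$ is the eigenvalue of $f_*:H_1(M,\mathbb{R})\to H_1(M,\mathbb{R})$ corresponding to the eigenvector $h_W$, then for every $x\in M$ and $r>0$ $$\chi=\chi(x,r)=\limsup_{i\to\infty}\frac1i\ln|f^i(W_r(x))|=\lim_{i\to\infty}\frac1i\ln|f^i(W_r(x))|=\ln\lambda_W .$$
   Context: Invariant: $f$ maps leaves of $W$ to leaves. $W(x)$ is the leaf through $x$; $W_r(x)$ is the segment (ball of radius $r$) in $W(x)$ centered at $x$, with the orientation of $W(x)$. $|\cdot|$ denotes length of curves. $\chi(x,r)=\limsup_{i\to\infty}\frac1i\ln|f^i(W_r(x))|$ and $\chi=\sup_{x\in M}\chi(x,r)$ (independent of $r$). Uniformly expanding: there are $\lambda>1$, $C>0$ with $\|Df^m_xv\|\ge C\lambda^m\|v\|$ for all $x\in M$, $v\in T_xW(x)$, $m\in\mathbb{N}$. Loops: given $x$, $r$ and $i\ge1$, let $l_i$ be the closed loop formed by adding to the segment $f^i(W_r(x))$ (with the image orientation) an oriented curve $b_i$ joining its two end points, of length at most the diameter of $M$. Let $[l_i]\in H_1(M,\mathbb{R})$ be its homology class and $|l_i|$ its length.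 The sequence $[l_i]/|l_i|$ is bounded, $|l_i|\to\infty$, and its sub-sequential limits do not depend on the choice of the $b_i$. $W$ carries a non-trivial homology $h\in H_1(M,\mathbb{R})$, $h\ne0$, if there are $x\in M$, $r>0$ and $n_i\to\infty$ with $\lim_{i\to\infty}[l_{n_i}]/|l_{n_i}|=h$. $W$ carries a unique non-trivial homology (up to rescaling) if there are constants $0<c_1<c_2$ and a unit vector $h\in H_1(M,\mathbb{R})$ (for a fixed norm) such that, for every $x\in M$ and $r>0$, every sub-sequential limit of $[l_i]/|l_i|$ belongs to $\{ch: c_1\le c\le c_2\}$; $h_W$ denotes one such limit. In this case $h_W$ is an eigenvector of $f_*$ on $H_1(M,\mathbb{R})$. *)

theory Defs
  imports
    "HOL-Analysis.Analysis"
    "HOL-Homology.Homology"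
begin

section \<open>Smooth Riemannian manifolds\<close>

text \<open>The manifold is a whole type \<open>'m\<close>, modelled on the Euclidean space \<open>'e\<close>.
  A chart is a pair of an open set and a map that is used only on that set.\<close>

type_synonym ('m, 'e) chart = "'m set \<times> ('m \<Rightarrow> 'e)"

text \<open>For open \<open>S\<close>: all partial derivatives up to order \<open>k\<close> exist and are continuous on \<open>S\<close>.\<close>

primrec Ck_on :: "nat \<Rightarrow> 'a::euclidean_space set \<Rightarrow> ('a \<Rightarrow> 'b::real_normed_vector) \<Rightarrow> bool" where
  "Ck_on 0 S F \<longleftrightarrow> continuous_on S F"
| "Ck_on (Suc k) S F \<longleftrightarrow>
     F differentiable_on S \<and> (\<forall>v. Ck_on k S (\<lambda>x. frechet_derivative F (at x) v))"

definition smooth_atlas :: "('m::t2_space, 'e::euclidean_space) chart set \<Rightarrow> bool" where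
  "smooth_atlas A \<longleftrightarrow>
     (\<Union>(U, \<phi>)\<in>A. U) = UNIV \<and>
     (\<forall>(U, \<phi>)\<in>A. open U \<and> open (\<phi> ` U) \<and> homeomorphism U (\<phi> ` U) \<phi> (inv_into U \<phi>)) \<and>
     (\<forall>(U, \<phi>)\<in>A. \<forall>(V, \<psi>)\<in>A. \<forall>k. Ck_on k (\<phi> ` (U \<inter> V)) (\<psi> \<circ> inv_into U \<phi>))"

text \<open>Every point gets a preferred chart, and \<open>T\<^sub>xM\<close> is identified with \<open>'e\<close> by means of the
  coordinates in the preferred chart at \<open>x\<close>. All tangent vectors below are understood in this way.\<close>

definition chart_at :: "('m, 'e) chart set \<Rightarrow> 'm \<Rightarrow> ('m, 'e) chart" where
  "chart_at A x = (SOME c. c \<in> A \<and> x \<in> fst c)"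

definition tangent_map ::
    "('m::t2_space, 'e::euclidean_space) chart set \<Rightarrow> ('m \<Rightarrow> 'm) \<Rightarrow> 'm \<Rightarrow> 'e \<Rightarrow> 'e" where
  "tangent_map A f x =
     frechet_derivative
       (snd (chart_at A (f x)) \<circ> f \<circ> inv_into (fst (chart_at A x)) (snd (chart_at A x)))
       (at (snd (chart_at A x) x))"

definition C1_map :: "('m::t2_space, 'e::euclidean_space) chart set \<Rightarrow> ('m \<Rightarrow> 'm) \<Rightarrow> bool" where
  "C1_map A f \<longleftrightarrow> continuous_on UNIV f \<and>
     (\<forall>(U, \<phi>)\<in>A. \<forall>(V, \<psi>)\<in>A. Ck_on 1 (\<phi> ` (U \<inter> f -` V)) (\<psi> \<circ> f \<circ> inv_into U \<phi>))"

definition C1_diffeomorphism ::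
    "('m::t2_space, 'e::euclidean_space) chart set \<Rightarrow> ('m \<Rightarrow> 'm) \<Rightarrow> bool" where
  "C1_diffeomorphism A f \<longleftrightarrow> bij f \<and> C1_map A f \<and> C1_map A (inv_into UNIV f)"

text \<open>Smoothness of the metric is tested in an arbitrary chart \<open>(U, \<phi>)\<close>: the frechet derivative
  below carries vectors in \<open>\<phi>\<close>-coordinates to coordinates in the preferred chart.\<close>

definition riemannian_metric ::
    "('m::t2_space, 'e::euclidean_space) chart set \<Rightarrow> ('m \<Rightarrow> 'e \<Rightarrow> 'e \<Rightarrow> real) \<Rightarrow> bool" where
  "riemannian_metric A g \<longleftrightarrow>
     (\<forall>x. bilinear (g x) \<and> (\<forall>v w. g x v w = g x w v) \<and> (\<forall>v. v \<noteq> 0 \<longrightarrow> g x v v > 0)) \<and>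
     (\<forall>(U, \<phi>)\<in>A. \<forall>v w k. Ck_on k (\<phi> ` U)
        (\<lambda>y. let x = inv_into U \<phi> y;
                  J = frechet_derivative (snd (chart_at A x) \<circ> inv_into U \<phi>) (at y)
              in g x (J v) (J w)))"

definition riemannian_manifold ::
    "('m::t2_space, 'e::euclidean_space) chart set \<Rightarrow> ('m \<Rightarrow> 'e \<Rightarrow> 'e \<Rightarrow> real) \<Rightarrow> bool" where
  "riemannian_manifold A g \<longleftrightarrow> smooth_atlas A \<and> riemannian_metric A g"

definition rnorm :: "('m \<Rightarrow> 'e \<Rightarrow> 'e \<Rightarrow> real) \<Rightarrow> 'm \<Rightarrow> 'e \<Rightarrow> real" where
  "rnorm g x v = sqrt (g x v v)"


section \<open>Curves and length\<close>

text \<open>At the ends of an interval \<open>I\<close> derivatives are one-sided.\<close>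

definition C1_curve_on ::
    "('m::t2_space, 'e::euclidean_space) chart set \<Rightarrow> real set \<Rightarrow> (real \<Rightarrow> 'm) \<Rightarrow> bool" where
  "C1_curve_on A I \<gamma> \<longleftrightarrow> continuous_on I \<gamma> \<and>
     (\<forall>(U, \<phi>)\<in>A. \<exists>D. continuous_on (I \<inter> \<gamma> -` U) D \<and>
        (\<forall>t \<in> I \<inter> \<gamma> -` U. ((\<phi> \<circ> \<gamma>) has_vector_derivative D t) (at t within I)))"

definition velocity ::
    "('m::t2_space, 'e::euclidean_space) chart set \<Rightarrow> real set \<Rightarrow> (real \<Rightarrow> 'm) \<Rightarrow> real \<Rightarrow> 'e" where
  "velocity A I \<gamma> t = vector_derivative (snd (chart_at A (\<gamma> t)) \<circ> \<gamma>) (at t within I)"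

definition piecewise_C1_path ::
    "('m::t2_space, 'e::euclidean_space) chart set \<Rightarrow> (real \<Rightarrow> 'm) \<Rightarrow> bool" where
  "piecewise_C1_path A \<gamma> \<longleftrightarrow> path \<gamma> \<and>
     (\<exists>S. finite S \<and>
       (\<forall>a b. 0 \<le> a \<and> a < b \<and> b \<le> 1 \<and> {a<..<b} \<inter> S = {} \<longrightarrow> C1_curve_on A {a..b} \<gamma>))"

definition riem_dist ::
    "('m::t2_space, 'e::euclidean_space) chart set \<Rightarrow> ('m \<Rightarrow> 'e \<Rightarrow> 'e \<Rightarrow> real) \<Rightarrow> 'm \<Rightarrow> 'm \<Rightarrow> real" where
  "riem_dist A g x y =
     Inf {integral {0..1} (\<lambda>t. rnorm g (\<gamma> t) (velocity A {0..1} \<gamma> t)) | \<gamma>.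
            piecewise_C1_path A \<gamma> \<and> pathstart \<gamma> = x \<and> pathfinish \<gamma> = y}"

definition riem_diameter ::
    "('m::t2_space, 'e::euclidean_space) chart set \<Rightarrow> ('m \<Rightarrow> 'e \<Rightarrow> 'e \<Rightarrow> real) \<Rightarrow> real" where
  "riem_diameter A g = Sup {riem_dist A g x y | x y. True}"

text \<open>Curves are continuous paths on \<open>[0,1]\<close>; their length is the supremum of the lengths of
  inscribed polygons for the Riemannian distance, which on piecewise \<open>C\<^sup>1\<close> curves is the integral
  of the speed. \<^const>\<open>Sup\<close> on the reals is meaningful only for rectifiable curves.\<close>

definition polygon_lengths ::
    "('m::t2_space, 'e::euclidean_space) chart set \<Rightarrow> ('m \<Rightarrow> 'e \<Rightarrow> 'e \<Rightarrow> real) \<Rightarrow> (real \<Rightarrow> 'm) \<Rightarrow> real set" where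
  "polygon_lengths A g \<gamma> =
     {\<Sum>i<n. riem_dist A g (\<gamma> (t i)) (\<gamma> (t (Suc i))) | n t.
        mono_on {..n} t \<and> t ` {..n} \<subseteq> {0..1}}"

definition rectifiable ::
    "('m::t2_space, 'e::euclidean_space) chart set \<Rightarrow> ('m \<Rightarrow> 'e \<Rightarrow> 'e \<Rightarrow> real) \<Rightarrow> (real \<Rightarrow> 'm) \<Rightarrow> bool" where
  "rectifiable A g \<gamma> \<longleftrightarrow> path \<gamma> \<and> bdd_above (polygon_lengths A g \<gamma>)"

definition curve_length ::
    "('m::t2_space, 'e::euclidean_space) chart set \<Rightarrow> ('m \<Rightarrow> 'e \<Rightarrow> 'e \<Rightarrow> real) \<Rightarrow> (real \<Rightarrow> 'm) \<Rightarrow> real" where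
  "curve_length A g \<gamma> = Sup (polygon_lengths A g \<gamma>)"


section \<open>One-dimensional foliations with oriented \<open>C\<^sup>1\<close> leaves\<close>

text \<open>A connected one-dimensional manifold is a line or a circle, so an immersed \<open>C\<^sup>1\<close> leaf is
  the image of a regular \<open>C\<^sup>1\<close> curve \<open>\<real> \<rightarrow> M\<close> which is injective or the periodic
  unrolling of a circle.\<close>

definition leaf_param ::
    "('m::t2_space, 'e::euclidean_space) chart set \<Rightarrow> 'm set \<Rightarrow> (real \<Rightarrow> 'm) \<Rightarrow> bool" where
  "leaf_param A L c \<longleftrightarrow>
     C1_curve_on A UNIV c \<and> (\<forall>t. velocity A UNIV c t \<noteq> 0) \<and> range c = L \<and>
     (inj c \<or> (\<exists>T>0. \<forall>s t. c s = c t \<longleftrightarrow> (\<exists>k::int. t = s + of_int k * T)))"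

text \<open>\<open>W x\<close> is the leaf through \<open>x\<close>. In a foliation box \<open>(U, \<psi>)\<close>, with \<open>\<psi>\<close> only a homeomorphism
  onto a cube, the plaques are the segments of the cube parallel to the coordinate direction \<open>e\<close>,
  and the components of \<open>L \<inter> U\<close> in the leaf topology of a leaf \<open>L\<close> are plaques. The leaf topology
  is the one carried over from \<open>\<real>\<close> by a parametrization of \<open>L\<close>.\<close>

definition foliation_1d ::
    "('m::t2_space, 'e::euclidean_space) chart set \<Rightarrow> ('m \<Rightarrow> 'm set) \<Rightarrow> bool" where
  "foliation_1d A W \<longleftrightarrow>
     (\<forall>x. x \<in> W x) \<and> (\<forall>x y. y \<in> W x \<longrightarrow> W y = W x) \<and>
     (\<forall>x. \<exists>c. leaf_param A (W x) c) \<and>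
     (\<forall>p. \<exists>U \<psi> \<psi>' e. open U \<and> p \<in> U \<and> e \<in> (Basis :: 'e set) \<and>
        homeomorphism U (box (- One) One :: 'e set) \<psi> \<psi>' \<and>
        (\<forall>x c J. leaf_param A (W x) c \<and> J \<in> components (c -` U) \<longrightarrow>
           (\<exists>z \<in> box (- One) One. c ` J = {q \<in> U. \<forall>i \<in> Basis - {e}. \<psi> q \<bullet> i = z \<bullet> i})))"

definition leaf_tangent ::
    "('m::t2_space, 'e::euclidean_space) chart set \<Rightarrow> ('m \<Rightarrow> 'm set) \<Rightarrow> 'm \<Rightarrow> 'e set" where
  "leaf_tangent A W x =
     {a *\<^sub>R velocity A UNIV c t | a c t. leaf_param A (W x) c \<and> c t = x}"

text \<open>An orientation of the leaves is given by the positive unit tangent vectors \<open>E x \<in> T\<^sub>xW(x)\<close>,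
  chosen coherently along every single leaf.\<close>

definition leaf_orientation ::
    "('m::t2_space, 'e::euclidean_space) chart set \<Rightarrow> ('m \<Rightarrow> 'e \<Rightarrow> 'e \<Rightarrow> real) \<Rightarrow>
     ('m \<Rightarrow> 'm set) \<Rightarrow> ('m \<Rightarrow> 'e) \<Rightarrow> bool" where
  "leaf_orientation A g W E \<longleftrightarrow>
     (\<forall>x. E x \<in> leaf_tangent A W x \<and> rnorm g x (E x) = 1) \<and>
     (\<forall>x. \<exists>c. leaf_param A (W x) c \<and> (\<forall>t. \<exists>a>0. velocity A UNIV c t = a *\<^sub>R E (c t)))"

definition invariant_foliation :: "('m \<Rightarrow> 'm) \<Rightarrow> ('m \<Rightarrow> 'm set) \<Rightarrow> bool" where
  "invariant_foliation f W \<longleftrightarrow> (\<forall>x. f ` W x = W (f x))"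

definition uniformly_expanding ::
    "('m::t2_space, 'e::euclidean_space) chart set \<Rightarrow> ('m \<Rightarrow> 'e \<Rightarrow> 'e \<Rightarrow> real) \<Rightarrow>
     ('m \<Rightarrow> 'm set) \<Rightarrow> ('m \<Rightarrow> 'm) \<Rightarrow> bool" where
  "uniformly_expanding A g W f \<longleftrightarrow>
     (\<exists>\<mu> C. \<mu> > 1 \<and> C > 0 \<and>
        (\<forall>x. \<forall>v \<in> leaf_tangent A W x. \<forall>m.
           rnorm g ((f ^^ m) x) (tangent_map A (f ^^ m) x v) \<ge> C * \<mu> ^ m * rnorm g x v))"

text \<open>\<open>W\<^sub>r(x)\<close> as an oriented curve: the arc-length parametrization \<open>[-r,r] \<rightarrow> W(x)\<close> centered at
  \<open>x\<close>, rescaled to \<open>[0,1]\<close>.\<close>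

definition arclength_segment ::
    "('m::t2_space, 'e::euclidean_space) chart set \<Rightarrow> ('m \<Rightarrow> 'm set) \<Rightarrow> ('m \<Rightarrow> 'e) \<Rightarrow>
     'm \<Rightarrow> real \<Rightarrow> (real \<Rightarrow> 'm) \<Rightarrow> bool" where
  "arclength_segment A W E x r \<gamma> \<longleftrightarrow>
     C1_curve_on A {-r..r} \<gamma> \<and> \<gamma> 0 = x \<and> \<gamma> ` {-r..r} \<subseteq> W x \<and>
     (\<forall>t \<in> {-r..r}. velocity A {-r..r} \<gamma> t = E (\<gamma> t))"

definition leaf_segment ::
    "('m::t2_space, 'e::euclidean_space) chart set \<Rightarrow> ('m \<Rightarrow> 'm set) \<Rightarrow> ('m \<Rightarrow> 'e) \<Rightarrow>
     'm \<Rightarrow> real \<Rightarrow> real \<Rightarrow> 'm" where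
  "leaf_segment A W E x r = (\<lambda>s. (SOME \<gamma>. arclength_segment A W E x r \<gamma>) (r * (2 * s - 1)))"

definition geom_expansion_at ::
    "('m::t2_space, 'e::euclidean_space) chart set \<Rightarrow> ('m \<Rightarrow> 'e \<Rightarrow> 'e \<Rightarrow> real) \<Rightarrow>
     ('m \<Rightarrow> 'm set) \<Rightarrow> ('m \<Rightarrow> 'e) \<Rightarrow> ('m \<Rightarrow> 'm) \<Rightarrow> 'm \<Rightarrow> real \<Rightarrow> ereal" where
  "geom_expansion_at A g W E f x r =
     limsup (\<lambda>i. ereal (1 / real i * ln (curve_length A g ((f ^^ i) \<circ> leaf_segment A W E x r))))"

text \<open>\<open>\<chi> = sup\<^sub>x \<chi>(x,r)\<close>; the radius stays an argument because its irrelevance is a theorem.\<close>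

definition geom_expansion ::
    "('m::t2_space, 'e::euclidean_space) chart set \<Rightarrow> ('m \<Rightarrow> 'e \<Rightarrow> 'e \<Rightarrow> real) \<Rightarrow>
     ('m \<Rightarrow> 'm set) \<Rightarrow> ('m \<Rightarrow> 'e) \<Rightarrow> ('m \<Rightarrow> 'm) \<Rightarrow> real \<Rightarrow> ereal" where
  "geom_expansion A g W E f r = (SUP x. geom_expansion_at A g W E f x r)"


section \<open>First real singular homology\<close>

text \<open>The integral singular chains of \<^theory>\<open>HOL-Homology.Simplices\<close>, with real coefficients.\<close>

instantiation poly_mapping :: (type, real_vector) real_vector
begin

lift_definition scaleR_poly_mapping :: "real \<Rightarrow> ('a \<Rightarrow>\<^sub>0 'b) \<Rightarrow> 'a \<Rightarrow>\<^sub>0 'b"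
  is "\<lambda>a c \<sigma>. a *\<^sub>R c \<sigma>"
  by (erule rev_finite_subset) auto

instance
  by standard (transfer; simp add: algebra_simps)+

end

type_synonym 'a real_chain = "((nat \<Rightarrow> real) \<Rightarrow> 'a) \<Rightarrow>\<^sub>0 real"

definition lin_extend :: "('s \<Rightarrow> 'v) \<Rightarrow> ('s \<Rightarrow>\<^sub>0 real) \<Rightarrow> 'v::real_vector" where
  "lin_extend b c = (\<Sum>\<sigma> \<in> Poly_Mapping.keys c. Poly_Mapping.lookup c \<sigma> *\<^sub>R b \<sigma>)"

definition real_boundary :: "nat \<Rightarrow> 'a real_chain \<Rightarrow> 'a real_chain" where
  "real_boundary p =
     lin_extend (\<lambda>\<sigma>. \<Sum>k\<le>p. (-1) ^ k *\<^sub>R Poly_Mapping.single (singular_face p k \<sigma>) 1)"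

definition real_singular_chain :: "nat \<Rightarrow> 'a::topological_space real_chain \<Rightarrow> bool" where
  "real_singular_chain p c \<longleftrightarrow> Poly_Mapping.keys c \<subseteq> singular_simplex_set p euclidean"

definition real_1cycle :: "'a::topological_space real_chain \<Rightarrow> bool" where
  "real_1cycle c \<longleftrightarrow> real_singular_chain 1 c \<and> real_boundary 1 c = 0"

definition real_1boundary :: "'a::topological_space real_chain \<Rightarrow> bool" where
  "real_1boundary c \<longleftrightarrow> (\<exists>d. real_singular_chain 2 d \<and> c = real_boundary 2 d)"

definition homologous_1cycles ::
    "'a::topological_space real_chain \<Rightarrow> 'a real_chain \<Rightarrow> bool" where
  "homologous_1cycles c d \<longleftrightarrow> real_1cycle c \<and> real_1cycle d \<and> real_1boundary (c - d)"

lemma lin_extend_superset: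
  assumes "finite K" "Poly_Mapping.keys c \<subseteq> K"
  shows "lin_extend b c = (\<Sum>\<sigma>\<in>K. Poly_Mapping.lookup c \<sigma> *\<^sub>R b \<sigma>)"
  unfolding lin_extend_def
  by (rule sum.mono_neutral_left) (use assms in \<open>auto simp: in_keys_iff\<close>)

lemma lin_extend_0 [simp]: "lin_extend b 0 = 0"
  by (simp add: lin_extend_def)

lemma keys_scaleR_subset: "Poly_Mapping.keys (a *\<^sub>R c) \<subseteq> Poly_Mapping.keys c"
  by (auto simp: in_keys_iff scaleR_poly_mapping.rep_eq)

lemma lin_extend_add: "lin_extend b (c + d) = lin_extend b c + lin_extend b d"
proof -
  let ?K = "Poly_Mapping.keys c \<union> Poly_Mapping.keys d"
  have "Poly_Mapping.keys (c + d) \<subseteq> ?K"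
    by (rule keys_add)
  then show ?thesis
    by (simp add: lin_extend_superset [of ?K] lookup_add scaleR_left_distrib sum.distrib)
qed

lemma lin_extend_scaleR: "lin_extend b (a *\<^sub>R c) = a *\<^sub>R lin_extend b c"
proof -
  have "lin_extend b (a *\<^sub>R c) =
      (\<Sum>\<sigma>\<in>Poly_Mapping.keys c. Poly_Mapping.lookup (a *\<^sub>R c) \<sigma> *\<^sub>R b \<sigma>)"
    by (rule lin_extend_superset) (auto intro: keys_scaleR_subset [THEN subsetD])
  then show ?thesis
    by (simp add: lin_extend_def scaleR_poly_mapping.rep_eq scaleR_sum_right)
qed

lemma real_boundary_add: "real_boundary p (c + d) = real_boundary p c + real_boundary p d"
  and real_boundary_scaleR: "real_boundary p (a *\<^sub>R c) = a *\<^sub>R real_boundary p c"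
  and real_boundary_0 [simp]: "real_boundary p 0 = 0"
  by (simp_all add: real_boundary_def lin_extend_add lin_extend_scaleR)

lemma real_singular_chain_0 [simp]: "real_singular_chain p 0"
  and real_singular_chain_add:
    "real_singular_chain p c \<Longrightarrow> real_singular_chain p d \<Longrightarrow> real_singular_chain p (c + d)"
  and real_singular_chain_scaleR:
    "real_singular_chain p c \<Longrightarrow> real_singular_chain p (a *\<^sub>R c)"
  unfolding real_singular_chain_def
  using keys_add [of c d] keys_scaleR_subset [of a c] by auto

lemma real_1cycle_0 [simp]: "real_1cycle 0"
  and real_1cycle_add: "real_1cycle c \<Longrightarrow> real_1cycle d \<Longrightarrow> real_1cycle (c + d)"
  and real_1cycle_scaleR: "real_1cycle c \<Longrightarrow> real_1cycle (a *\<^sub>R c)"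
  by (simp_all add: real_1cycle_def real_singular_chain_add real_singular_chain_scaleR
      real_boundary_add real_boundary_scaleR)

lemma real_1boundary_0 [simp]: "real_1boundary 0"
  unfolding real_1boundary_def by (rule exI [of _ 0]) simp

lemma real_1boundary_add: "real_1boundary c \<Longrightarrow> real_1boundary d \<Longrightarrow> real_1boundary (c + d)"
  unfolding real_1boundary_def by (metis real_boundary_add real_singular_chain_add)

lemma real_1boundary_scaleR: "real_1boundary c \<Longrightarrow> real_1boundary (a *\<^sub>R c)"
  unfolding real_1boundary_def by (metis real_boundary_scaleR real_singular_chain_scaleR)

lemma part_equivp_homologous:
  "part_equivp (homologous_1cycles :: 'a::topological_space real_chain \<Rightarrow> _)" (is "part_equivp ?R")
proof (rule part_equivpI)
  show "\<exists>x. ?R x x"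
    by (rule exI [of _ 0]) (simp add: homologous_1cycles_def)
  show "symp ?R"
  proof (rule sympI)
    fix c d :: "'a real_chain"
    assume cd: "homologous_1cycles c d"
    then have "real_1boundary ((-1) *\<^sub>R (c - d))"
      unfolding homologous_1cycles_def by (intro real_1boundary_scaleR) auto
    then show "homologous_1cycles d c"
      using cd by (simp add: homologous_1cycles_def)
  qed
  show "transp ?R"
  proof (rule transpI)
    fix c d e :: "'a real_chain"
    assume *: "homologous_1cycles c d" "homologous_1cycles d e"
    then have "real_1boundary ((c - d) + (d - e))"
      unfolding homologous_1cycles_def by (intro real_1boundary_add) auto
    then show "homologous_1cycles c e"
      using * by (simp add: homologous_1cycles_def)
  qed
qed

text \<open>\<open>H\<^sub>1(M,\<real>)\<close>\<close>

quotient_type (overloaded) 'a real_H1 =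
    "'a::topological_space real_chain" / partial: homologous_1cycles
  morphisms rep_H1 H1_class
  by (rule part_equivp_homologous)

instantiation real_H1 :: (topological_space) real_vector
begin

lift_definition zero_real_H1 :: "'a real_H1" is 0
  by (simp add: homologous_1cycles_def)

lift_definition plus_real_H1 :: "'a real_H1 \<Rightarrow> 'a real_H1 \<Rightarrow> 'a real_H1" is "(+)"
  unfolding homologous_1cycles_def
  by (metis add_diff_add real_1boundary_add real_1cycle_add)

lift_definition scaleR_real_H1 :: "real \<Rightarrow> 'a real_H1 \<Rightarrow> 'a real_H1" is "(*\<^sub>R)"
  unfolding homologous_1cycles_def
  by (metis real_1boundary_scaleR real_1cycle_scaleR scaleR_diff_right)

definition uminus_real_H1 :: "'a real_H1 \<Rightarrow> 'a real_H1" where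
  "uminus_real_H1 x = (-1) *\<^sub>R x"

definition minus_real_H1 :: "'a real_H1 \<Rightarrow> 'a real_H1 \<Rightarrow> 'a real_H1" where
  "minus_real_H1 x y = x + - y"

instance
proof
  fix x y z :: "'a real_H1" and a b :: real
  have r: "homologous_1cycles c c'" if "real_1cycle c" "c = c'" for c c' :: "'a real_chain"
    using that by (simp add: homologous_1cycles_def)
  note cyc = real_1cycle_add real_1cycle_scaleR
  show "x + y + z = x + (y + z)"
    by transfer (rule r; simp add: homologous_1cycles_def cyc algebra_simps)
  show "x + y = y + x"
    by transfer (rule r; simp add: homologous_1cycles_def cyc algebra_simps)
  show "0 + x = x"
    by transfer (rule r; simp add: homologous_1cycles_def)
  show "- x + x = 0"
    unfolding uminus_real_H1_def
    by transfer (rule r; simp add: homologous_1cycles_def real_1cycle_def)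
  show "x - y = x + - y"
    by (fact minus_real_H1_def)
  show "a *\<^sub>R (x + y) = a *\<^sub>R x + a *\<^sub>R y"
    by transfer (rule r; simp add: homologous_1cycles_def cyc algebra_simps)
  show "(a + b) *\<^sub>R x = a *\<^sub>R x + b *\<^sub>R x"
    by transfer (rule r; simp add: homologous_1cycles_def cyc algebra_simps)
  show "a *\<^sub>R b *\<^sub>R x = (a * b) *\<^sub>R x"
    by transfer (rule r; simp add: homologous_1cycles_def cyc algebra_simps)
  show "1 *\<^sub>R x = x"
    by transfer (rule r; simp add: homologous_1cycles_def)
qed

end

text \<open>\<open>f\<^sub>*\<close> is evaluated on a representing cycle; for continuous \<open>f\<close> its choice is immaterial.\<close>

definition H1_map :: "('a \<Rightarrow> 'a) \<Rightarrow> 'a::topological_space real_H1 \<Rightarrow> 'a real_H1" where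
  "H1_map f h =
     H1_class (lin_extend (\<lambda>\<sigma>. Poly_Mapping.single (simplex_map 1 f \<sigma>) 1) (rep_H1 h))"

definition loop_class :: "(real \<Rightarrow> 'a) \<Rightarrow> 'a::topological_space real_H1" where
  "loop_class l =
     H1_class (Poly_Mapping.single (restrict (\<lambda>s. l (s 1)) (standard_simplex 1)) 1)"

definition is_norm :: "('v::real_vector \<Rightarrow> real) \<Rightarrow> bool" where
  "is_norm N \<longleftrightarrow> (\<forall>v. N v = 0 \<longleftrightarrow> v = 0) \<and> (\<forall>v w. N (v + w) \<le> N v + N w) \<and>
     (\<forall>a v. N (a *\<^sub>R v) = \<bar>a\<bar> * N v)"


section \<open>The homology carried by a foliation\<close>

definition closing_curve ::
    "('m::t2_space, 'e::euclidean_space) chart set \<Rightarrow> ('m \<Rightarrow> 'e \<Rightarrow> 'e \<Rightarrow> real) \<Rightarrow>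
     (real \<Rightarrow> 'm) \<Rightarrow> (real \<Rightarrow> 'm) \<Rightarrow> bool" where
  "closing_curve A g \<sigma> b \<longleftrightarrow>
     rectifiable A g b \<and> curve_length A g b \<le> riem_diameter A g \<and>
     pathstart b = pathfinish \<sigma> \<and> pathfinish b = pathstart \<sigma>"

definition homology_limits ::
    "('m::t2_space, 'e::euclidean_space) chart set \<Rightarrow> ('m \<Rightarrow> 'e \<Rightarrow> 'e \<Rightarrow> real) \<Rightarrow>
     ('m \<Rightarrow> 'm set) \<Rightarrow> ('m \<Rightarrow> 'e) \<Rightarrow> ('m \<Rightarrow> 'm) \<Rightarrow> ('m real_H1 \<Rightarrow> real) \<Rightarrow>
     'm \<Rightarrow> real \<Rightarrow> 'm real_H1 set" where
  "homology_limits A g W E f N x r =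
     {h. \<exists>b n. let l = (\<lambda>i. ((f ^^ i) \<circ> leaf_segment A W E x r) +++ b i) in
        (\<forall>i\<ge>1. closing_curve A g ((f ^^ i) \<circ> leaf_segment A W E x r) (b i)) \<and>
        strict_mono (n :: nat \<Rightarrow> nat) \<and>
        (\<lambda>j. N ((1 / curve_length A g (l (n j))) *\<^sub>R loop_class (l (n j)) - h)) \<longlonglongrightarrow> 0}"

definition carries_unique_homology ::
    "('m::t2_space, 'e::euclidean_space) chart set \<Rightarrow> ('m \<Rightarrow> 'e \<Rightarrow> 'e \<Rightarrow> real) \<Rightarrow>
     ('m \<Rightarrow> 'm set) \<Rightarrow> ('m \<Rightarrow> 'e) \<Rightarrow> ('m \<Rightarrow> 'm) \<Rightarrow> ('m real_H1 \<Rightarrow> real) \<Rightarrow>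
     'm real_H1 \<Rightarrow> bool" where
  "carries_unique_homology A g W E f N hW \<longleftrightarrow>
     (\<exists>c1 c2 u. 0 < c1 \<and> c1 < c2 \<and> N u = 1 \<and>
        (\<forall>x r. r > 0 \<longrightarrow> homology_limits A g W E f N x r \<subseteq> {c *\<^sub>R u | c. c1 \<le> c \<and> c \<le> c2})) \<and>
     (\<exists>x r. r > 0 \<and> hW \<in> homology_limits A g W E f N x r)"

end

theory Submission
  imports Defs
begin

text \<open>
  Cut a rectifiable curve into pieces of small diameter. Only finitely many homology classes arise
  from the pieces, once their end points are joined to a base point, and a curve of length \<open>\<ell>\<close> needs
  at most \<open>\<ell>/\<delta> + 2\<close> pieces. Hence the classes \<open>[l\<^sub>i]/|l\<^sub>i|\<close> stay in a bounded part of a finite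
  dimensional subspace, and \<open>[l\<^bsub>i+1\<^esub>] - f\<^sub>*[l\<^sub>i]\<close>, which is the class of \<open>b\<^bsub>i+1\<^esub> - f \<circ> b\<^sub>i\<close>, is bounded.
  By hypothesis all limit points of \<open>[l\<^sub>i]/|l\<^sub>i|\<close> are multiples \<open>c u\<close> with \<open>c\<^sub>1 \<le> c \<le> c\<^sub>2\<close>, so by
  compactness \<open>[l\<^sub>i] = |l\<^sub>i| (c\<^sub>i u + o(1))\<close>. Since the expansion forces \<open>|l\<^sub>i| \<rightarrow> \<infinity>\<close>, comparison of
  \<open>[l\<^bsub>i+1\<^esub>]\<close> with \<open>f\<^sub>*[l\<^sub>i]\<close> shows that \<open>u\<close> is an eigenvector of \<open>f\<^sub>*\<close> and that
  \<open>c\<^bsub>i+1\<^esub>|l\<^bsub>i+1\<^esub>| / (c\<^sub>i|l\<^sub>i|)\<close> tends to its eigenvalue. The closing curves exist because compact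
  length spaces are geodesic, and the leaves are complete because a leaf end of finite length
  would converge to a point of a foliation box.
\<close>

section \<open>Homology classes of paths\<close>

text \<open>Compactness is not drawn from \<open>N\<close> or from the dimension of the homology but
  from coefficients over one finite set \<open>F\<close> of classes. \<open>N\<close> and the
  induced map are related by no continuity assumption, yet limits taken coefficient by coefficient
  pass through every linear map, hence serve \<open>v\<close> and its image alike. A segment is not
  closed, so paths receive classes relative to chains from a base point; these classes add up under
  cutting and agree with the usual class on loops, which cancels the segment in the comparison of
  consecutive loops. To bound the class of \<open>f \<circ> b_i\<close>, the curve
  \<open>b_i\<close> is cut so finely that the pieces have small images as well: uniform continuity
  of \<open>f\<close> is enough, the length of the image never enters. The ratios of consecutive
  lengths need not converge, because \<open>c_i\<close> may oscillate between \<open>c_1\<close> and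
  \<open>c_2\<close>; the ratios of the products \<open>c_i |l_i|\<close> do. Averaging their
  logarithms gives the exponential rate, and the bounded term \<open>ln c_i\<close> disappears after
  division by \<open>i\<close>.\<close>

definition path_chain :: "(real \<Rightarrow> 'a) \<Rightarrow> 'a::topological_space real_chain" where
  "path_chain \<gamma> = Poly_Mapping.single (restrict (\<lambda>s. \<gamma> (s 1)) (standard_simplex 1)) 1"

definition point_chain :: "'a \<Rightarrow> 'a::topological_space real_chain" where
  "point_chain x = Poly_Mapping.single (restrict (\<lambda>_. x) (standard_simplex 0)) 1"

lemma lin_extend_single [simp]: "lin_extend b (Poly_Mapping.single \<sigma> 1) = b \<sigma>"
  by (simp add: lin_extend_def)

lemma lin_extend_uminus: "lin_extend b (- c) = - lin_extend b c"
  using lin_extend_scaleR[of b "-1" c] by simp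

lemma lin_extend_diff: "lin_extend b (c - d) = lin_extend b c - lin_extend b d"
  using lin_extend_add[of b c "- d"] by (simp add: lin_extend_uminus)

lemma real_boundary_diff: "real_boundary p (c - d) = real_boundary p c - real_boundary p d"
  by (simp add: real_boundary_def lin_extend_diff)

lemma real_singular_chain_diff:
  "real_singular_chain p c \<Longrightarrow> real_singular_chain p d \<Longrightarrow> real_singular_chain p (c - d)"
  using real_singular_chain_add[of p c "(-1) *\<^sub>R d"] real_singular_chain_scaleR[of p d "-1"] by simp

lemma real_1boundary_uminus: "real_1boundary c \<Longrightarrow> real_1boundary (- c)"
  using real_1boundary_scaleR[of c "-1"] by simp

lemma real_1boundary_diff: "real_1boundary c \<Longrightarrow> real_1boundary d \<Longrightarrow> real_1boundary (c - d)"
  using real_1boundary_add[of c "- d"] real_1boundary_uminus[of d] by simp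

lemma simplex_coordinate_01: "x \<in> standard_simplex p \<Longrightarrow> x i \<in> {0..1}"
  by (auto simp: standard_simplex_def)

lemma singular_simplex_iff_continuous_on:
  "singular_simplex p euclidean \<sigma> \<longleftrightarrow>
     continuous_on (standard_simplex p) \<sigma> \<and> \<sigma> \<in> extensional (standard_simplex p)"
  by (simp add: singular_simplex_def euclidean_product_topology)

lemma continuous_on_simplex_coordinate [continuous_intros]:
  "continuous_on S (\<lambda>x :: nat \<Rightarrow> real. x i)"
  by (rule continuous_on_product_coordinates[THEN continuous_on_subset]) auto

lemma real_singular_chain_path_chain:
  assumes "path \<gamma>" shows "real_singular_chain 1 (path_chain \<gamma>)"
proof -
  have "continuous_on (standard_simplex 1) (\<lambda>s. \<gamma> (s 1))"
    using assms unfolding path_def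
    by (rule continuous_on_compose2) (auto intro: continuous_intros simp: standard_simplex_def)
  then have "singular_simplex 1 euclidean (restrict (\<lambda>s. \<gamma> (s 1)) (standard_simplex 1))"
    by (simp add: singular_simplex_iff_continuous_on cong: continuous_on_cong)
  then show ?thesis by (simp add: path_chain_def real_singular_chain_def)
qed

lemma real_boundary_path_chain:
  "real_boundary 1 (path_chain \<gamma>) = point_chain (\<gamma> 1) - point_chain (\<gamma> 0)"
proof -
  have z: "x \<in> standard_simplex 0 \<Longrightarrow> x 0 = 1" for x by (auto simp: standard_simplex_0)
  \<comment> \<open>Face 0 omits vertex 0 and so leaves the end of the path; face 1 leaves its
    start.\<close>
  have 0: "singular_face 1 0 (restrict (\<lambda>s. \<gamma> (s 1)) (standard_simplex 1))
      = restrict (\<lambda>_. \<gamma> 1) (standard_simplex 0)"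
    using simplical_face_in_standard_simplex[of 1 0]
    by (auto simp: singular_face_def fun_eq_iff restrict_def simplical_face_def z)
  have 1: "singular_face 1 1 (restrict (\<lambda>s. \<gamma> (s 1)) (standard_simplex 1))
      = restrict (\<lambda>_. \<gamma> 0) (standard_simplex 0)"
    using simplical_face_in_standard_simplex[of 1 1]
    by (auto simp: singular_face_def fun_eq_iff restrict_def simplical_face_def z)
  have "{..Suc 0} = {0, 1}" by auto
  then show ?thesis
    unfolding real_boundary_def path_chain_def point_chain_def lin_extend_single
    using 0 1 by simp
qed

lemma real_1cycle_path_chain:
  assumes "path \<gamma>" "\<gamma> 1 = \<gamma> 0" shows "real_1cycle (path_chain \<gamma>)"
  using assms by (simp add: real_1cycle_def real_singular_chain_path_chain real_boundary_path_chain
      del: One_nat_def)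

lemma path_chain_cong:
  assumes "\<And>t. t \<in> {0..1} \<Longrightarrow> \<gamma> t = \<eta> t" shows "path_chain \<gamma> = path_chain \<eta>"
proof -
  have "restrict (\<lambda>s. \<gamma> (s 1)) (standard_simplex 1) = restrict (\<lambda>s. \<eta> (s 1)) (standard_simplex 1)"
    using assms simplex_coordinate_01 by (intro restrict_ext) blast
  then show ?thesis by (simp add: path_chain_def)
qed

text \<open>The triangle below the diagonal of the square, as a singular 2-simplex, has these three
  sides. Constant paths, homotopies and the cutting of paths are all special choices of
  \<open>H\<close>.\<close>

lemma real_1boundary_triangle:
  fixes H :: "real \<times> real \<Rightarrow> 'a::topological_space"
  assumes H: "continuous_on ({0..1} \<times> {0..1}) H"
  shows "real_1boundary (path_chain (\<lambda>s. H (s, 0)) + path_chain (\<lambda>s. H (1, s))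
           - path_chain (\<lambda>s. H (s, s)))"
proof -
  \<comment> \<open>The vertices 0, 1, 2 go to the corners (0,0), (1,0), (1,1).\<close>
  define \<sigma> where "\<sigma> = restrict (\<lambda>x :: nat \<Rightarrow> real. H (x 1 + x 2, x 2)) (standard_simplex 2)"
  have e2: "{..2::nat} = {0, 1, 2}" "{..Suc 0} = {0,1}" by auto
  have sum2: "x 0 + x 1 + x 2 = 1" if "x \<in> standard_simplex 2" for x
    using that by (auto simp: standard_simplex_def e2)
  have mem: "(x 1 + x 2, x 2) \<in> {0..1} \<times> {0..1}" if "x \<in> standard_simplex 2" for x
    using sum2[OF that] simplex_coordinate_01[OF that, of 0] simplex_coordinate_01[OF that, of 1]
      simplex_coordinate_01[OF that, of 2] by auto
  have "continuous_on (standard_simplex 2) (\<lambda>x :: nat \<Rightarrow> real. H (x 1 + x 2, x 2))"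
    by (rule continuous_on_compose2[OF H]) (use mem in \<open>auto intro!: continuous_intros\<close>)
  then have sing: "singular_simplex 2 euclidean \<sigma>"
    by (simp add: singular_simplex_iff_continuous_on \<sigma>_def cong: continuous_on_cong)
  have s1: "x 0 + x 1 = 1" if "x \<in> standard_simplex 1" for x
    using that by (auto simp: standard_simplex_def e2)
  have f: "simplical_face k x \<in> standard_simplex 2" if "x \<in> standard_simplex 1" "k \<le> 2" for k x
    using simplical_face_in_standard_simplex[of 2 k x] that by simp
  have f0: "singular_face 2 0 \<sigma> = restrict (\<lambda>s. H (1, s 1)) (standard_simplex 1)"
    using s1 f[where k = 0]
    by (auto simp: singular_face_def fun_eq_iff restrict_def simplical_face_def \<sigma>_def numeral_2_eq_2)
  have f1: "singular_face 2 1 \<sigma> = restrict (\<lambda>s. H (s 1, s 1)) (standard_simplex 1)"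
    using s1 f[where k = 1]
    by (auto simp: singular_face_def fun_eq_iff restrict_def simplical_face_def \<sigma>_def numeral_2_eq_2)
  have f2: "singular_face 2 2 \<sigma> = restrict (\<lambda>s. H (s 1, 0)) (standard_simplex 1)"
    using s1 f[where k = 2]
    by (auto simp: singular_face_def fun_eq_iff restrict_def simplical_face_def \<sigma>_def numeral_2_eq_2)
  have "real_boundary 2 (Poly_Mapping.single \<sigma> 1) =
      path_chain (\<lambda>s. H (1, s)) - path_chain (\<lambda>s. H (s, s)) + path_chain (\<lambda>s. H (s, 0))"
    unfolding real_boundary_def lin_extend_single e2
    by (simp add: f0 f1 f2[simplified numeral_2_eq_2] f2 path_chain_def del: One_nat_def)
  moreover have "real_singular_chain 2 (Poly_Mapping.single \<sigma> 1)"
    using sing by (simp add: real_singular_chain_def)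
  ultimately show ?thesis
    unfolding real_1boundary_def
    by (intro exI[of _ "Poly_Mapping.single \<sigma> 1"]) (simp add: algebra_simps)
qed

text \<open>All sides of a constant triangle coincide; with signs +, +, - one copy survives.\<close>

lemma real_1boundary_const_path: "real_1boundary (path_chain (\<lambda>_. x))"
  using real_1boundary_triangle[of "\<lambda>_. x"] by simp

text \<open>The two triangles of the homotopy square share the diagonal, which cancels. Two of the
  remaining sides are constant because the end points stay fixed.\<close>

lemma real_1boundary_homotopic_paths:
  assumes "homotopic_paths S p q"
  shows "real_1boundary (path_chain p - path_chain q)"
proof -
  obtain h :: "real \<times> real \<Rightarrow> _" where h: "continuous_on ({0..1} \<times> {0..1}) h"
    and h': "\<forall>x\<in>{0..1}. h (0, x) = p x" "\<forall>x\<in>{0..1}. h (1, x) = q x"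
      "\<forall>t\<in>{0..1}. pathstart (h \<circ> Pair t) = pathstart p \<and> pathfinish (h \<circ> Pair t) = pathfinish p"
    using assms unfolding homotopic_paths by blast
  \<comment> \<open>Exchanging the coordinates turns the upper triangle of the square into a lower
    one.\<close>
  have "continuous_on ({0..1} \<times> {0..1}) (\<lambda>z. h (snd z, fst z))"
    by (rule continuous_on_compose2[OF h]) (auto intro!: continuous_intros)
  from real_1boundary_triangle[OF this]
  have 1: "real_1boundary (path_chain (\<lambda>s. h (0, s)) + path_chain (\<lambda>s. h (s, 1)) - path_chain (\<lambda>s. h (s, s)))"
    by simp
  have "path_chain (\<lambda>s. h (0, s)) = path_chain p" "path_chain (\<lambda>s. h (1, s)) = path_chain q"
    "path_chain (\<lambda>s. h (s, 1)) = path_chain (\<lambda>_. p 1)" "path_chain (\<lambda>s. h (s, 0)) = path_chain (\<lambda>_. p 0)"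
    using h' by (auto intro!: path_chain_cong simp: pathstart_def pathfinish_def)
  note e = this
  have 2: "real_1boundary (path_chain (\<lambda>_. p 0) + path_chain q - path_chain (\<lambda>s. h (s, s)))"
    using real_1boundary_triangle[OF h] by (simp only: e)
  have "real_1boundary (((path_chain p + path_chain (\<lambda>_. p 1) - path_chain (\<lambda>s. h (s, s)))
     - (path_chain (\<lambda>_. p 0) + path_chain q - path_chain (\<lambda>s. h (s, s))))
     - path_chain (\<lambda>_. p 1) + path_chain (\<lambda>_. p 0))"
    by (rule real_1boundary_add[OF real_1boundary_diff[OF real_1boundary_diff[OF 1[unfolded e] 2]]];
        rule real_1boundary_const_path)
  then show ?thesis by (simp add: algebra_simps)
qed

text \<open>\<^const>\<open>subpath\<close> is restricted to normed spaces.\<close>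

definition subarc :: "real \<Rightarrow> real \<Rightarrow> (real \<Rightarrow> 'a) \<Rightarrow> real \<Rightarrow> 'a" where
  "subarc a b \<gamma> = (\<lambda>s. \<gamma> (a + (b - a) * s))"

lemma affine_01_mem:
  assumes "0 \<le> a" "a \<le> b" "b \<le> 1" "s \<in> {0..1::real}"
  shows "a + (b - a) * s \<in> {a..b}"
proof -
  have "0 \<le> (b - a) * s" "(b - a) * s \<le> b - a"
    using assms by (auto intro: mult_left_le)
  then show ?thesis by simp
qed

lemma path_subarc:
  assumes "path \<gamma>" "0 \<le> a" "a \<le> b" "b \<le> 1"
  shows "path (subarc a b \<gamma>)"
  using assms(1) unfolding path_def subarc_def
  by (rule continuous_on_compose2) (use affine_01_mem[OF assms(2-4)] assms in \<open>force intro!: continuous_intros\<close>)+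

text \<open>A triangle that factors through the parameter interval: the horizontal side runs from
  \<open>a\<close> to \<open>b\<close>, the vertical one from \<open>b\<close> to \<open>c\<close>,
  and the diagonal from \<open>a\<close> to \<open>c\<close>.\<close>

lemma real_1boundary_subarc:
  assumes "path \<gamma>" "0 \<le> a" "a \<le> b" "b \<le> c" "c \<le> 1"
  shows "real_1boundary (path_chain (subarc a b \<gamma>) + path_chain (subarc b c \<gamma>)
           - path_chain (subarc a c \<gamma>))"
proof -
  let ?H = "\<lambda>z :: real \<times> real. \<gamma> (a + (b - a) * fst z + (c - b) * snd z)"
  have "0 \<le> a + (b - a) * x + (c - b) * y \<and> a + (b - a) * x + (c - b) * y \<le> 1"
    if "x \<in> {0..1}" "y \<in> {0..1}" for x y :: real
  proof -
    have "0 \<le> (b - a) * x" "0 \<le> (c - b) * y" "(b - a) * x \<le> b - a" "(c - b) * y \<le> c - b"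
      using that assms by (auto intro: mult_nonneg_nonneg mult_left_le)
    then show ?thesis using assms by linarith
  qed
  then have sub: "(\<lambda>z. a + (b - a) * fst z + (c - b) * snd z) ` ({0..1} \<times> {0..1}) \<subseteq> {0..1}"
    by fastforce
  have "continuous_on ({0..1} \<times> {0..1}) ?H"
    by (rule continuous_on_compose2[OF assms(1)[unfolded path_def] _ sub]) (intro continuous_intros)
  from real_1boundary_triangle[OF this]
  have "real_1boundary (path_chain (\<lambda>s. \<gamma> (a + (b - a) * s)) + path_chain (\<lambda>s. \<gamma> (b + (c - b) * s))
    - path_chain (\<lambda>s. \<gamma> (a + (b - a) * s + (c - b) * s)))" by simp
  moreover have "a + (b - a) * s + (c - b) * s = a + (c - a) * s" for s
    by (simp add: algebra_simps)
  ultimately show ?thesis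
    by (simp only: subarc_def)
qed

text \<open>The joined path is cut at time 1/2, and \<open>subarc\<close> undoes the double speed of
  the halves.\<close>

lemma real_1boundary_join:
  assumes "path p" "path q" "pathfinish p = pathstart q"
  shows "real_1boundary (path_chain p + path_chain q - path_chain (p +++ q))"
proof -
  have "path (p +++ q)" using assms by simp
  then have "real_1boundary (path_chain (subarc 0 (1/2) (p +++ q)) + path_chain (subarc (1/2) 1 (p +++ q))
     - path_chain (subarc 0 1 (p +++ q)))"
    by (rule real_1boundary_subarc) auto
  moreover have "path_chain (subarc 0 (1/2) (p +++ q)) = path_chain p"
    by (rule path_chain_cong) (auto simp: subarc_def joinpaths_def)
  moreover have "path_chain (subarc (1/2) 1 (p +++ q)) = path_chain q"
    using assms(3)
    by (intro path_chain_cong) (auto simp: subarc_def joinpaths_def pathstart_def pathfinish_def field_simps)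
  moreover have "subarc 0 1 (p +++ q) = p +++ q" by (simp add: subarc_def)
  ultimately show ?thesis by simp
qed

section \<open>Classes of cycles and the induced map on homology\<close>

lemma H1_class_eq_iff:
  assumes "real_1cycle c" "real_1cycle d"
  shows "H1_class c = H1_class d \<longleftrightarrow> real_1boundary (c - d)"
  using Quotient_rel[OF Quotient_real_H1, of c d] assms
  by (auto simp: homologous_1cycles_def)

lemma H1_class_add:
  assumes "real_1cycle c" "real_1cycle d"
  shows "H1_class (c + d) = H1_class c + H1_class d"
  using assms by (metis homologous_1cycles_def diff_self plus_real_H1.abs_eq real_1boundary_0)

lemma H1_class_scaleR:
  assumes "real_1cycle c" shows "H1_class (a *\<^sub>R c) = a *\<^sub>R H1_class c"
  using assms by (metis homologous_1cycles_def diff_self scaleR_real_H1.abs_eq real_1boundary_0)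

lemma rep_H1_cycle: "real_1cycle (rep_H1 h)"
  using Quotient_rep_reflp[OF Quotient_real_H1, of h] by (simp add: homologous_1cycles_def)

lemma H1_class_rep_H1: "H1_class (rep_H1 h) = h"
  by (rule Quotient_abs_rep[OF Quotient_real_H1])

lemma loop_class_eq_H1_class: "loop_class l = H1_class (path_chain l)"
  by (simp add: loop_class_def path_chain_def)

text \<open>The chain map behind \<open>H1_map\<close>. The degree is a parameter because boundaries
  are pushed through their 2-chains.\<close>

definition push_chain :: "nat \<Rightarrow> ('a \<Rightarrow> 'a) \<Rightarrow> 'a::topological_space real_chain \<Rightarrow> 'a real_chain" where
  "push_chain p f = lin_extend (\<lambda>\<sigma>. Poly_Mapping.single (simplex_map p f \<sigma>) 1)"

lemma push_chain_add: "push_chain p f (c + d) = push_chain p f c + push_chain p f d"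
  and push_chain_diff: "push_chain p f (c - d) = push_chain p f c - push_chain p f d"
  and push_chain_scaleR: "push_chain p f (a *\<^sub>R c) = a *\<^sub>R push_chain p f c"
  by (simp_all add: push_chain_def lin_extend_add lin_extend_diff lin_extend_scaleR)

lemma push_chain_path_chain: "push_chain 1 f (path_chain \<gamma>) = path_chain (f \<circ> \<gamma>)"
  unfolding push_chain_def path_chain_def lin_extend_single
  by (rule arg_cong[where f = "\<lambda>\<sigma>. Poly_Mapping.single \<sigma> 1"]) (auto simp: simplex_map_def fun_eq_iff restrict_def)

lemma lin_extend_sum: "lin_extend b (sum c I) = (\<Sum>i\<in>I. lin_extend b (c i))"
  by (induction I rule: infinite_finite_induct) (simp_all add: lin_extend_add)

lemma real_singular_chain_sum:
  "(\<And>i. i \<in> I \<Longrightarrow> real_singular_chain p (c i)) \<Longrightarrow> real_singular_chain p (sum c I)"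
  by (induction I rule: infinite_finite_induct) (simp_all add: real_singular_chain_add)

lemma real_singular_chain_push_chain:
  assumes f: "continuous_on UNIV f" and c: "real_singular_chain p c"
  shows "real_singular_chain p (push_chain p f c)"
proof -
  have "singular_simplex p euclidean (simplex_map p f \<sigma>)" if "\<sigma> \<in> Poly_Mapping.keys c" for \<sigma>
    using that c f by (auto simp: real_singular_chain_def intro!: singular_simplex_simplex_map)
  then show ?thesis
    unfolding push_chain_def lin_extend_def
    by (intro real_singular_chain_sum real_singular_chain_scaleR) (simp add: real_singular_chain_def)
qed

lemma real_boundary_push_chain:
  assumes c: "real_singular_chain p c" and p: "1 \<le> p"
  shows "real_boundary p (push_chain p f c) = push_chain (p - 1) f (real_boundary p c)"
proof -
  have face: "singular_face p k (simplex_map p f \<sigma>) = simplex_map (p - 1) f (singular_face p k \<sigma>)"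
    if "k \<le> p" for k \<sigma>
    using that p by (auto simp add: singular_face_def simplex_map_def fun_eq_iff
        simplical_face_in_standard_simplex)
  have "real_boundary p (push_chain p f c) = (\<Sum>\<sigma>\<in>Poly_Mapping.keys c. Poly_Mapping.lookup c \<sigma> *\<^sub>R
     (\<Sum>k\<le>p. (-1) ^ k *\<^sub>R Poly_Mapping.single (singular_face p k (simplex_map p f \<sigma>)) 1))"
    unfolding real_boundary_def push_chain_def lin_extend_def[of "\<lambda>\<sigma>. Poly_Mapping.single (simplex_map p f \<sigma>) 1"]
    by (simp add: lin_extend_sum lin_extend_scaleR)
  also have "\<dots> = (\<Sum>\<sigma>\<in>Poly_Mapping.keys c. Poly_Mapping.lookup c \<sigma> *\<^sub>R
     (\<Sum>k\<le>p. (-1) ^ k *\<^sub>R Poly_Mapping.single (simplex_map (p - 1) f (singular_face p k \<sigma>)) 1))"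
    by (simp add: face)
  also have "\<dots> = push_chain (p - 1) f (real_boundary p c)"
    unfolding real_boundary_def push_chain_def
      lin_extend_def[of "\<lambda>\<sigma>. \<Sum>k\<le>p. (-1) ^ k *\<^sub>R Poly_Mapping.single (singular_face p k \<sigma>) 1"]
    by (simp add: lin_extend_sum lin_extend_scaleR)
  finally show ?thesis .
qed

lemma real_1cycle_push_chain:
  assumes "continuous_on UNIV f" "real_1cycle c" shows "real_1cycle (push_chain 1 f c)"
  using assms real_singular_chain_push_chain[of f 1 c] real_boundary_push_chain[of 1 c f]
  by (simp add: real_1cycle_def push_chain_def del: One_nat_def)

lemma real_1boundary_push_chain:
  assumes "continuous_on UNIV f" "real_1boundary c" shows "real_1boundary (push_chain 1 f c)"
proof -
  obtain d where d: "real_singular_chain 2 d" "c = real_boundary 2 d"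
    using assms(2) by (auto simp: real_1boundary_def)
  then have "push_chain 1 f c = real_boundary 2 (push_chain 2 f d)"
    using real_boundary_push_chain[of 2 d f] by simp
  then show ?thesis
    using real_singular_chain_push_chain[OF assms(1) d(1)] by (auto simp: real_1boundary_def)
qed

text \<open>The representative chosen by \<open>rep_H1\<close> differs from \<open>c\<close> by a
  boundary, and \<open>f\<close> carries boundaries to boundaries.\<close>

lemma H1_map_H1_class:
  assumes f: "continuous_on UNIV f" and c: "real_1cycle c"
  shows "H1_map f (H1_class c) = H1_class (push_chain 1 f c)"
proof -
  have "H1_class (rep_H1 (H1_class c)) = H1_class c" by (rule H1_class_rep_H1)
  then have "real_1boundary (rep_H1 (H1_class c) - c)"
    using H1_class_eq_iff rep_H1_cycle c by blast
  then have "real_1boundary (push_chain 1 f (rep_H1 (H1_class c)) - push_chain 1 f c)"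
    using real_1boundary_push_chain[OF f] by (fastforce simp: push_chain_diff)
  then show ?thesis
    unfolding H1_map_def push_chain_def[symmetric]
    using H1_class_eq_iff real_1cycle_push_chain[OF f] rep_H1_cycle c by blast
qed

lemma H1_map_add:
  assumes f: "continuous_on UNIV f" shows "H1_map f (h + k) = H1_map f h + H1_map f k"
proof -
  have "H1_map f (h + k) = H1_map f (H1_class (rep_H1 h + rep_H1 k))"
    by (simp add: H1_class_add rep_H1_cycle H1_class_rep_H1)
  also have "\<dots> = H1_class (push_chain 1 f (rep_H1 h)) + H1_class (push_chain 1 f (rep_H1 k))"
    using H1_class_add[OF real_1cycle_push_chain[OF f rep_H1_cycle] real_1cycle_push_chain[OF f rep_H1_cycle]]
    by (subst H1_map_H1_class[OF f]) (simp_all add: real_1cycle_add rep_H1_cycle push_chain_add)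
  finally show ?thesis by (simp add: H1_map_def push_chain_def)
qed

lemma H1_map_scaleR:
  assumes f: "continuous_on UNIV f" shows "H1_map f (a *\<^sub>R h) = a *\<^sub>R H1_map f h"
proof -
  have "H1_map f (a *\<^sub>R h) = H1_map f (H1_class (a *\<^sub>R rep_H1 h))"
    by (simp add: H1_class_scaleR rep_H1_cycle H1_class_rep_H1)
  also have "\<dots> = a *\<^sub>R H1_class (push_chain 1 f (rep_H1 h))"
    using H1_class_scaleR[OF real_1cycle_push_chain[OF f rep_H1_cycle]]
    by (subst H1_map_H1_class[OF f]) (simp_all add: real_1cycle_scaleR rep_H1_cycle push_chain_scaleR)
  finally show ?thesis by (simp add: H1_map_def push_chain_def)
qed

lemma H1_map_loop_class:
  assumes "continuous_on UNIV f" "path l" "l 1 = l 0"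
  shows "H1_map f (loop_class l) = loop_class (f \<circ> l)"
  using assms H1_map_H1_class[OF assms(1) real_1cycle_path_chain[OF assms(2,3)]]
  by (simp add: loop_class_eq_H1_class push_chain_path_chain del: One_nat_def)

text \<open>A path with end points \<open>p\<close>, \<open>q\<close> is completed to a cycle by means of chains \<open>\<rho> p\<close>, \<open>\<rho> q\<close> that
  join a base point to \<open>p\<close> and \<open>q\<close>; this makes homology classes additive along a path.\<close>

definition lasso_class :: "('a \<Rightarrow> 'a real_chain) \<Rightarrow> (real \<Rightarrow> 'a) \<Rightarrow> 'a::topological_space real_H1" where
  "lasso_class \<rho> \<gamma> = H1_class (\<rho> (\<gamma> 0) + path_chain \<gamma> - \<rho> (\<gamma> 1))"

text \<open>Only the boundary of each chain is prescribed, so \<open>\<rho> q\<close> may be a sum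
  of paths and may vary discontinuously with \<open>q\<close>.\<close>

definition joining_chains :: "'a \<Rightarrow> ('a \<Rightarrow> 'a::topological_space real_chain) \<Rightarrow> bool" where
  "joining_chains x0 \<rho> \<longleftrightarrow> (\<forall>q. real_singular_chain 1 (\<rho> q) \<and> real_boundary 1 (\<rho> q) = point_chain q - point_chain x0)"

lemma real_1cycle_lasso:
  assumes "joining_chains x0 \<rho>" "path \<gamma>"
  shows "real_1cycle (\<rho> (\<gamma> 0) + path_chain \<gamma> - \<rho> (\<gamma> 1))"
  using assms unfolding joining_chains_def real_1cycle_def
  by (simp add: real_singular_chain_add real_singular_chain_diff real_singular_chain_path_chain
      real_boundary_add real_boundary_diff real_boundary_path_chain del: One_nat_def)

lemma lasso_class_loop:
  assumes \<rho>: "joining_chains x0 \<rho>" and "path l" "l 1 = l 0"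
  shows "lasso_class \<rho> l = loop_class l"
  using assms by (simp add: lasso_class_def loop_class_eq_H1_class)

text \<open>The chain attached to the common middle point enters with both signs and
  cancels.\<close>

lemma lasso_class_add:
  assumes \<rho>: "joining_chains x0 \<rho>" and p: "path p" "path q" "path r"
    and e: "p 0 = r 0" "p 1 = q 0" "q 1 = r 1"
    and b: "real_1boundary (path_chain p + path_chain q - path_chain r)"
  shows "lasso_class \<rho> r = lasso_class \<rho> p + lasso_class \<rho> q"
proof -
  note c = real_1cycle_lasso[OF \<rho>]
  have "lasso_class \<rho> p + lasso_class \<rho> q =
      H1_class ((\<rho> (p 0) + path_chain p - \<rho> (p 1)) + (\<rho> (q 0) + path_chain q - \<rho> (q 1)))"
    unfolding lasso_class_def by (rule H1_class_add[symmetric]; rule c; rule p)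
  also have "\<dots> = lasso_class \<rho> r"
    unfolding lasso_class_def
    using b e by (subst H1_class_eq_iff[OF real_1cycle_add[OF c[OF p(1)] c[OF p(2)]] c[OF p(3)]])
      (simp add: algebra_simps)
  finally show ?thesis by simp
qed

lemma lasso_class_join:
  assumes "joining_chains x0 \<rho>" "path p" "path q" "pathfinish p = pathstart q"
  shows "lasso_class \<rho> (p +++ q) = lasso_class \<rho> p + lasso_class \<rho> q"
  using assms
  by (intro lasso_class_add[OF assms(1)] real_1boundary_join path_join_imp)
    (auto simp: pathstart_def pathfinish_def, auto simp: joinpaths_def)

lemma lasso_class_subarc:
  assumes "joining_chains x0 \<rho>" "path \<gamma>" "0 \<le> a" "a \<le> b" "b \<le> c" "c \<le> 1"
  shows "lasso_class \<rho> (subarc a c \<gamma>) = lasso_class \<rho> (subarc a b \<gamma>) + lasso_class \<rho> (subarc b c \<gamma>)"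
  using assms
  by (intro lasso_class_add[OF assms(1)] real_1boundary_subarc path_subarc)
    (auto simp: subarc_def)

section \<open>Growth rates from normalized limits\<close>

lemma is_normD:
  assumes "is_norm N"
  shows "N v = 0 \<longleftrightarrow> v = 0" "N (v + w) \<le> N v + N w" "N (a *\<^sub>R v) = \<bar>a\<bar> * N v"
  using assms by (auto simp: is_norm_def)

lemma is_norm_minus: "is_norm N \<Longrightarrow> N (- v) = N v"
  using is_normD(3)[of N "-1" v] by simp

lemma is_norm_nonneg: "is_norm N \<Longrightarrow> 0 \<le> N v"
  using is_normD(2)[of N v "- v"] is_normD(1)[of N 0] is_norm_minus[of N v] by simp

lemma is_norm_diff: "is_norm N \<Longrightarrow> N (v - w) \<le> N v + N w"
  using is_normD(2)[of N v "- w"] is_norm_minus[of N w] by simp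

lemma is_norm_sum:
  assumes "is_norm N" shows "N (sum g I) \<le> (\<Sum>i\<in>I. N (g i))"
proof (induction I rule: infinite_finite_induct)
  case (insert x F)
  then show ?case using is_normD(2)[OF assms, of "g x" "sum g F"] by simp
qed (use is_normD(1)[OF assms, of 0] in simp_all)

lemma is_norm_abs_diff: "is_norm N \<Longrightarrow> \<bar>N v - N w\<bar> \<le> N (v - w)"
  using is_normD(2)[of N "v - w" w] is_normD(2)[of N "w - v" v] is_norm_minus[of N "v - w"] by simp

text \<open>A norm-free way to say that \<open>v\<close> lies in a bounded part of the span of
  \<open>F\<close>. The elements of \<open>F\<close> may be linearly dependent, so the coefficients
  are not determined by \<open>v\<close>.\<close>

definition coeff_bounded :: "'v::real_vector set \<Rightarrow> real \<Rightarrow> 'v \<Rightarrow> bool" where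
  "coeff_bounded F B v \<longleftrightarrow> (\<exists>a. (\<forall>k\<in>F. \<bar>a k\<bar> \<le> B) \<and> v = (\<Sum>k\<in>F. a k *\<^sub>R k))"

lemma coeff_bounded_add:
  assumes "coeff_bounded F B v" "coeff_bounded F C w" shows "coeff_bounded F (B + C) (v + w)"
proof -
  obtain a where a: "\<forall>k\<in>F. \<bar>a k\<bar> \<le> B" "v = (\<Sum>k\<in>F. a k *\<^sub>R k)"
    using assms(1) unfolding coeff_bounded_def by blast
  obtain b where b: "\<forall>k\<in>F. \<bar>b k\<bar> \<le> C" "w = (\<Sum>k\<in>F. b k *\<^sub>R k)"
    using assms(2) unfolding coeff_bounded_def by blast
  have "\<bar>a k + b k\<bar> \<le> B + C" if "k \<in> F" for k
    using a(1) b(1) that abs_triangle_ineq[of "a k" "b k"] by fastforce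
  moreover have "v + w = (\<Sum>k\<in>F. (a k + b k) *\<^sub>R k)"
    by (simp add: a(2) b(2) scaleR_left_distrib sum.distrib)
  ultimately show ?thesis unfolding coeff_bounded_def by (intro exI[of _ "\<lambda>k. a k + b k"]) simp
qed

lemma coeff_bounded_scaleR:
  assumes "coeff_bounded F B v" shows "coeff_bounded F (\<bar>c\<bar> * B) (c *\<^sub>R v)"
proof -
  obtain a where "\<forall>k\<in>F. \<bar>a k\<bar> \<le> B" "v = (\<Sum>k\<in>F. a k *\<^sub>R k)"
    using assms unfolding coeff_bounded_def by metis
  then show ?thesis unfolding coeff_bounded_def
    by (intro exI[of _ "\<lambda>k. c * a k"]) (auto simp: scaleR_sum_right abs_mult mult_left_mono)
qed

lemma coeff_bounded_mono: "coeff_bounded F B v \<Longrightarrow> B \<le> C \<Longrightarrow> coeff_bounded F C v"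
  unfolding coeff_bounded_def by (elim exE conjE, intro exI conjI) (auto intro: order_trans)

lemma coeff_bounded_member:
  assumes "finite F" "v \<in> F" shows "coeff_bounded F 1 v"
  unfolding coeff_bounded_def
  by (intro exI[of _ "\<lambda>k. if k = v then 1 else 0"])
    (use assms in \<open>auto simp: if_distrib[of "\<lambda>c. c *\<^sub>R _"] cong: if_cong\<close>)

text \<open>Bolzano-Weierstrass for one coordinate at a time; a further subsequence keeps the limits
  already obtained.\<close>

lemma bounded_coordinates_convergent_subsequence:
  fixes a :: "nat \<Rightarrow> 'k \<Rightarrow> real"
  assumes "finite F" "\<And>i k. k \<in> F \<Longrightarrow> \<bar>a i k\<bar> \<le> B"
  shows "\<exists>(n::nat \<Rightarrow> nat) a'. strict_mono n \<and> (\<forall>k\<in>F. (\<lambda>j. a (n j) k) \<longlonglongrightarrow> a' k)"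
  using assms
proof (induction F rule: finite_induct)
  case empty
  then show ?case by (auto intro!: exI[of _ id] strict_mono_id)
next
  case (insert x F)
  then obtain n a' where n: "strict_mono (n::nat \<Rightarrow> nat)" "\<forall>k\<in>F. (\<lambda>j. a (n j) k) \<longlonglongrightarrow> a' k"
    by auto
  have "bounded (range (\<lambda>j. a (n j) x))"
    using insert.prems[of x] by (auto simp: bounded_iff)
  then obtain l r where r: "strict_mono (r::nat \<Rightarrow> nat)" "((\<lambda>j. a (n j) x) \<circ> r) \<longlonglongrightarrow> l"
    using bounded_imp_convergent_subsequence by blast
  have "strict_mono (n \<circ> r)" using n(1) r(1) by (rule strict_mono_o)
  moreover have "\<forall>k\<in>insert x F. (\<lambda>j. a ((n \<circ> r) j) k) \<longlonglongrightarrow> (a'(x := l)) k"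
  proof
    fix k assume "k \<in> insert x F"
    then show "(\<lambda>j. a ((n \<circ> r) j) k) \<longlonglongrightarrow> (a'(x := l)) k"
      using r(2) LIMSEQ_subseq_LIMSEQ[OF n(2)[rule_format] r(1), of k] by (cases "k = x") (auto simp: o_def)
  qed
  ultimately show ?case by blast
qed

text \<open>Subsequence and limit come from the coefficients, before any norm or map is named. Hence
  the same pair works for the identity and for a linear map not known to be continuous.\<close>

lemma coeff_bounded_convergent_subsequence:
  fixes v :: "nat \<Rightarrow> 'a::real_vector"
  assumes F: "finite F" and v: "\<And>i. coeff_bounded F B (v i)"
  obtains n h where "strict_mono (n::nat \<Rightarrow> nat)"
    "\<And>(N :: 'b::real_vector \<Rightarrow> real) (T :: 'a \<Rightarrow> 'b). is_norm N \<Longrightarrow> Modules.additive T \<Longrightarrow> (\<And>c x. T (c *\<^sub>R x) = c *\<^sub>R T x)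
       \<Longrightarrow> (\<lambda>j. N (T (v (n j)) - T h)) \<longlonglongrightarrow> 0"
proof -
  obtain a where a: "\<And>i k. k \<in> F \<Longrightarrow> \<bar>a i k\<bar> \<le> B" "\<And>i. v i = (\<Sum>k\<in>F. a i k *\<^sub>R k)"
    using v unfolding coeff_bounded_def by metis
  obtain n a' where n: "strict_mono (n::nat \<Rightarrow> nat)" "\<And>k. k \<in> F \<Longrightarrow> (\<lambda>j. a (n j) k) \<longlonglongrightarrow> a' k"
    using bounded_coordinates_convergent_subsequence[of F a B, OF F a(1)] by blast
  show ?thesis
  proof (rule that[OF n(1), of "\<Sum>k\<in>F. a' k *\<^sub>R k"])
    fix N :: "'b \<Rightarrow> real" and T :: "'a \<Rightarrow> 'b"
    assume N: "is_norm N" and T: "Modules.additive T" "\<And>c x. T (c *\<^sub>R x) = c *\<^sub>R T x"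
    have "T (v (n j)) - T (\<Sum>k\<in>F. a' k *\<^sub>R k) = (\<Sum>k\<in>F. (a (n j) k - a' k) *\<^sub>R T k)" for j
      by (simp add: a(2) additive.sum[OF T(1)] T(2) sum_subtractf scaleR_left_diff_distrib)
    then have le: "N (T (v (n j)) - T (\<Sum>k\<in>F. a' k *\<^sub>R k)) \<le> (\<Sum>k\<in>F. \<bar>a (n j) k - a' k\<bar> * N (T k))" for j
      using is_norm_sum[OF N, of "\<lambda>k. (a (n j) k - a' k) *\<^sub>R T k" F] by (simp add: is_normD(3)[OF N])
    have lim: "(\<lambda>j. \<Sum>k\<in>F. \<bar>a (n j) k - a' k\<bar> * N (T k)) \<longlonglongrightarrow> 0"
    proof (rule tendsto_null_sum)
      fix k assume "k \<in> F"
      then have "(\<lambda>j. \<bar>a (n j) k - a' k\<bar> * N (T k)) \<longlonglongrightarrow> \<bar>a' k - a' k\<bar> * N (T k)"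
        by (intro tendsto_intros n(2))
      then show "(\<lambda>j. \<bar>a (n j) k - a' k\<bar> * N (T k)) \<longlonglongrightarrow> 0" by simp
    qed
    show "(\<lambda>j. N (T (v (n j)) - T (\<Sum>k\<in>F. a' k *\<^sub>R k))) \<longlonglongrightarrow> 0"
      by (rule Lim_null_comparison[OF always_eventually lim])
        (simp only: real_norm_def abs_of_nonneg[OF is_norm_nonneg[OF N]] le simp_thms)
  qed
qed

text \<open>Linearity alone bounds \<open>T\<close> here, since only its values on the finite set
  \<open>F\<close> matter.\<close>

lemma coeff_bounded_norm_bound:
  assumes F: "finite F" and N: "is_norm N" and T: "Modules.additive T" "\<And>c x. T (c *\<^sub>R x) = c *\<^sub>R T x"
    and v: "coeff_bounded F B v"
  shows "N (T v) \<le> B * (\<Sum>k\<in>F. N (T k))"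
proof -
  obtain a where a: "\<And>k. k \<in> F \<Longrightarrow> \<bar>a k\<bar> \<le> B" "v = (\<Sum>k\<in>F. a k *\<^sub>R k)"
    using v unfolding coeff_bounded_def by metis
  have "N (T v) \<le> (\<Sum>k\<in>F. \<bar>a k\<bar> * N (T k))"
    using is_norm_sum[OF N, of "\<lambda>k. a k *\<^sub>R T k" F]
    by (simp add: a(2) additive.sum[OF T(1)] T(2) is_normD(3)[OF N])
  also have "\<dots> \<le> (\<Sum>k\<in>F. B * N (T k))"
    by (intro sum_mono mult_right_mono a is_norm_nonneg[OF N])
  finally show ?thesis by (simp add: sum_distrib_left)
qed

section \<open>Cesaro means and logarithmic growth\<close>

lemma tendsto_average:
  fixes x :: "nat \<Rightarrow> real"
  assumes "x \<longlonglongrightarrow> l" shows "(\<lambda>n. 1 / real n * (\<Sum>i<n. x i)) \<longlonglongrightarrow> l"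
proof -
  have "(\<lambda>n. 1 / real n * (\<Sum>i<n. x i - l)) \<longlonglongrightarrow> 0"
  proof (rule LIMSEQ_I)
    fix e :: real assume e: "0 < e"
    then obtain k where k: "\<And>n. n \<ge> k \<Longrightarrow> \<bar>x n - l\<bar> < e / 2"
      using LIMSEQ_D[OF assms, of "e / 2"] by auto
    define S where "S = (\<Sum>i<k. \<bar>x i - l\<bar>)"
    \<comment> \<open>Beyond \<open>m\<close> the fixed initial sum \<open>S\<close> is below
      \<open>n * (e / 2)\<close>; every later term contributes at most \<open>e / 2\<close>.\<close>
    obtain m where m: "real m > 2 * S / e" using reals_Archimedean2 by blast
    have "\<bar>1 / real n * (\<Sum>i<n. x i - l)\<bar> < e" if n: "n \<ge> max (Suc k) m" for n
    proof -
      have np: "real n > 0" using n by auto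
      have "{..<n} = {..<k} \<union> {k..<n}" "{..<k} \<inter> {k..<n} = {}" using n by auto
      then have "(\<Sum>i<n. \<bar>x i - l\<bar>) = S + (\<Sum>i=k..<n. \<bar>x i - l\<bar>)"
        unfolding S_def by (simp add: sum.union_disjoint)
      also have "(\<Sum>i=k..<n. \<bar>x i - l\<bar>) \<le> (\<Sum>i=k..<n. e / 2)"
        by (rule sum_mono) (use k in force)
      also have "\<dots> \<le> real n * (e / 2)" using e by (simp add: mult_right_mono)
      also have "S < real n * (e / 2)"
      proof -
        have "2 * S / e < real n" using m n by linarith
        then show ?thesis using e by (simp add: field_simps)
      qed
      finally have "(\<Sum>i<n. \<bar>x i - l\<bar>) < e * real n" by (simp add: field_simps)
      with sum_abs[of "\<lambda>i. x i - l" "{..<n}"] have "\<bar>\<Sum>i<n. x i - l\<bar> < e * real n" by linarith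
      then show ?thesis using np by (simp add: abs_mult divide_simps)
    qed
    then show "\<exists>no. \<forall>n\<ge>no. norm (1 / real n * (\<Sum>i<n. x i - l) - 0) < e"
      by (intro exI[of _ "max (Suc k) m"] allI impI) simp
  qed
  then have "(\<lambda>n. 1 / real n * (\<Sum>i<n. x i - l) + l) \<longlonglongrightarrow> 0 + l"
    by (intro tendsto_intros)
  moreover have "\<forall>\<^sub>F n in sequentially. 1 / real n * (\<Sum>i<n. x i - l) + l = 1 / real n * (\<Sum>i<n. x i)"
    using eventually_gt_at_top[of 0]
    by eventually_elim (simp add: sum_subtractf field_simps)
  ultimately show ?thesis by (simp add: tendsto_cong)
qed

text \<open>The logarithm of \<open>d n\<close> telescopes into logarithms of ratios, so up to
  \<open>ln (d 0) / n\<close> the claim is a Cesaro mean.\<close>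

lemma tendsto_ln_ratio:
  fixes d :: "nat \<Rightarrow> real"
  assumes d: "\<And>i. 0 < d i" and l: "0 < l" and r: "(\<lambda>i. d (Suc i) / d i) \<longlonglongrightarrow> l"
  shows "(\<lambda>n. 1 / real n * ln (d n)) \<longlonglongrightarrow> ln l"
proof -
  have "(\<lambda>i. ln (d (Suc i) / d i)) \<longlonglongrightarrow> ln l"
    using r l by (intro tendsto_ln) auto
  from tendsto_average[OF this]
  have "(\<lambda>n. 1 / real n * (\<Sum>i<n. ln (d (Suc i) / d i))) \<longlonglongrightarrow> ln l" .
  moreover have "(\<Sum>i<n. ln (d (Suc i) / d i)) = ln (d n) - ln (d 0)" for n
    using d by (simp add: ln_div sum_lessThan_telescope[of "\<lambda>i. ln (d i)"] less_imp_neq[THEN not_sym])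
  ultimately have "(\<lambda>n. 1 / real n * (ln (d n) - ln (d 0)) + 1 / real n * ln (d 0)) \<longlonglongrightarrow> ln l + 0 * ln (d 0)"
    by (intro tendsto_intros lim_1_over_n) simp
  then show ?thesis by (simp add: algebra_simps)
qed

text \<open>The dynamical argument in abstract form: \<open>v i\<close> stands for the class of the
  \<open>i\<close>-th loop, \<open>L i\<close> for its length, \<open>T\<close> for the induced map,
  and \<open>\<beta>\<close> bounds what the closing curves contribute.\<close>

lemma growth_rate_of_normalized_limits:
  fixes v :: "nat \<Rightarrow> 'v::real_vector" and L :: "nat \<Rightarrow> real"
  assumes N: "is_norm N" and T: "Modules.additive T" "\<And>c x. T (c *\<^sub>R x) = c *\<^sub>R T x"
    and F: "finite F" and c: "0 < c1" "c1 \<le> c2" and u: "N u = 1"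
    and L: "\<And>i. 0 < L i" "filterlim L at_top sequentially"
    and v: "\<And>i. coeff_bounded F (K * L i) (v i)"
    and \<beta>: "\<And>i. N (v (Suc i) - T (v i)) \<le> B"
    and lim: "\<And>n h. strict_mono (n::nat \<Rightarrow> nat) \<Longrightarrow>
       (\<lambda>j. N ((1 / L (n j)) *\<^sub>R v (n j) - h)) \<longlonglongrightarrow> 0 \<Longrightarrow> \<exists>c\<in>{c1..c2}. h = c *\<^sub>R u"
  shows "\<exists>l>0. T u = l *\<^sub>R u \<and> (\<lambda>i. 1 / real i * ln (L i)) \<longlonglongrightarrow> ln l"
proof -
  note N0 = is_norm_nonneg[OF N] and Nt = is_normD(2)[OF N] and Ns = is_normD(3)[OF N]
    and Nd = is_norm_diff[OF N] and Nm = is_norm_minus[OF N] and Nz = is_normD(1)[OF N]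
  have Tadd: "T (x + y) = T x + T y" for x y using T(1) by (rule additive.add)
  have Tdiff: "T (x - y) = T x - T y" for x y using T(1) by (rule additive.diff)
  have Lpos: "0 < L i" "L i \<noteq> 0" for i using L(1)[of i] by auto
  define w where "w i = (1 / L i) *\<^sub>R v i" for i
  have w: "coeff_bounded F K (w i)" for i
    using coeff_bounded_scaleR[OF v, of "1 / L i" i] Lpos[of i] by (simp add: w_def abs_mult)
  \<comment> \<open>A nearest point to \<open>w i\<close> on the segment of admissible limits. It
    need not be unique, so one is selected for each \<open>i\<close>.\<close>
  have "\<exists>c\<in>{c1..c2}. \<forall>c'\<in>{c1..c2}. N (w i - c *\<^sub>R u) \<le> N (w i - c' *\<^sub>R u)" for i
  proof (rule continuous_attains_inf)
    have "continuous_on UNIV (\<lambda>c. N (w i - c *\<^sub>R u))"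
    proof (rule lipschitz_on_continuous_on[of 1], rule lipschitz_onI)
      fix x y
      have "\<bar>N (w i - x *\<^sub>R u) - N (w i - y *\<^sub>R u)\<bar> \<le> N ((y - x) *\<^sub>R u)"
        using is_norm_abs_diff[OF N, of "w i - x *\<^sub>R u" "w i - y *\<^sub>R u"] by (simp add: algebra_simps)
      then show "dist (N (w i - x *\<^sub>R u)) (N (w i - y *\<^sub>R u)) \<le> 1 * dist x y"
        by (simp add: Ns u dist_real_def)
    qed simp
    then show "continuous_on {c1..c2} (\<lambda>c. N (w i - c *\<^sub>R u))"
      by (rule continuous_on_subset) simp
  qed (use c in auto)
  then obtain \<gamma> where \<gamma>: "\<And>i. \<gamma> i \<in> {c1..c2}"
    and \<gamma>min: "\<And>i c'. c' \<in> {c1..c2} \<Longrightarrow> N (w i - \<gamma> i *\<^sub>R u) \<le> N (w i - c' *\<^sub>R u)"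
    by metis
  have \<gamma>pos: "0 < \<gamma> i" "c1 \<le> \<gamma> i" "\<gamma> i \<le> c2" "\<gamma> i \<noteq> 0" for i using \<gamma>[of i] c by auto
  define e where "e i = w i - \<gamma> i *\<^sub>R u" for i
  \<comment> \<open>Both errors are put into one sum: \<open>T\<close> is not known to be continuous
    for \<open>N\<close>, so the second does not follow from the first.\<close>
  have e0: "(\<lambda>i. N (e i) + N (T (e i))) \<longlonglongrightarrow> 0"
  proof (rule ccontr)
    assume "\<not> ?thesis"
    then obtain \<epsilon> where \<epsilon>: "\<epsilon> > 0" and "\<not> (\<forall>\<^sub>F i in sequentially. dist (N (e i) + N (T (e i))) 0 < \<epsilon>)"
      unfolding tendsto_iff by blast
    then have "\<exists>\<^sub>\<infinity>i. dist (N (e i) + N (T (e i))) 0 \<ge> \<epsilon>"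
      by (simp add: frequently_def not_le cofinite_eq_sequentially)
    then have "infinite {i. dist (N (e i) + N (T (e i))) 0 \<ge> \<epsilon>}"
      by (simp add: INFM_iff_infinite)
    then obtain r where r: "strict_mono (r::nat \<Rightarrow> nat)"
        "\<And>j. dist (N (e (r j)) + N (T (e (r j)))) 0 \<ge> \<epsilon>"
      using infinite_enumerate by blast
    \<comment> \<open>Along this one subsequence both \<open>w\<close> and \<open>T w\<close>
      converge, the latter to \<open>T h\<close> with the same \<open>h\<close>.\<close>
    obtain n h where n: "strict_mono (n::nat \<Rightarrow> nat)" and
      h: "\<And>N' T'. is_norm N' \<Longrightarrow> Modules.additive T' \<Longrightarrow> (\<And>c x. T' (c *\<^sub>R x) = c *\<^sub>R T' x)
       \<Longrightarrow> (\<lambda>j. (N' :: 'v \<Rightarrow> real) (T' (w (r (n j))) - T' h)) \<longlonglongrightarrow> 0"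
      using coeff_bounded_convergent_subsequence[OF F, of K "\<lambda>j. w (r j)"] w by blast
    have h1: "(\<lambda>j. N (w (r (n j)) - h)) \<longlonglongrightarrow> 0"
      using h[OF N, of "\<lambda>x. x"] by (simp add: Modules.additive.intro)
    have h2: "(\<lambda>j. N (T (w (r (n j))) - T h)) \<longlonglongrightarrow> 0"
      using h[OF N T] .
    obtain c' where c': "c' \<in> {c1..c2}" "h = c' *\<^sub>R u"
      using lim[of "r \<circ> n" h] h1 r(1) n by (auto simp: w_def strict_mono_o)
    let ?i = "\<lambda>j. r (n j)"
    have e1: "N (e (?i j)) \<le> N (w (?i j) - h)" for j
      using \<gamma>min[OF c'(1)] by (simp add: e_def c'(2))
    have g0: "\<bar>c' - \<gamma> (?i j)\<bar> \<le> N (e (?i j)) + N (w (?i j) - h)" for j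
    proof -
      have "\<bar>c' - \<gamma> (?i j)\<bar> = N ((c' - \<gamma> (?i j)) *\<^sub>R u)" by (simp add: Ns u)
      also have "(c' - \<gamma> (?i j)) *\<^sub>R u = e (?i j) - (w (?i j) - h)"
        by (simp add: e_def c'(2) algebra_simps)
      finally show ?thesis using Nd by metis
    qed
    have g: "\<bar>c' - \<gamma> (?i j)\<bar> \<le> 2 * N (w (?i j) - h)" for j
      using g0[of j] e1[of j] by linarith
    have Te: "N (T (e (?i j))) \<le> N (T (w (?i j)) - T h) + 2 * N (w (?i j) - h) * N (T u)" for j
    proof -
      have "T (e (?i j)) = (T (w (?i j)) - T h) + (c' - \<gamma> (?i j)) *\<^sub>R T u"
        by (simp add: e_def Tdiff T(2) c'(2) algebra_simps)
      then have "N (T (e (?i j))) \<le> N (T (w (?i j)) - T h) + \<bar>c' - \<gamma> (?i j)\<bar> * N (T u)"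
        using Nt Ns by metis
      also have "\<bar>c' - \<gamma> (?i j)\<bar> * N (T u) \<le> 2 * N (w (?i j) - h) * N (T u)"
        by (intro mult_right_mono g N0)
      finally show ?thesis by simp
    qed
    have "\<epsilon> \<le> N (w (?i j) - h) + (N (T (w (?i j)) - T h) + 2 * N (w (?i j) - h) * N (T u))" for j
      using Te[of j] e1[of j] r(2)[of "n j"] N0[of "e (?i j)"] N0[of "T (e (?i j))"]
      unfolding dist_real_def by linarith
    moreover have "(\<lambda>j. N (w (?i j) - h) + (N (T (w (?i j)) - T h) + 2 * N (w (?i j) - h) * N (T u)))
        \<longlonglongrightarrow> 0 + (0 + 2 * 0 * N (T u))"
      by (intro tendsto_intros h1 h2)
    ultimately have "\<epsilon> \<le> 0"
      by (intro tendsto_lowerbound[where F = sequentially]) auto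
    then show False using \<epsilon> by simp
  qed
  have e1: "(\<lambda>i. N (e i)) \<longlonglongrightarrow> 0"
    by (rule tendsto_sandwich[OF _ _ tendsto_const e0]) (auto simp: N0)
  have e2: "(\<lambda>i. N (T (e i))) \<longlonglongrightarrow> 0"
    by (rule tendsto_sandwich[OF _ _ tendsto_const e0]) (auto simp: N0)
  define \<rho> where "\<rho> i = L (Suc i) / L i" for i
  define b where "b i = (1 / L i) *\<^sub>R (v (Suc i) - T (v i))" for i
  have \<rho>pos: "0 < \<rho> i" for i using Lpos by (simp add: \<rho>_def)
  have step: "\<rho> i *\<^sub>R w (Suc i) = T (w i) + b i" for i
    using Lpos by (simp add: \<rho>_def w_def b_def T(2) algebra_simps)
  have b0: "(\<lambda>i. N (b i)) \<longlonglongrightarrow> 0"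
  proof (rule tendsto_sandwich[OF _ _ tendsto_const])
    show "(\<lambda>i. B / L i) \<longlonglongrightarrow> 0"
      by (rule real_tendsto_divide_at_top[OF tendsto_const L(2)])
    show "\<forall>\<^sub>F i in sequentially. N (b i) \<le> B / L i"
      using \<beta> less_imp_le[OF Lpos(1)]
      by (intro always_eventually allI) (auto simp: b_def Ns intro!: divide_right_mono)
  qed (auto simp: N0)
  define M where "M = K * (\<Sum>k\<in>F. N (T k))"
  have M: "N (T (w i)) \<le> M" for i
    unfolding M_def by (rule coeff_bounded_norm_bound[OF F N T w])
  \<comment> \<open>Since \<open>w (Suc i)\<close> is close to a multiple of \<open>u\<close> by at
    least \<open>c1\<close>, its norm is eventually at least \<open>c1 / 2\<close>, whereas
    \<open>\<rho> i\<close> times this norm is at most \<open>M + 1\<close> by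
    \<open>step\<close>.\<close>
  have \<rho>b: "\<forall>\<^sub>F i in sequentially. \<rho> i \<le> 2 * (M + 1) / c1"
  proof -
    have "\<forall>\<^sub>F i in sequentially. N (e (Suc i)) < c1 / 2"
      using c by (intro order_tendstoD(2)[OF LIMSEQ_Suc[OF e1]]) simp
    moreover have "\<forall>\<^sub>F i in sequentially. N (b i) < 1"
      by (rule order_tendstoD(2)[OF b0]) simp
    ultimately show ?thesis
    proof eventually_elim
      case (elim i)
      have "\<gamma> (Suc i) *\<^sub>R u = w (Suc i) - e (Suc i)" by (simp add: e_def)
      then have "\<gamma> (Suc i) \<le> N (w (Suc i)) + N (e (Suc i))"
        using Nd[of "w (Suc i)" "e (Suc i)"] Ns[of "\<gamma> (Suc i)" u] u \<gamma>pos(1)[of "Suc i"] by simp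
      then have "c1 / 2 \<le> N (w (Suc i))" using elim(1) \<gamma>pos(2)[of "Suc i"] by linarith
      then have "\<rho> i * (c1 / 2) \<le> \<rho> i * N (w (Suc i))"
        using \<rho>pos[of i] by (intro mult_left_mono) auto
      also have "\<dots> = N (T (w i) + b i)"
        using Ns[of "\<rho> i" "w (Suc i)"] \<rho>pos[of i] step[of i] by simp
      also have "\<dots> \<le> M + 1"
        using Nt[of "T (w i)" "b i"] M[of i] elim(2) by linarith
      finally show ?case using c by (simp add: field_simps)
    qed
  qed
  \<comment> \<open>Inserting \<open>w = \<gamma> u + e\<close> into \<open>step\<close> gives
    \<open>\<tau> i u\<close> close to \<open>T u\<close>. That \<open>u\<close> is an eigenvector
    is a consequence, not an input.\<close>
  define \<tau> where "\<tau> i = \<rho> i * \<gamma> (Suc i) / \<gamma> i" for i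
  define R where "R = 2 * (M + 1) / c1"
  have \<tau>le: "\<forall>\<^sub>F i in sequentially. N (\<tau> i *\<^sub>R u - T u) \<le> (N (T (e i)) + N (b i) + R * N (e (Suc i))) / c1"
    using \<rho>b
  proof eventually_elim
    case (elim i)
    have "\<gamma> i *\<^sub>R (\<tau> i *\<^sub>R u - T u) = T (e i) + b i - \<rho> i *\<^sub>R e (Suc i)"
      using step[of i] \<gamma>pos[of i]
      by (simp add: \<tau>_def e_def Tdiff T(2) algebra_simps)
    then have "\<gamma> i * N (\<tau> i *\<^sub>R u - T u) \<le> N (T (e i)) + N (b i) + \<rho> i * N (e (Suc i))"
      using Ns[of "\<gamma> i" "\<tau> i *\<^sub>R u - T u"] Ns[of "\<rho> i" "e (Suc i)"] \<gamma>pos(1)[of i] \<rho>pos[of i]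
        Nd[of "T (e i) + b i" "\<rho> i *\<^sub>R e (Suc i)"] Nt[of "T (e i)" "b i"] by simp
    also have "\<rho> i * N (e (Suc i)) \<le> R * N (e (Suc i))"
      using elim by (intro mult_right_mono N0) (simp add: R_def)
    finally have "\<gamma> i * N (\<tau> i *\<^sub>R u - T u) \<le> N (T (e i)) + N (b i) + R * N (e (Suc i))" by simp
    moreover have "c1 * N (\<tau> i *\<^sub>R u - T u) \<le> \<gamma> i * N (\<tau> i *\<^sub>R u - T u)"
      by (intro mult_right_mono \<gamma>pos N0)
    ultimately show ?case using c by (simp add: field_simps)
  qed
  have \<tau>lim: "(\<lambda>i. (N (T (e i)) + N (b i) + R * N (e (Suc i))) / c1) \<longlonglongrightarrow> (0 + 0 + R * 0) / c1"
    using c by (intro tendsto_intros e2 b0 LIMSEQ_Suc[OF e1]) auto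
  have \<tau>0: "(\<lambda>i. N (\<tau> i *\<^sub>R u - T u)) \<longlonglongrightarrow> 0"
    by (rule Lim_null_comparison[where g = "\<lambda>i. (N (T (e i)) + N (b i) + R * N (e (Suc i))) / c1"])
      (use \<tau>le \<tau>lim in \<open>simp_all only: real_norm_def abs_of_nonneg[OF N0] mult_zero_right add_0_left div_0\<close>)
  \<comment> \<open>The norm of \<open>u\<close> is 1, so distances of the multiples of
    \<open>u\<close> are distances of their factors.\<close>
  have "Cauchy \<tau>"
  proof (rule metric_CauchyI)
    fix \<epsilon> :: real assume "0 < \<epsilon>"
    then have "\<forall>\<^sub>F i in sequentially. N (\<tau> i *\<^sub>R u - T u) < \<epsilon> / 2"
      by (intro order_tendstoD(2)[OF \<tau>0]) simp
    then obtain k where k: "\<And>i. i \<ge> k \<Longrightarrow> N (\<tau> i *\<^sub>R u - T u) < \<epsilon> / 2"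
      by (auto simp: eventually_sequentially)
    have "dist (\<tau> i) (\<tau> j) < \<epsilon>" if "i \<ge> k" "j \<ge> k" for i j
    proof -
      have "dist (\<tau> i) (\<tau> j) = N ((\<tau> i *\<^sub>R u - T u) - (\<tau> j *\<^sub>R u - T u))"
        using Ns[of "\<tau> i - \<tau> j" u] by (simp add: u dist_real_def algebra_simps)
      also have "\<dots> \<le> N (\<tau> i *\<^sub>R u - T u) + N (\<tau> j *\<^sub>R u - T u)" by (rule Nd)
      finally show ?thesis using k[OF that(1)] k[OF that(2)] by linarith
    qed
    then show "\<exists>k. \<forall>i\<ge>k. \<forall>j\<ge>k. dist (\<tau> i) (\<tau> j) < \<epsilon>" by blast
  qed
  then obtain l where l: "\<tau> \<longlonglongrightarrow> l" using Cauchy_convergent convergent_def by blast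
  have "N (l *\<^sub>R u - T u) \<le> \<bar>l - \<tau> i\<bar> + N (\<tau> i *\<^sub>R u - T u)" for i
  proof -
    have "l *\<^sub>R u - T u = (l - \<tau> i) *\<^sub>R u + (\<tau> i *\<^sub>R u - T u)" by (simp add: algebra_simps)
    then show ?thesis using Nt Ns u by (metis mult.right_neutral)
  qed
  moreover have "(\<lambda>i. \<bar>l - \<tau> i\<bar> + N (\<tau> i *\<^sub>R u - T u)) \<longlonglongrightarrow> \<bar>l - l\<bar> + 0"
    by (intro tendsto_intros l \<tau>0)
  ultimately have "N (l *\<^sub>R u - T u) \<le> 0"
    by (intro tendsto_lowerbound[where F = sequentially]) auto
  then have Tu: "T u = l *\<^sub>R u" using N0[of "l *\<^sub>R u - T u"] Nz[of "l *\<^sub>R u - T u"] by simp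
  \<comment> \<open>The size of the \<open>u\<close>-part of \<open>v i\<close>. Its successive
    ratios are exactly the convergent sequence \<open>\<tau>\<close>.\<close>
  define d where "d i = \<gamma> i * L i" for i
  have dpos: "0 < d i" for i using \<gamma>pos Lpos by (simp add: d_def)
  have \<tau>d: "\<tau> i = d (Suc i) / d i" for i
    using Lpos \<gamma>pos by (simp add: \<tau>_def d_def \<rho>_def mult.commute)
  \<comment> \<open>A limit below 1 would make \<open>d\<close> eventually decreasing, and then
    \<open>L\<close>, which is at most \<open>d / c1\<close>, could not tend to infinity. This also
    makes \<open>ln l\<close> meaningful.\<close>
  have l1: "1 \<le> l"
  proof (rule ccontr)
    assume "\<not> 1 \<le> l"
    then have "\<forall>\<^sub>F i in sequentially. \<tau> i < 1" by (intro order_tendstoD(2)[OF l]) simp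
    then obtain k where k: "\<And>i. i \<ge> k \<Longrightarrow> \<tau> i < 1" by (auto simp: eventually_sequentially)
    have "d (k + i) \<le> d k" for i
    proof (induction i)
      case (Suc i)
      then show ?case using k[of "k + i"] dpos[of "k + i"] by (simp add: \<tau>d field_simps)
    qed simp
    then have le: "L (k + i) \<le> d k / c1" for i
    proof -
      have "c1 * L (k + i) \<le> d (k + i)"
        unfolding d_def by (intro mult_right_mono \<gamma>pos less_imp_le[OF Lpos(1)])
      also have "\<dots> \<le> d k" by fact
      finally show ?thesis using c by (simp add: field_simps)
    qed
    have "\<forall>\<^sub>F i in sequentially. L i > d k / c1"
      using L(2) by (simp add: filterlim_at_top_dense)
    then obtain m where "\<And>i. i \<ge> m \<Longrightarrow> L i > d k / c1" by (auto simp: eventually_sequentially)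
    from this[of "k + m"] le[of m] show False by simp
  qed
  have "(\<lambda>i. 1 / real i * ln (d i)) \<longlonglongrightarrow> ln l"
    using l1 dpos l by (intro tendsto_ln_ratio) (auto simp: \<tau>d[abs_def])
  moreover have "(\<lambda>i. 1 / real i * ln (\<gamma> i)) \<longlonglongrightarrow> 0"
  proof (rule tendsto_rabs_zero_cancel, rule tendsto_sandwich[OF _ _ tendsto_const])
    let ?S = "\<bar>ln c1\<bar> + \<bar>ln c2\<bar>"
    have "ln c1 \<le> ln (\<gamma> i)" "ln (\<gamma> i) \<le> ln c2" for i
      using \<gamma>pos[of i] c by auto
    then have "\<bar>ln (\<gamma> i)\<bar> \<le> ?S" for i by (smt (verit))
    then show "\<forall>\<^sub>F i in sequentially. \<bar>1 / real i * ln (\<gamma> i)\<bar> \<le> 1 / real i * ?S"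
      by (intro always_eventually allI) (auto simp: abs_mult intro!: mult_left_mono divide_right_mono)
    show "(\<lambda>i. 1 / real i * ?S) \<longlonglongrightarrow> 0"
      by (rule tendsto_mult_left_zero[OF lim_1_over_n])
  qed auto
  ultimately have "(\<lambda>i. 1 / real i * ln (d i) - 1 / real i * ln (\<gamma> i)) \<longlonglongrightarrow> ln l - 0"
    by (rule tendsto_diff)
  moreover have "1 / real i * ln (d i) - 1 / real i * ln (\<gamma> i) = 1 / real i * ln (L i)" for i
    using Lpos[of i] \<gamma>pos[of i] by (simp add: d_def ln_mult algebra_simps)
  ultimately show ?thesis using l1 Tu by (intro exI[of _ l]) auto
qed

section \<open>Polygon sums and compact length spaces\<close>

text \<open>The parameter interval is kept free, so that a curve can be treated piece by piece
  without reparametrization.\<close>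

definition polygon_sums :: "('m \<Rightarrow> 'm \<Rightarrow> real) \<Rightarrow> real \<Rightarrow> real \<Rightarrow> (real \<Rightarrow> 'm) \<Rightarrow> real set" where
  "polygon_sums d a b \<gamma> =
     {\<Sum>i<n. d (\<gamma> (t i)) (\<gamma> (t (Suc i))) | n t. mono_on {..n} t \<and> t ` {..n} \<subseteq> {a..b}}"

lemma polygon_lengths_eq: "polygon_lengths A g \<gamma> = polygon_sums (riem_dist A g) 0 1 \<gamma>"
  by (simp add: polygon_lengths_def polygon_sums_def)

lemma polygon_sums_mono: "a' \<le> a \<Longrightarrow> b \<le> b' \<Longrightarrow> polygon_sums d a b \<gamma> \<subseteq> polygon_sums d a' b' \<gamma>"
  unfolding polygon_sums_def by fastforce

lemma polygon_sums_0: "a \<le> b \<Longrightarrow> 0 \<in> polygon_sums d a b \<gamma>"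
  unfolding polygon_sums_def
  by (rule CollectI, rule exI[of _ 0], rule exI[of _ "\<lambda>_. a"]) (auto simp: mono_on_def)

lemma polygon_sums_2:
  assumes "a \<le> s" "s \<le> t" "t \<le> b" shows "d (\<gamma> s) (\<gamma> t) \<in> polygon_sums d a b \<gamma>"
  unfolding polygon_sums_def
  by (rule CollectI, rule exI[of _ 1], rule exI[of _ "\<lambda>i. if i = 0 then s else t"])
    (use assms in \<open>auto simp: mono_on_def\<close>)

lemma polygon_sums_reparam:
  assumes "mono_on {a..b} h" "h ` {a..b} \<subseteq> {a'..b'}" "\<And>s. s \<in> {a..b} \<Longrightarrow> \<gamma> s = \<eta> (h s)"
  shows "polygon_sums d a b \<gamma> \<subseteq> polygon_sums d a' b' \<eta>"
proof
  fix x assume "x \<in> polygon_sums d a b \<gamma>"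
  then obtain n t where x: "x = (\<Sum>i<n. d (\<gamma> (t i)) (\<gamma> (t (Suc i))))"
    and t: "mono_on {..n} t" "t ` {..n} \<subseteq> {a..b}" by (auto simp: polygon_sums_def)
  have "x = (\<Sum>i<n. d (\<eta> ((h \<circ> t) i)) (\<eta> ((h \<circ> t) (Suc i))))"
    unfolding x by (rule sum.cong) (use t(2) assms(3) in \<open>auto simp: image_subset_iff\<close>)
  moreover have "mono_on {..n} (h \<circ> t)"
    using t assms(1) by (intro mono_onI) (auto simp: image_subset_iff intro!: mono_onD[OF assms(1)] mono_onD[OF t(1)])
  moreover have "(h \<circ> t) ` {..n} \<subseteq> {a'..b'}" using t(2) assms(2) by fastforce
  ultimately show "x \<in> polygon_sums d a' b' \<eta>" unfolding polygon_sums_def by blast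
qed

text \<open>The vertices are listed one after the other. The edge between the two lists only adds a
  nonnegative term, hence the inequality.\<close>

lemma polygon_sums_concat:
  assumes "\<And>x y. 0 \<le> d x y" and x: "x \<in> polygon_sums d a b \<gamma>" and y: "y \<in> polygon_sums d b c \<gamma>"
    and "a \<le> b" "b \<le> c"
  shows "\<exists>z\<in>polygon_sums d a c \<gamma>. x + y \<le> z"
proof -
  obtain n t where x: "x = (\<Sum>i<n. d (\<gamma> (t i)) (\<gamma> (t (Suc i))))"
    and t: "mono_on {..n} t" "t ` {..n} \<subseteq> {a..b}" using x by (auto simp: polygon_sums_def)
  obtain m s where y: "y = (\<Sum>i<m. d (\<gamma> (s i)) (\<gamma> (s (Suc i))))"
    and s: "mono_on {..m} s" "s ` {..m} \<subseteq> {b..c}" using y by (auto simp: polygon_sums_def)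
  \<comment> \<open>The second list starts at index \<open>n + 1\<close>; the edge from
    \<open>n\<close> to \<open>n + 1\<close> is the additional one.\<close>
  define r where "r i = (if i \<le> n then t i else s (i - Suc n))" for i
  have t': "a \<le> t i" "t i \<le> b" if "i \<le> n" for i using t(2) that by auto
  have s': "b \<le> s i" "s i \<le> c" if "i \<le> m" for i using s(2) that by auto
  have "mono_on {..n + Suc m} r"
  proof (rule mono_onI)
    fix i j assume ij: "i \<in> {..n + Suc m}" "j \<in> {..n + Suc m}" "i \<le> j"
    consider "j \<le> n" | "i \<le> n" "j > n" | "i > n" "j > n" using ij by linarith
    then show "r i \<le> r j"
    proof cases
      case 1 then show ?thesis using ij mono_onD[OF t(1), of i j] by (simp add: r_def)
    next
      case 2
      then have "j - Suc n \<le> m" using ij by auto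
      then show ?thesis using 2 t'(2)[of i] s'(1)[of "j - Suc n"] by (simp add: r_def)
    next
      case 3 then show ?thesis using ij mono_onD[OF s(1), of "i - Suc n" "j - Suc n"] by (simp add: r_def)
    qed
  qed
  moreover have "r i \<in> {a..c}" if "i \<le> n + Suc m" for i
  proof (cases "i \<le> n")
    case True
    then show ?thesis using t'[of i] assms(4,5) by (simp add: r_def)
  next
    case False
    then have "i - Suc n \<le> m" using that by auto
    then show ?thesis using False s'[of "i - Suc n"] assms(4,5) by (simp add: r_def)
  qed
  ultimately have "(\<Sum>i<n + Suc m. d (\<gamma> (r i)) (\<gamma> (r (Suc i)))) \<in> polygon_sums d a c \<gamma>"
    unfolding polygon_sums_def by blast
  moreover have "x + y \<le> (\<Sum>i<n + Suc m. d (\<gamma> (r i)) (\<gamma> (r (Suc i))))"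
  proof -
    have "(\<Sum>i<n + Suc m. d (\<gamma> (r i)) (\<gamma> (r (Suc i)))) =
       (\<Sum>i<n. d (\<gamma> (r i)) (\<gamma> (r (Suc i)))) + d (\<gamma> (r n)) (\<gamma> (r (Suc n)))
        + (\<Sum>i<m. d (\<gamma> (r (Suc n + i))) (\<gamma> (r (Suc (Suc n + i)))))"
      by (induction m) auto
    moreover have "(\<Sum>i<n. d (\<gamma> (r i)) (\<gamma> (r (Suc i)))) = x"
      unfolding x by (rule sum.cong) (auto simp: r_def)
    moreover have "(\<Sum>i<m. d (\<gamma> (r (Suc n + i))) (\<gamma> (r (Suc (Suc n + i))))) = y"
      unfolding y by (rule sum.cong) (auto simp: r_def)
    ultimately show ?thesis using assms(1)[of "\<gamma> (r n)" "\<gamma> (r (Suc n))"] by linarith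
  qed
  ultimately show ?thesis by blast
qed

text \<open>\<open>small_ball_subset\<close> and \<open>ball_nbhd\<close> together say that
  \<open>d\<close> induces the given topology. Almost geodesics are only asked to be Lipschitz; this
  already makes them continuous.\<close>

locale compact_length_space =
  fixes d :: "'m::t2_space \<Rightarrow> 'm \<Rightarrow> real"
  assumes compact_UNIV: "compact (UNIV :: 'm set)"
    and d_nonneg: "0 \<le> d x y" and d_refl: "d x x = 0" and d_sym: "d x y = d y x"
    and d_triangle: "d x z \<le> d x y + d y z"
    and small_ball_subset: "open U \<Longrightarrow> x \<in> U \<Longrightarrow> \<exists>e>0. \<forall>y. d x y < e \<longrightarrow> y \<in> U"
    and ball_nbhd: "0 < e \<Longrightarrow> \<exists>U. open U \<and> x \<in> U \<and> (\<forall>y\<in>U. d x y < e)"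
    and almost_geodesic: "0 < e \<Longrightarrow> \<exists>b :: real \<Rightarrow> 'm. b 0 = x \<and> b 1 = y \<and>
        (\<forall>s\<in>{0..1}. \<forall>t\<in>{0..1}. d (b s) (b t) \<le> (d x y + e) * \<bar>s - t\<bar>)"
begin

lemma tendsto_iff_d: "(u \<longlongrightarrow> x) F \<longleftrightarrow> ((\<lambda>i. d x (u i)) \<longlongrightarrow> 0) F"
proof
  assume u: "(u \<longlongrightarrow> x) F"
  show "((\<lambda>i. d x (u i)) \<longlongrightarrow> 0) F"
  proof (rule tendstoI)
    fix e :: real assume "0 < e"
    then obtain U where "open U" "x \<in> U" "\<forall>y\<in>U. d x y < e" using ball_nbhd by blast
    then show "\<forall>\<^sub>F i in F. dist (d x (u i)) 0 < e"
      using topological_tendstoD[OF u, of U] d_nonneg by (auto elim: eventually_mono simp: dist_real_def)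
  qed
next
  assume u: "((\<lambda>i. d x (u i)) \<longlongrightarrow> 0) F"
  show "(u \<longlongrightarrow> x) F"
  proof (rule topological_tendstoI)
    fix U assume "open U" "x \<in> U"
    then obtain e where "e > 0" "\<forall>y. d x y < e \<longrightarrow> y \<in> U" using small_ball_subset by blast
    then show "\<forall>\<^sub>F i in F. u i \<in> U"
      using order_tendstoD(2)[OF u, of e] by (auto elim: eventually_mono)
  qed
qed

lemma tendsto_d:
  assumes "(u \<longlongrightarrow> x) F" "(v \<longlongrightarrow> y) F" shows "((\<lambda>i. d (u i) (v i)) \<longlongrightarrow> d x y) F"
proof (rule Lim_transform[OF tendsto_const], rule Lim_null_comparison[OF always_eventually], rule allI)
  fix i
  have "d (u i) (v i) \<le> d (u i) x + (d x y + d y (v i))"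
    using d_triangle[of "u i" "v i" x] d_triangle[of x "v i" y] by linarith
  moreover have "d x y \<le> d x (u i) + (d (u i) (v i) + d (v i) y)"
    using d_triangle[of x y "u i"] d_triangle[of "u i" y "v i"] by linarith
  ultimately show "norm (d (u i) (v i) - d x y) \<le> d x (u i) + d y (v i)"
    using d_sym[of "u i" x] d_sym[of "v i" y] by (simp add: abs_le_iff)
next
  show "((\<lambda>i. d x (u i) + d y (v i)) \<longlongrightarrow> 0) F"
    using tendsto_add[OF assms[unfolded tendsto_iff_d]] by simp
qed

lemma continuous_on_d [continuous_intros]:
  assumes "continuous_on S u" "continuous_on S v" shows "continuous_on S (\<lambda>s. d (u s) (v s))"
  using assms unfolding continuous_on_def by (auto intro: tendsto_d)

lemma bounded_d: "\<exists>D. \<forall>x y. d x y \<le> D"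
proof -
  \<comment> \<open>\<open>undefined\<close> serves as an arbitrary base point.\<close>
  have "continuous_on UNIV (\<lambda>y. d undefined y)" by (intro continuous_intros)
  then have "bounded (range (\<lambda>y. d undefined y))"
    by (intro compact_imp_bounded compact_continuous_image compact_UNIV)
  then obtain D where "\<And>z. z \<in> range (d undefined) \<Longrightarrow> norm z \<le> D" by (auto simp: bounded_iff)
  then have D: "d undefined y \<le> D" for y using d_nonneg by (metis abs_of_nonneg rangeI real_norm_def)
  have "d x y \<le> D + D" for x y
    using D[of x] D[of y] d_triangle[of x y undefined] d_sym[of x undefined] by linarith
  then show ?thesis by blast
qed

text \<open>The finite cover uses neighbourhoods inside balls of radius \<open>e x / 2\<close>,
  which leaves the other half for the triangle inequality.\<close>

lemma lebesgue_number:
  assumes "\<And>x. \<exists>U\<in>\<C>. open U \<and> x \<in> U"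
  shows "\<exists>\<delta>>0. \<forall>x. \<exists>U\<in>\<C>. \<forall>y. d x y < \<delta> \<longrightarrow> y \<in> U"
proof -
  have "\<exists>U\<in>\<C>. \<exists>e>0. \<forall>y. d x y < e \<longrightarrow> y \<in> U" for x using assms small_ball_subset by metis
  then obtain U e where U: "\<And>x. U x \<in> \<C>" "\<And>x. 0 < e x" "\<And>x y. d x y < e x \<Longrightarrow> y \<in> U x" by metis
  have "\<exists>V. open V \<and> x \<in> V \<and> (\<forall>y\<in>V. d x y < e x / 2)" for x
    using ball_nbhd[of "e x / 2" x] U(2)[of x] by simp
  then obtain V where V: "\<And>x. open (V x)" "\<And>x. x \<in> V x" "\<And>x y. y \<in> V x \<Longrightarrow> d x y < e x / 2" by metis
  have cover: "UNIV \<subseteq> (\<Union>x\<in>UNIV. V x)" using V(2) by blast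
  obtain P where P: "finite P" "UNIV \<subseteq> (\<Union>x\<in>P. V x)"
    by (rule compactE_image[OF compact_UNIV V(1) cover]) blast
  then have Pne: "P \<noteq> {}" by auto
  define \<delta> where "\<delta> = Min ((\<lambda>p. e p / 2) ` P)"
  have "\<delta> > 0" unfolding \<delta>_def using P(1) Pne U(2) by (simp add: Min_gr_iff)
  moreover have "\<exists>U\<in>\<C>. \<forall>y. d x y < \<delta> \<longrightarrow> y \<in> U" for x
  proof -
    obtain p where p: "p \<in> P" "x \<in> V p" using P(2) by auto
    have "\<delta> \<le> e p / 2" unfolding \<delta>_def using P(1) p(1) by (intro Min_le) auto
    then have "y \<in> U p" if "d x y < \<delta>" for y
      using that V(3)[OF p(2)] d_triangle[of p y x] by (intro U(3)) linarith
    then show ?thesis using U(1) by blast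
  qed
  ultimately show ?thesis by blast
qed

lemma finite_net:
  assumes "0 < \<delta>" shows "\<exists>P. finite P \<and> (\<forall>x. \<exists>p\<in>P. d p x < \<delta>)"
proof -
  have "\<exists>V. open V \<and> x \<in> V \<and> (\<forall>y\<in>V. d x y < \<delta>)" for x using ball_nbhd[OF assms] .
  then obtain V where V: "\<And>x. open (V x)" "\<And>x. x \<in> V x" "\<And>x y. y \<in> V x \<Longrightarrow> d x y < \<delta>" by metis
  have cover: "UNIV \<subseteq> (\<Union>x\<in>UNIV. V x)" using V(2) by blast
  obtain P where P: "finite P" "UNIV \<subseteq> (\<Union>x\<in>P. V x)"
    by (rule compactE_image[OF compact_UNIV V(1) cover]) blast
  have "\<exists>p\<in>P. d p x < \<delta>" for x
  proof -
    obtain p where "p \<in> P" "x \<in> V p" using P(2) by blast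
    then show ?thesis using V(3) by blast
  qed
  then show ?thesis using P(1) by blast
qed

text \<open>A Lebesgue number for the cover by sets on which \<open>f\<close> varies by less than
  \<open>e\<close>.\<close>

lemma uniformly_continuous:
  assumes f: "continuous_on UNIV f" and e: "0 < e"
  shows "\<exists>\<delta>>0. \<forall>x y. d x y < \<delta> \<longrightarrow> d (f x) (f y) < e"
proof -
  let ?\<C> = "{U. \<forall>x\<in>U. \<forall>y\<in>U. d (f x) (f y) < e}"
  have "\<exists>U\<in>?\<C>. open U \<and> x \<in> U" for x
  proof -
    obtain V where V: "open V" "f x \<in> V" "\<forall>y\<in>V. d (f x) y < e / 2" using ball_nbhd[of "e / 2"] e by auto
    have "d (f y) (f z) < e" if "f y \<in> V" "f z \<in> V" for y z
      using V(3)[rule_format, OF that(1)] V(3)[rule_format, OF that(2)]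
        d_triangle[of "f y" "f z" "f x"] d_sym[of "f x" "f y"] by linarith
    then show ?thesis using V open_vimage[OF V(1) f] by (intro bexI[of _ "f -` V"]) auto
  qed
  from lebesgue_number[OF this]
  obtain \<delta> where "\<delta> > 0" "\<And>x. \<exists>U\<in>?\<C>. \<forall>y. d x y < \<delta> \<longrightarrow> y \<in> U" by blast
  then show ?thesis using d_refl by (metis (mono_tags, lifting) mem_Collect_eq)
qed

text \<open>Geodesics are obtained from almost geodesics by Tychonoff's theorem: the Lipschitz conditions
  are closed in the compact space of all functions \<open>\<real> \<rightarrow> M\<close>.\<close>

lemma geodesic:
  obtains b where "path b" "b 0 = x" "b 1 = y"
    "\<And>s t. s \<in> {0..1} \<Longrightarrow> t \<in> {0..1} \<Longrightarrow> d (b s) (b t) \<le> d x y * \<bar>s - t\<bar>"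
proof -
  define K where "K n = {b :: real \<Rightarrow> 'm. b 0 = x \<and> b 1 = y \<and>
     (\<forall>s\<in>{0..1}. \<forall>t\<in>{0..1}. d (b s) (b t) \<le> (d x y + 1 / real (Suc n)) * \<bar>s - t\<bar>)}" for n
  have comp: "compact (UNIV :: (real \<Rightarrow> 'm) set)"
  proof -
    have "compact_space (product_topology (\<lambda>i::real. euclidean :: 'm topology) UNIV)"
      unfolding compact_space_product_topology using compact_UNIV by (simp add: compact_space_def)
    then show ?thesis
      by (simp add: euclidean_product_topology compact_space_def)
  qed
  \<comment> \<open>Evaluation at a fixed time is a coordinate of the product space, so each single
    Lipschitz inequality is a closed condition.\<close>
  have ev: "continuous_on UNIV (\<lambda>b :: real \<Rightarrow> 'm. b s)" for s by (rule continuous_on_product_coordinates)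
  have cl: "closed (K n)" for n
  proof -
    have "K n = {b. b 0 = x} \<inter> {b. b 1 = y} \<inter> (\<Inter>s\<in>{0..1}. \<Inter>t\<in>{0..1}.
        {b. d (b s) (b t) \<le> (d x y + 1 / real (Suc n)) * \<bar>s - t\<bar>})"
      unfolding K_def by auto
    also have "closed \<dots>"
      by (intro closed_Int closed_INT ballI closed_Collect_eq closed_Collect_le continuous_on_d
          ev continuous_on_const)
    finally show ?thesis .
  qed
  have mono: "K m \<subseteq> K n" if "n \<le> m" for m n
  proof -
    have "(d x y + 1 / real (Suc m)) * \<bar>s - t\<bar> \<le> (d x y + 1 / real (Suc n)) * \<bar>s - t\<bar>" for s t
      using that by (intro mult_right_mono add_left_mono divide_left_mono) auto
    then show ?thesis unfolding K_def by (blast intro: order_trans)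
  qed
  have "K n \<noteq> {}" for n
  proof -
    have "0 < 1 / real (Suc n)" by simp
    from almost_geodesic[OF this, of x y] show ?thesis unfolding K_def by blast
  qed
  note ne = this
  have fip: "UNIV \<inter> \<Inter>\<F> \<noteq> {}" if fin: "finite \<F>" and sub: "\<F> \<subseteq> range K" for \<F>
  proof -
    obtain I where I: "finite I" "\<F> = K ` I" using finite_subset_image[OF fin sub] by blast
    then obtain m where "\<And>n. n \<in> I \<Longrightarrow> n \<le> m" by (meson finite_nat_set_iff_bounded_le)
    then have "K m \<subseteq> \<Inter>\<F>" using mono by (auto simp: I)
    then show ?thesis using ne[of m] by blast
  qed
  have "UNIV \<inter> \<Inter>(range K) \<noteq> {}"
    by (rule compact_imp_fip[OF comp]) (use cl fip in auto)
  then obtain b where b: "\<And>n. b \<in> K n" by auto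
  have lip: "d (b s) (b t) \<le> d x y * \<bar>s - t\<bar>" if st: "s \<in> {0..1}" "t \<in> {0..1}" for s t
  proof (rule tendsto_lowerbound[where F = sequentially])
    have "(\<lambda>n. (d x y + 1 / real (Suc n)) * \<bar>s - t\<bar>) \<longlonglongrightarrow> (d x y + 0) * \<bar>s - t\<bar>"
      by (intro tendsto_intros LIMSEQ_Suc[OF lim_1_over_n])
    then show "(\<lambda>n. (d x y + 1 / real (Suc n)) * \<bar>s - t\<bar>) \<longlonglongrightarrow> d x y * \<bar>s - t\<bar>" by simp
  qed (use b st in \<open>auto simp: K_def\<close>)
  \<comment> \<open>A point of the product space is an arbitrary function; continuity comes from the
    Lipschitz bound that survived the limit.\<close>
  have "path b"
    unfolding path_def continuous_on_def
  proof
    fix s :: real assume s: "s \<in> {0..1}"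
    show "(b \<longlongrightarrow> b s) (at s within {0..1})"
      unfolding tendsto_iff_d
    proof (rule Lim_null_comparison)
      show "\<forall>\<^sub>F t in at s within {0..1}. norm (d (b s) (b t)) \<le> d x y * \<bar>s - t\<bar>"
        using lip[OF s] d_nonneg by (auto simp: eventually_at_filter)
      have "((\<lambda>t. d x y * \<bar>s - t\<bar>) \<longlongrightarrow> d x y * \<bar>s - s\<bar>) (at s within {0..1})"
        by (intro tendsto_intros)
      then show "((\<lambda>t. d x y * \<bar>s - t\<bar>) \<longlongrightarrow> 0) (at s within {0..1})" by simp
    qed
  qed
  then show ?thesis using that lip b by (auto simp: K_def)
qed

lemma polygon_sums_Lipschitz:
  assumes "\<And>s t. s \<in> {a..b} \<Longrightarrow> t \<in> {a..b} \<Longrightarrow> d (\<gamma> s) (\<gamma> t) \<le> K * \<bar>s - t\<bar>"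
    and "0 \<le> K" "a \<le> b" and x: "x \<in> polygon_sums d a b \<gamma>"
  shows "x \<le> K * (b - a)"
proof -
  obtain n t where x: "x = (\<Sum>i<n. d (\<gamma> (t i)) (\<gamma> (t (Suc i))))"
    and t: "mono_on {..n} t" "t ` {..n} \<subseteq> {a..b}" using x by (auto simp: polygon_sums_def)
  have "x \<le> (\<Sum>i<n. K * (t (Suc i) - t i))"
    unfolding x
  proof (rule sum_mono)
    fix i assume "i \<in> {..<n}"
    then show "d (\<gamma> (t i)) (\<gamma> (t (Suc i))) \<le> K * (t (Suc i) - t i)"
      using assms(1)[of "t i" "t (Suc i)"] t(2) mono_onD[OF t(1), of i "Suc i"]
      by (auto simp: image_subset_iff)
  qed
  also have "\<dots> = K * (t n - t 0)"
    by (simp add: sum_lessThan_telescope flip: sum_distrib_left)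
  also have "\<dots> \<le> K * (b - a)"
    using t(2) assms(2) by (intro mult_left_mono diff_mono) (auto simp: image_subset_iff)
  finally show ?thesis .
qed

text \<open>The vertex \<open>b\<close> is inserted by truncating all parameters from above and from
  below. An edge that does not cross \<open>b\<close> is degenerate in one of the two polygons; a
  crossing edge is handled by the triangle inequality.\<close>

lemma polygon_sums_split:
  assumes x: "x \<in> polygon_sums d a c \<gamma>" and "a \<le> b" "b \<le> c"
  shows "\<exists>y\<in>polygon_sums d a b \<gamma>. \<exists>z\<in>polygon_sums d b c \<gamma>. x \<le> y + z"
proof -
  obtain n t where x: "x = (\<Sum>i<n. d (\<gamma> (t i)) (\<gamma> (t (Suc i))))"
    and t: "mono_on {..n} t" "t ` {..n} \<subseteq> {a..c}" using x by (auto simp: polygon_sums_def)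
  define p q where "p i = min (t i) b" and "q i = max (t i) b" for i
  have "mono_on {..n} p" "mono_on {..n} q"
    using mono_onD[OF t(1)] by (auto intro!: mono_onI simp: p_def q_def min_def max_def; force)+
  moreover have "p ` {..n} \<subseteq> {a..b}" "q ` {..n} \<subseteq> {b..c}"
    using t(2) assms(2,3) by (auto simp: p_def q_def image_subset_iff)
  ultimately have "(\<Sum>i<n. d (\<gamma> (p i)) (\<gamma> (p (Suc i)))) \<in> polygon_sums d a b \<gamma>"
    "(\<Sum>i<n. d (\<gamma> (q i)) (\<gamma> (q (Suc i)))) \<in> polygon_sums d b c \<gamma>"
    unfolding polygon_sums_def by blast+
  moreover have "d (\<gamma> (t i)) (\<gamma> (t (Suc i))) \<le> d (\<gamma> (p i)) (\<gamma> (p (Suc i))) + d (\<gamma> (q i)) (\<gamma> (q (Suc i)))"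
    if "i < n" for i
    using mono_onD[OF t(1), of i "Suc i"] that d_triangle[of "\<gamma> (t i)" "\<gamma> (t (Suc i))" "\<gamma> b"]
    by (auto simp: p_def q_def min_def max_def d_refl)
  then have "x \<le> (\<Sum>i<n. d (\<gamma> (p i)) (\<gamma> (p (Suc i)))) + (\<Sum>i<n. d (\<gamma> (q i)) (\<gamma> (q (Suc i))))"
    unfolding x sum.distrib[symmetric] by (intro sum_mono) auto
  ultimately show ?thesis by blast
qed

text \<open>Greedy cutting: each piece ends when the distance from its start first reaches
  \<open>\<delta>\<close>. Such a piece uses up at least \<open>\<delta>\<close> of length, so
  \<open>n\<close> drops by one, and it contributes a single element of \<open>F\<close>. Here
  \<open>Z\<close> is any function of intervals that is additive under cutting.\<close>

lemma coeff_bounded_additive_on_rectifiable: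
  assumes \<gamma>: "path \<gamma>" and F: "finite F" and \<delta>: "0 < \<delta>"
    and Z: "\<And>a b c. 0 \<le> a \<Longrightarrow> a \<le> b \<Longrightarrow> b \<le> c \<Longrightarrow> c \<le> 1 \<Longrightarrow> Z a c = Z a b + Z b c"
    and small: "\<And>a b. 0 \<le> a \<Longrightarrow> a \<le> b \<Longrightarrow> b \<le> 1 \<Longrightarrow> (\<And>s. s \<in> {a..b} \<Longrightarrow> d (\<gamma> a) (\<gamma> s) \<le> \<delta>) \<Longrightarrow> Z a b \<in> F"
    and L: "\<And>x. x \<in> polygon_sums d a 1 \<gamma> \<Longrightarrow> x \<le> real n * \<delta>" and a: "0 \<le> a" "a \<le> 1"
  shows "coeff_bounded F (real n + 1) (Z a 1)"
  using L a
proof (induction n arbitrary: a)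
  case 0
  then have "d (\<gamma> a) (\<gamma> s) \<le> \<delta>" if "s \<in> {a..1}" for s
    using polygon_sums_2[of a a s 1 d \<gamma>] that \<delta> by fastforce
  then show ?case using small[of a 1] 0 coeff_bounded_member[OF F] by auto
next
  case (Suc n)
  show ?case
  proof (cases "\<forall>s\<in>{a..1}. d (\<gamma> a) (\<gamma> s) \<le> \<delta>")
    case True
    then have "coeff_bounded F 1 (Z a 1)" using small[of a 1] Suc.prems coeff_bounded_member[OF F] by auto
    then show ?thesis by (rule coeff_bounded_mono) simp
  next
    case False
    then obtain s0 where s0: "s0 \<in> {a..1}" "d (\<gamma> a) (\<gamma> s0) > \<delta>" by auto
    have cont: "continuous_on {a..1} (\<lambda>s. d (\<gamma> a) (\<gamma> s))"
      using \<gamma> Suc.prems(2) unfolding path_def by (intro continuous_intros) (rule continuous_on_subset, auto)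
    \<comment> \<open>The least element of \<open>S\<close> is the first time at distance at least
      \<open>\<delta>\<close>; by the intermediate value theorem the distance there is exactly
      \<open>\<delta>\<close>.\<close>
    define S where "S = {a..1} \<inter> (\<lambda>s. d (\<gamma> a) (\<gamma> s)) -` {\<delta>..}"
    have "closed S" unfolding S_def by (rule continuous_closed_preimage[OF cont]) auto
    moreover have "bounded S" unfolding S_def by (rule bounded_subset[of "{a..1}"]) auto
    moreover have "s0 \<in> S" using s0 by (simp add: S_def)
    ultimately obtain b where b: "b \<in> S" "\<And>s. s \<in> S \<Longrightarrow> b \<le> s"
      using compact_attains_inf[of S] compact_eq_bounded_closed by blast
    have ab: "a \<le> b" "b \<le> 1" "\<delta> \<le> d (\<gamma> a) (\<gamma> b)" using b(1) by (auto simp: S_def)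
    have less: "d (\<gamma> a) (\<gamma> s) < \<delta>" if "s \<in> {a..<b}" for s
      using b(2)[of s] that ab by (force simp: S_def)
    have "\<exists>s\<ge>a. s \<le> b \<and> d (\<gamma> a) (\<gamma> s) = \<delta>"
      by (rule IVT') (use ab \<delta> d_refl cont in \<open>auto intro: continuous_on_subset\<close>)
    then obtain s where s: "a \<le> s" "s \<le> b" "d (\<gamma> a) (\<gamma> s) = \<delta>" by blast
    then have "s = b" using less[of s] by force
    then have eq: "d (\<gamma> a) (\<gamma> b) = \<delta>" using s by simp
    have "d (\<gamma> a) (\<gamma> s) \<le> \<delta>" if "s \<in> {a..b}" for s
      using less[of s] eq that by (cases "s = b") auto
    then have "Z a b \<in> F" using Suc.prems ab by (intro small) auto
    moreover have "coeff_bounded F (real n + 1) (Z b 1)"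
    proof (rule Suc.IH)
      \<comment> \<open>Prepending the edge from \<open>a\<close> to \<open>b\<close>, of length
        \<open>\<delta>\<close>, turns a polygon on \<open>[b,1]\<close> into one on
        \<open>[a,1]\<close>.\<close>
      fix x assume "x \<in> polygon_sums d b 1 \<gamma>"
      then obtain z where "z \<in> polygon_sums d a 1 \<gamma>" "\<delta> + x \<le> z"
        using polygon_sums_concat[OF d_nonneg polygon_sums_2[of a a b b d \<gamma>], of x 1] ab eq by auto
      then show "x \<le> real n * \<delta>" using Suc.prems(1)[of z] by (simp add: algebra_simps)
    qed (use ab Suc.prems in auto)
    ultimately have "coeff_bounded F (1 + (real n + 1)) (Z a b + Z b 1)"
      by (intro coeff_bounded_add coeff_bounded_member F)
    then show ?thesis using Z[of a b 1] ab Suc.prems by (simp add: algebra_simps)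
  qed
qed

text \<open>Of the additive constant 2, one unit pays for rounding \<open>L / \<delta>\<close> up
  and one for the last, incomplete piece.\<close>

lemma coeff_bounded_additive_on_rectifiable':
  assumes "path \<gamma>" "finite F" "0 < \<delta>"
    "\<And>a b c. 0 \<le> a \<Longrightarrow> a \<le> b \<Longrightarrow> b \<le> c \<Longrightarrow> c \<le> 1 \<Longrightarrow> Z a c = Z a b + Z b c"
    "\<And>a b. 0 \<le> a \<Longrightarrow> a \<le> b \<Longrightarrow> b \<le> 1 \<Longrightarrow> (\<And>s. s \<in> {a..b} \<Longrightarrow> d (\<gamma> a) (\<gamma> s) \<le> \<delta>) \<Longrightarrow> Z a b \<in> F"
    and L: "\<And>x. x \<in> polygon_sums d 0 1 \<gamma> \<Longrightarrow> x \<le> L"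
  shows "coeff_bounded F (L / \<delta> + 2) (Z 0 1)"
proof -
  have L0: "0 \<le> L" using L[OF polygon_sums_0] by simp
  define n where "n = nat \<lceil>L / \<delta>\<rceil>"
  have n: "L / \<delta> \<le> real n" "real n \<le> L / \<delta> + 1"
    using L0 assms(3) by (auto simp: n_def intro: real_nat_ceiling_ge) 
  have "L \<le> real n * \<delta>" using n(1) assms(3) by (simp add: field_simps)
  then have "coeff_bounded F (real n + 1) (Z 0 1)"
    by (intro coeff_bounded_additive_on_rectifiable[OF assms(1-5)]) (use L in fastforce)+
  then show ?thesis by (rule coeff_bounded_mono) (use n in simp)
qed

text \<open>Every point is joined to the base point through a nearby point of a finite net. On small
  sets path chains are homologous to differences of a potential \<open>\<kappa>\<close>, so the
  class of a short path depends only on the net points at its two ends, and there are finitely many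
  such pairs.\<close>

lemma finite_small_lasso_classes:
  assumes good: "\<And>x :: 'm. \<exists>U \<kappa>. open U \<and> x \<in> U \<and> (\<forall>\<gamma>. path \<gamma> \<and> path_image \<gamma> \<subseteq> U \<longrightarrow>
     real_1boundary (path_chain \<gamma> - (\<kappa> (\<gamma> 1) - \<kappa> (\<gamma> 0))))"
  obtains x0 :: 'm and \<rho> \<delta> where "0 < \<delta>" "joining_chains x0 \<rho>"
    "finite {lasso_class \<rho> \<gamma> | \<gamma>. path \<gamma> \<and> (\<forall>s\<in>{0..1}. d (\<gamma> 0) (\<gamma> s) \<le> \<delta>)}"
proof -
  let ?\<C> = "{U :: 'm set. \<exists>\<kappa>. \<forall>\<gamma>. path \<gamma> \<and> path_image \<gamma> \<subseteq> U \<longrightarrow>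
     real_1boundary (path_chain \<gamma> - (\<kappa> (\<gamma> 1) - \<kappa> (\<gamma> 0)))}"
  have "\<exists>U\<in>?\<C>. open U \<and> x \<in> U" for x using good[of x] by blast
  from lebesgue_number[OF this]
  obtain \<epsilon> where \<epsilon>: "\<epsilon> > 0" and leb: "\<And>x. \<exists>U\<in>?\<C>. \<forall>y. d x y < \<epsilon> \<longrightarrow> y \<in> U" by blast
  have "\<exists>\<kappa>. \<forall>\<gamma>. path \<gamma> \<and> (\<forall>s\<in>{0..1}. d x (\<gamma> s) < \<epsilon>) \<longrightarrow>
      real_1boundary (path_chain \<gamma> - (\<kappa> (\<gamma> 1) - \<kappa> (\<gamma> 0)))" for x
  proof -
    obtain U \<kappa> where U: "\<forall>y. d x y < \<epsilon> \<longrightarrow> y \<in> U" and \<kappa>: "\<forall>\<gamma>. path \<gamma> \<and> path_image \<gamma> \<subseteq> U \<longrightarrow>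
      real_1boundary (path_chain \<gamma> - (\<kappa> (\<gamma> 1) - \<kappa> (\<gamma> 0)))" using leb[of x] by blast
    have "path_image \<gamma> \<subseteq> U" if "\<forall>s\<in>{0..1}. d x (\<gamma> s) < \<epsilon>" for \<gamma>
      using that U unfolding path_image_def by blast
    then show ?thesis using \<kappa> by blast
  qed
  then obtain \<kappa> where \<kappa>: "\<And>x \<gamma>. path \<gamma> \<Longrightarrow> (\<And>s. s \<in> {0..1} \<Longrightarrow> d x (\<gamma> s) < \<epsilon>) \<Longrightarrow>
      real_1boundary (path_chain \<gamma> - (\<kappa> x (\<gamma> 1) - \<kappa> x (\<gamma> 0)))" by metis
  \<comment> \<open>A short path together with the arcs from net points to its ends stays within
    \<open>3 * \<delta>\<close> of the net point at its start, safely below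
    \<open>\<epsilon>\<close>.\<close>
  define \<delta> where "\<delta> = \<epsilon> / 4"
  have \<delta>: "0 < \<delta>" "4 * \<delta> = \<epsilon>" using \<epsilon> by (simp_all add: \<delta>_def)
  obtain P where P: "finite P" "\<And>x. \<exists>p\<in>P. d p x < \<delta>" using finite_net[OF \<delta>(1)] by blast
  then obtain \<pi> where \<pi>: "\<And>q. \<pi> q \<in> P" "\<And>q. d (\<pi> q) q < \<delta>" by metis
  have "\<exists>r. path r \<and> r 0 = p \<and> r 1 = q \<and> (\<forall>s\<in>{0..1}. d p (r s) \<le> d p q \<and> d (r s) q \<le> d p q)" for p q
  proof -
    obtain b where b: "path b" "b 0 = p" "b 1 = q"
       "\<And>s t. s \<in> {0..1} \<Longrightarrow> t \<in> {0..1} \<Longrightarrow> d (b s) (b t) \<le> d p q * \<bar>s - t\<bar>" by (rule geodesic[of p q]) blast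
    have "d p (b s) \<le> d p q" "d (b s) q \<le> d p q" if "s \<in> {0..1}" for s
    proof -
      have "d p q * \<bar>0 - s\<bar> \<le> d p q" "d p q * \<bar>s - 1\<bar> \<le> d p q"
        using that d_nonneg[of p q] by (auto intro!: mult_left_le)
      then show "d p (b s) \<le> d p q" "d (b s) q \<le> d p q"
        using b(4)[of 0 s] b(4)[of s 1] that b(2,3) by auto
    qed
    then show ?thesis using b by blast
  qed
  then obtain r where r: "\<And>p q. path (r p q)" "\<And>p q. r p q 0 = p" "\<And>p q. r p q 1 = q"
    and rd: "\<And>p q s. s \<in> {0..1} \<Longrightarrow> d p (r p q s) \<le> d p q \<and> d (r p q s) q \<le> d p q" by metis
  define x0 :: 'm where "x0 = undefined"
  define \<rho> where "\<rho> q = path_chain (r x0 (\<pi> q)) + path_chain (r (\<pi> q) q)" for q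
  have j: "joining_chains x0 \<rho>"
    unfolding joining_chains_def \<rho>_def
    by (simp add: real_singular_chain_add real_singular_chain_path_chain real_boundary_add
        real_boundary_path_chain r del: One_nat_def)
  define S where "S = {\<gamma>. path \<gamma> \<and> (\<forall>s\<in>{0..1}. d (\<gamma> 0) (\<gamma> s) \<le> \<delta>)}"
  have eq: "lasso_class \<rho> \<gamma> = lasso_class \<rho> \<eta>"
    if \<gamma>: "\<gamma> \<in> S" and \<eta>: "\<eta> \<in> S" and e: "\<pi> (\<gamma> 0) = \<pi> (\<eta> 0)" "\<pi> (\<gamma> 1) = \<pi> (\<eta> 1)" for \<gamma> \<eta>
  proof -
    \<comment> \<open>The values of the potential at \<open>\<gamma> 0\<close> and
      \<open>\<gamma> 1\<close> cancel between the three arcs, and only those at the net points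
      remain.\<close>
    have *: "real_1boundary (path_chain (r (\<pi> (\<gamma> 0)) (\<gamma> 0)) + path_chain \<gamma> - path_chain (r (\<pi> (\<gamma> 1)) (\<gamma> 1))
        - (\<kappa> (\<pi> (\<gamma> 0)) (\<pi> (\<gamma> 1)) - \<kappa> (\<pi> (\<gamma> 0)) (\<pi> (\<gamma> 0))))" if \<gamma>: "\<gamma> \<in> S" for \<gamma>
    proof -
      let ?p = "\<pi> (\<gamma> 0)"
      have g: "path \<gamma>" "\<And>s. s \<in> {0..1} \<Longrightarrow> d (\<gamma> 0) (\<gamma> s) \<le> \<delta>" using \<gamma> by (auto simp: S_def)
      have p0: "d ?p (\<gamma> 0) < \<delta>" "d (\<pi> (\<gamma> 1)) (\<gamma> 1) < \<delta>" by (rule \<pi>)+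
      have d1: "d ?p (\<gamma> s) < \<epsilon>" if "s \<in> {0..1}" for s
        using g(2)[OF that] p0 d_triangle[of ?p "\<gamma> s" "\<gamma> 0"] \<delta> by linarith
      have d2: "d ?p (r ?p (\<gamma> 0) s) < \<epsilon>" if "s \<in> {0..1}" for s
        using rd[OF that, of ?p "\<gamma> 0"] p0 \<delta> by linarith
      have d3: "d ?p (r (\<pi> (\<gamma> 1)) (\<gamma> 1) s) < \<epsilon>" if "s \<in> {0..1}" for s
        using rd[OF that, of "\<pi> (\<gamma> 1)" "\<gamma> 1"] p0 \<delta> g(2)[of 1]
          d_triangle[of ?p "r (\<pi> (\<gamma> 1)) (\<gamma> 1) s" "\<gamma> 1"] d_triangle[of ?p "\<gamma> 1" "\<gamma> 0"]
          d_sym[of "\<gamma> 1" "r (\<pi> (\<gamma> 1)) (\<gamma> 1) s"] by force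
      have "real_1boundary ((path_chain (r ?p (\<gamma> 0)) - (\<kappa> ?p (\<gamma> 0) - \<kappa> ?p ?p))
         + (path_chain \<gamma> - (\<kappa> ?p (\<gamma> 1) - \<kappa> ?p (\<gamma> 0)))
         - (path_chain (r (\<pi> (\<gamma> 1)) (\<gamma> 1)) - (\<kappa> ?p (\<gamma> 1) - \<kappa> ?p (\<pi> (\<gamma> 1)))))"
        using real_1boundary_diff[OF real_1boundary_add[OF \<kappa>[OF r(1) d2] \<kappa>[OF g(1) d1]] \<kappa>[OF r(1) d3]]
        by (simp only: r)
      then show ?thesis by (simp add: algebra_simps)
    qed
    have p: "path \<gamma>" "path \<eta>" using \<gamma> \<eta> by (auto simp: S_def)
    show ?thesis
      unfolding lasso_class_def H1_class_eq_iff[OF real_1cycle_lasso[OF j p(1)] real_1cycle_lasso[OF j p(2)]]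
      using real_1boundary_diff[OF *[OF \<gamma>] *[OF \<eta>]] e by (simp add: \<rho>_def algebra_simps)
  qed
  have "lasso_class \<rho> ` S \<subseteq> (\<lambda>(p, q). lasso_class \<rho> (SOME \<gamma>. \<gamma> \<in> S \<and> \<pi> (\<gamma> 0) = p \<and> \<pi> (\<gamma> 1) = q)) ` (P \<times> P)"
  proof clarify
    fix \<gamma> assume \<gamma>: "\<gamma> \<in> S"
    define \<eta> where "\<eta> = (SOME \<eta>. \<eta> \<in> S \<and> \<pi> (\<eta> 0) = \<pi> (\<gamma> 0) \<and> \<pi> (\<eta> 1) = \<pi> (\<gamma> 1))"
    have "\<eta> \<in> S \<and> \<pi> (\<eta> 0) = \<pi> (\<gamma> 0) \<and> \<pi> (\<eta> 1) = \<pi> (\<gamma> 1)"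
      unfolding \<eta>_def by (rule someI[of _ \<gamma>]) (simp add: \<gamma>)
    then have "lasso_class \<rho> \<gamma> = lasso_class \<rho> \<eta>" by (intro eq[OF \<gamma>]) simp_all
    then show "lasso_class \<rho> \<gamma> \<in> (\<lambda>(p, q). lasso_class \<rho> (SOME \<gamma>. \<gamma> \<in> S \<and> \<pi> (\<gamma> 0) = p \<and> \<pi> (\<gamma> 1) = q)) ` (P \<times> P)"
      using \<pi>(1) by (intro image_eqI[of _ _ "(\<pi> (\<gamma> 0), \<pi> (\<gamma> 1))"]) (simp_all add: \<eta>_def)
  qed
  then have "finite (lasso_class \<rho> ` S)" using P(1) finite_subset by blast
  then have "finite {lasso_class \<rho> \<gamma> | \<gamma>. path \<gamma> \<and> (\<forall>s\<in>{0..1}. d (\<gamma> 0) (\<gamma> s) \<le> \<delta>)}"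
    by (rule rev_finite_subset) (auto simp: S_def)
  with \<delta>(1) j show ?thesis by (rule that)
qed

end

section \<open>Curves in charts\<close>

lemma Ck_on_1_has_derivative:
  assumes "Ck_on 1 S F" "open S" "y \<in> S"
  shows "(F has_derivative frechet_derivative F (at y)) (at y)"
  using assms by (auto simp: frechet_derivative_works[symmetric] differentiable_on_eq_differentiable_at)

lemma Ck_on_1_differentiable:
  assumes "Ck_on 1 S F" "open S" "y \<in> S" shows "F differentiable (at y)"
  using Ck_on_1_has_derivative[OF assms] by (auto simp: differentiable_def)

lemma linear_frechet_derivative_at:
  "F differentiable (at y) \<Longrightarrow> linear (frechet_derivative F (at y))"
  by (rule linear_frechet_derivative)

text \<open>\<open>Ck_on\<close> gives continuity of the derivative in the base point for each fixed
  vector. Expanding \<open>v t\<close> in the basis lets both vary.\<close>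

lemma continuous_on_frechet_derivative_apply:
  fixes F :: "'e::euclidean_space \<Rightarrow> 'b::real_normed_vector"
  assumes F: "Ck_on 1 S F" "open S" and y: "continuous_on T y" "y ` T \<subseteq> S" and v: "continuous_on T v"
  shows "continuous_on T (\<lambda>t. frechet_derivative F (at (y t)) (v t))"
proof -
  have "frechet_derivative F (at (y t)) (v t) =
      (\<Sum>b\<in>Basis. (v t \<bullet> b) *\<^sub>R frechet_derivative F (at (y t)) b)" if "t \<in> T" for t
  proof -
    have "linear (frechet_derivative F (at (y t)))"
      using y(2) that by (intro linear_frechet_derivative_at Ck_on_1_differentiable[OF F]) auto
    then show ?thesis
      by (subst euclidean_representation[of "v t", symmetric]) (simp add: linear_sum linear_cmul)
  qed
  moreover have "continuous_on T (\<lambda>t. \<Sum>b\<in>Basis. (v t \<bullet> b) *\<^sub>R frechet_derivative F (at (y t)) b)"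
  proof (intro continuous_intros v)
    fix b :: 'e
    have "continuous_on S (\<lambda>x. frechet_derivative F (at x) b)" using F(1) by simp
    then show "continuous_on T (\<lambda>t. frechet_derivative F (at (y t)) b)"
      by (rule continuous_on_compose2[OF _ y])
  qed
  ultimately show ?thesis by (simp cong: continuous_on_cong)
qed

lemma has_vector_derivative_frechet_compose:
  assumes "(\<eta> has_vector_derivative D) (at t within I)" "F differentiable (at (\<eta> t))"
  shows "((F \<circ> \<eta>) has_vector_derivative frechet_derivative F (at (\<eta> t)) D) (at t within I)"
proof -
  have "(F has_derivative frechet_derivative F (at (\<eta> t))) (at (\<eta> t) within \<eta> ` I)"
    using assms(2) frechet_derivative_works has_derivative_at_withinI by blast
  from diff_chain_within[OF assms(1)[unfolded has_vector_derivative_def] this]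
  have "((F \<circ> \<eta>) has_derivative (\<lambda>s. frechet_derivative F (at (\<eta> t)) (s *\<^sub>R D))) (at t within I)"
    by (simp add: o_def)
  then show ?thesis
    unfolding has_vector_derivative_def
    using linear_frechet_derivative_at[OF assms(2)] by (simp add: linear_cmul)
qed

text \<open>The preimage is relatively open in \<open>I\<close>, so derivatives, including one-sided
  ones, may be computed inside a chart domain.\<close>

lemma at_within_Int_vimage:
  assumes "continuous_on I \<gamma>" "open U" "t \<in> I" "\<gamma> t \<in> U"
  shows "at t within (I \<inter> \<gamma> -` U) = at t within I"
proof -
  obtain T where T: "open T" "T \<inter> I = \<gamma> -` U \<inter> I"
    using assms(1,2) unfolding continuous_on_open_invariant by metis
  have "t \<in> T" using T(2) assms by auto
  then show ?thesis
    by (rule at_within_nhd[OF _ T(1)]) (use T(2) in auto)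
qed

lemma continuous_on_locally:
  fixes I :: "real set"
  assumes "continuous_on I \<gamma>"
    and "\<And>t. t \<in> I \<Longrightarrow> \<exists>U. open U \<and> \<gamma> t \<in> U \<and> continuous_on (I \<inter> \<gamma> -` U) h"
  shows "continuous_on I h"
  unfolding continuous_on_eq_continuous_within
proof
  fix t assume t: "t \<in> I"
  then obtain U where U: "open U" "\<gamma> t \<in> U" "continuous_on (I \<inter> \<gamma> -` U) h" using assms(2) by blast
  have "continuous (at t within (I \<inter> \<gamma> -` U)) h"
    using U t by (auto simp: continuous_on_eq_continuous_within)
  then show "continuous (at t within I) h"
    unfolding continuous_within at_within_Int_vimage[OF assms(1) U(1) t U(2)] .
qed

section \<open>Charts, transition maps and velocities\<close>

definition chart_inv :: "('m, 'e) chart \<Rightarrow> 'e \<Rightarrow> 'm" where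
  "chart_inv c = inv_into (fst c) (snd c)"

locale atlas =
  fixes A :: "('m::t2_space, 'e::euclidean_space) chart set"
  assumes atlas: "smooth_atlas A"
begin

lemma chart_at_in: "chart_at A x \<in> A" and chart_at_mem: "x \<in> fst (chart_at A x)"
proof -
  have "\<exists>c. c \<in> A \<and> x \<in> fst c" using atlas unfolding smooth_atlas_def by force
  from someI_ex[OF this] show "chart_at A x \<in> A" "x \<in> fst (chart_at A x)"
    by (simp_all add: chart_at_def)
qed

lemma chart_homeomorphism:
  assumes "c \<in> A"
  shows "open (fst c)" "open (snd c ` fst c)" "homeomorphism (fst c) (snd c ` fst c) (snd c) (chart_inv c)"
  using atlas assms unfolding smooth_atlas_def chart_inv_def by (auto simp: case_prod_beta)

lemma chart_inv:
  assumes "c \<in> A"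
  shows "continuous_on (fst c) (snd c)" "continuous_on (snd c ` fst c) (chart_inv c)"
    "x \<in> fst c \<Longrightarrow> chart_inv c (snd c x) = x"
    "y \<in> snd c ` fst c \<Longrightarrow> snd c (chart_inv c y) = y" "y \<in> snd c ` fst c \<Longrightarrow> chart_inv c y \<in> fst c"
  using chart_homeomorphism(3)[OF assms] by (auto simp: homeomorphism_def)

lemma open_chart_image:
  assumes "c \<in> A" "open V" shows "open (snd c ` (fst c \<inter> V))"
proof -
  have "snd c ` (fst c \<inter> V) = snd c ` fst c \<inter> chart_inv c -` V"
    using chart_inv[OF assms(1)] by (auto simp: image_iff) (metis+)?
  then show ?thesis
    using continuous_open_preimage[OF chart_inv(2)[OF assms(1)] chart_homeomorphism(2)[OF assms(1)] assms(2)]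
    by simp
qed

lemma transition:
  assumes "c \<in> A" "c' \<in> A"
  shows "Ck_on k (snd c ` (fst c \<inter> fst c')) (snd c' \<circ> chart_inv c)"
  using atlas assms unfolding smooth_atlas_def chart_inv_def by (fastforce simp: case_prod_beta)

lemma transition_differentiable:
  assumes "c \<in> A" "c' \<in> A" "x \<in> fst c" "x \<in> fst c'"
  shows "(snd c' \<circ> chart_inv c) differentiable (at (snd c x))"
  using assms by (intro Ck_on_1_differentiable[OF transition open_chart_image] chart_homeomorphism) auto

text \<open>The chain rule read through the chart \<open>c\<close>. The composite of chart and
  inverse agrees with \<open>\<gamma>\<close> only inside the chart domain, hence the passage to a
  smaller set. For \<open>h\<close> one takes another chart, possibly preceded by a map of the
  manifold.\<close>

lemma has_vector_derivative_via_chart: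
  assumes c: "c \<in> A" "\<gamma> t \<in> fst c" and t: "t \<in> I" and \<gamma>: "continuous_on I \<gamma>"
    and D: "((snd c \<circ> \<gamma>) has_vector_derivative D) (at t within I)"
    and h: "(h \<circ> chart_inv c) differentiable (at (snd c (\<gamma> t)))"
  shows "((h \<circ> \<gamma>) has_vector_derivative frechet_derivative (h \<circ> chart_inv c) (at (snd c (\<gamma> t))) D) (at t within I)"
proof -
  have "(((h \<circ> chart_inv c) \<circ> (snd c \<circ> \<gamma>)) has_vector_derivative
      frechet_derivative (h \<circ> chart_inv c) (at (snd c (\<gamma> t))) D) (at t within I)"
    using has_vector_derivative_frechet_compose[OF D, of "h \<circ> chart_inv c"] h by simp
  moreover have "at t within I = at t within (I \<inter> \<gamma> -` fst c)"
    using at_within_Int_vimage[OF \<gamma> chart_homeomorphism(1)[OF c(1)] t c(2)] by simp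
  ultimately have "(((h \<circ> chart_inv c) \<circ> (snd c \<circ> \<gamma>)) has_vector_derivative
      frechet_derivative (h \<circ> chart_inv c) (at (snd c (\<gamma> t))) D) (at t within (I \<inter> \<gamma> -` fst c))" by simp
  then have "((h \<circ> \<gamma>) has_vector_derivative
      frechet_derivative (h \<circ> chart_inv c) (at (snd c (\<gamma> t))) D) (at t within (I \<inter> \<gamma> -` fst c))"
    by (rule has_vector_derivative_transform[rotated 2]) (use t c chart_inv(3)[OF c(1)] in auto)
  then show ?thesis
    using at_within_Int_vimage[OF \<gamma> chart_homeomorphism(1)[OF c(1)] t c(2)] by simp
qed

lemma C1_curve_onD:
  assumes "C1_curve_on A I \<gamma>" "c \<in> A"
  obtains D where "continuous_on (I \<inter> \<gamma> -` fst c) D"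
    "\<And>t. t \<in> I \<Longrightarrow> \<gamma> t \<in> fst c \<Longrightarrow> ((snd c \<circ> \<gamma>) has_vector_derivative D t) (at t within I)"
  using assms unfolding C1_curve_on_def by (fastforce simp: case_prod_beta)

lemma C1_curve_on_continuous: "C1_curve_on A I \<gamma> \<Longrightarrow> continuous_on I \<gamma>"
  by (simp add: C1_curve_on_def)

lemma C1_curve_onI:
  assumes "continuous_on I \<gamma>"
    and "\<And>c. c \<in> A \<Longrightarrow> \<exists>D. continuous_on (I \<inter> \<gamma> -` fst c) D \<and>
      (\<forall>t \<in> I \<inter> \<gamma> -` fst c. ((snd c \<circ> \<gamma>) has_vector_derivative D t) (at t within I))"
  shows "C1_curve_on A I \<gamma>"
  using assms unfolding C1_curve_on_def by (auto simp: case_prod_beta)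

lemma C1_curve_on_subset:
  assumes "C1_curve_on A I \<gamma>" "J \<subseteq> I" shows "C1_curve_on A J \<gamma>"
proof (rule C1_curve_onI)
  show "continuous_on J \<gamma>" using assms C1_curve_on_continuous continuous_on_subset by blast
  fix c assume "c \<in> A"
  then obtain D where D: "continuous_on (I \<inter> \<gamma> -` fst c) D"
    "\<And>t. t \<in> I \<Longrightarrow> \<gamma> t \<in> fst c \<Longrightarrow> ((snd c \<circ> \<gamma>) has_vector_derivative D t) (at t within I)"
    using C1_curve_onD[OF assms(1)] by blast
  then show "\<exists>D. continuous_on (J \<inter> \<gamma> -` fst c) D \<and>
      (\<forall>t \<in> J \<inter> \<gamma> -` fst c. ((snd c \<circ> \<gamma>) has_vector_derivative D t) (at t within J))"
    using assms(2) by (intro exI[of _ D] conjI ballI)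
      (auto intro: continuous_on_subset has_vector_derivative_within_subset)
qed

lemma C1_curve_on_cong:
  assumes \<gamma>: "C1_curve_on A I \<gamma>" and eq: "\<And>t. t \<in> I \<Longrightarrow> \<eta> t = \<gamma> t"
  shows "C1_curve_on A I \<eta>"
proof (rule C1_curve_onI)
  show "continuous_on I \<eta>" using C1_curve_on_continuous[OF \<gamma>] eq by (simp cong: continuous_on_cong)
  fix c assume "c \<in> A"
  then obtain D where D: "continuous_on (I \<inter> \<gamma> -` fst c) D"
    "\<And>t. t \<in> I \<Longrightarrow> \<gamma> t \<in> fst c \<Longrightarrow> ((snd c \<circ> \<gamma>) has_vector_derivative D t) (at t within I)"
    using C1_curve_onD[OF \<gamma>] by blast
  have e: "I \<inter> \<eta> -` fst c = I \<inter> \<gamma> -` fst c" using eq by auto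
  have "((snd c \<circ> \<eta>) has_vector_derivative D t) (at t within I)" if "t \<in> I" "\<gamma> t \<in> fst c" for t
    by (rule has_vector_derivative_transform[OF that(1) _ D(2)[OF that]]) (simp add: eq)
  then show "\<exists>D. continuous_on (I \<inter> \<eta> -` fst c) D \<and>
      (\<forall>t \<in> I \<inter> \<eta> -` fst c. ((snd c \<circ> \<eta>) has_vector_derivative D t) (at t within I))"
    unfolding e using D(1) by (intro exI[of _ D]) auto
qed

lemma C1_curve_on_single_chart:
  assumes c: "c \<in> A" "\<gamma> ` I \<subseteq> fst c" and \<gamma>: "continuous_on I \<gamma>" and D: "continuous_on I D"
    "\<And>t. t \<in> I \<Longrightarrow> ((snd c \<circ> \<gamma>) has_vector_derivative D t) (at t within I)"
  shows "C1_curve_on A I \<gamma>"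
proof (rule C1_curve_onI[OF \<gamma>])
  fix c' assume c': "c' \<in> A"
  let ?D = "\<lambda>t. frechet_derivative (snd c' \<circ> chart_inv c) (at (snd c (\<gamma> t))) (D t)"
  have "continuous_on (I \<inter> \<gamma> -` fst c') ?D"
  proof (rule continuous_on_frechet_derivative_apply[OF transition[OF c(1) c'] open_chart_image])
    show "continuous_on (I \<inter> \<gamma> -` fst c') (\<lambda>t. snd c (\<gamma> t))"
      by (rule continuous_on_compose2[OF chart_inv(1)[OF c(1)]])
        (use c \<gamma> in \<open>auto intro: continuous_on_subset\<close>)
  qed (use c c' D chart_homeomorphism in \<open>auto intro: continuous_on_subset\<close>)
  moreover have "((snd c' \<circ> \<gamma>) has_vector_derivative ?D t) (at t within I)" if "t \<in> I" "\<gamma> t \<in> fst c'" for t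
    by (rule has_vector_derivative_via_chart[OF c(1) _ that(1) \<gamma> D(2)])
      (use that c c' in \<open>auto intro!: transition_differentiable\<close>)
  ultimately show "\<exists>D. continuous_on (I \<inter> \<gamma> -` fst c') D \<and>
      (\<forall>t \<in> I \<inter> \<gamma> -` fst c'. ((snd c' \<circ> \<gamma>) has_vector_derivative D t) (at t within I))"
    by (intro exI[of _ ?D]) auto
qed

lemma C1_curve_on_reparam:
  assumes \<gamma>: "C1_curve_on A J \<gamma>" and h: "h ` I \<subseteq> J" "\<And>t. t \<in> I \<Longrightarrow> (h has_vector_derivative h' t) (at t within I)"
    and h': "continuous_on I h'"
  shows "C1_curve_on A I (\<gamma> \<circ> h)"
proof (rule C1_curve_onI)
  have hc: "continuous_on I h"
    using h(2) has_vector_derivative_continuous continuous_on_eq_continuous_within by blast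
  show "continuous_on I (\<gamma> \<circ> h)"
    using continuous_on_compose[OF hc continuous_on_subset[OF C1_curve_on_continuous[OF \<gamma>] h(1)]] .
  fix c assume "c \<in> A"
  then obtain D where D: "continuous_on (J \<inter> \<gamma> -` fst c) D"
    "\<And>t. t \<in> J \<Longrightarrow> \<gamma> t \<in> fst c \<Longrightarrow> ((snd c \<circ> \<gamma>) has_vector_derivative D t) (at t within J)"
    using C1_curve_onD[OF \<gamma>] by blast
  let ?D = "\<lambda>t. h' t *\<^sub>R D (h t)"
  have "continuous_on (I \<inter> (\<gamma> \<circ> h) -` fst c) ?D"
    by (intro continuous_intros continuous_on_compose2[OF D(1)] continuous_on_subset[OF hc]
        continuous_on_subset[OF h']) (use h(1) in auto)
  moreover have "((snd c \<circ> (\<gamma> \<circ> h)) has_vector_derivative ?D t) (at t within I)"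
    if "t \<in> I" "\<gamma> (h t) \<in> fst c" for t
  proof -
    have "((snd c \<circ> \<gamma>) has_vector_derivative D (h t)) (at (h t) within h ` I)"
      using D(2)[of "h t"] that h(1) by (auto intro: has_vector_derivative_within_subset)
    from vector_diff_chain_within[OF h(2)[OF that(1)] this] show ?thesis by (simp add: o_def)
  qed
  ultimately show "\<exists>D. continuous_on (I \<inter> (\<gamma> \<circ> h) -` fst c) D \<and>
      (\<forall>t \<in> I \<inter> (\<gamma> \<circ> h) -` fst c. ((snd c \<circ> (\<gamma> \<circ> h)) has_vector_derivative D t) (at t within I))"
    by (intro exI[of _ ?D]) auto
qed

lemma velocity_eq:
  assumes "((snd (chart_at A (\<gamma> t)) \<circ> \<gamma>) has_vector_derivative D) (at t within I)" "at t within I \<noteq> bot"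
  shows "velocity A I \<gamma> t = D"
  using vector_derivative_within[OF assms(2,1)] by (simp add: velocity_def)

lemma velocity_works:
  assumes "C1_curve_on A I \<gamma>" "t \<in> I" "at t within I \<noteq> bot"
  shows "((snd (chart_at A (\<gamma> t)) \<circ> \<gamma>) has_vector_derivative velocity A I \<gamma> t) (at t within I)"
proof -
  obtain D where "((snd (chart_at A (\<gamma> t)) \<circ> \<gamma>) has_vector_derivative D) (at t within I)"
    using C1_curve_onD[OF assms(1) chart_at_in[of "\<gamma> t"]] assms(2) chart_at_mem by metis
  then show ?thesis using velocity_eq assms(3) by metis
qed

lemma velocity_cong:
  assumes "\<And>t. t \<in> I \<Longrightarrow> \<eta> t = \<gamma> t" "C1_curve_on A I \<gamma>" "t \<in> I" "at t within I \<noteq> bot"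
  shows "velocity A I \<eta> t = velocity A I \<gamma> t"
proof (rule velocity_eq)
  show "(snd (chart_at A (\<eta> t)) \<circ> \<eta> has_vector_derivative velocity A I \<gamma> t) (at t within I)"
    by (rule has_vector_derivative_transform[OF assms(3) _ velocity_works[OF assms(2-4), folded assms(1)[OF assms(3)]]])
      (simp add: assms(1))
qed fact

lemma velocity_reparam:
  assumes \<gamma>: "C1_curve_on A J \<gamma>" and h: "h ` I \<subseteq> J" "(h has_vector_derivative h') (at t within I)"
    and t: "t \<in> I" "at t within I \<noteq> bot" "at (h t) within J \<noteq> bot"
  shows "velocity A I (\<gamma> \<circ> h) t = h' *\<^sub>R velocity A J \<gamma> (h t)"
proof (rule velocity_eq)
  have "((snd (chart_at A (\<gamma> (h t))) \<circ> \<gamma>) has_vector_derivative velocity A J \<gamma> (h t)) (at (h t) within h ` I)"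
    using velocity_works[OF \<gamma> _ t(3)] h(1) t(1) by (auto intro: has_vector_derivative_within_subset)
  from vector_diff_chain_within[OF h(2) this]
  show "(snd (chart_at A ((\<gamma> \<circ> h) t)) \<circ> (\<gamma> \<circ> h) has_vector_derivative h' *\<^sub>R velocity A J \<gamma> (h t)) (at t within I)"
    by (simp add: o_def)
qed fact

text \<open>The coordinate change from the chart \<open>c\<close> to the preferred chart at
  \<open>x\<close>, in which \<open>velocity\<close> and \<open>g\<close> are expressed.\<close>

definition to_preferred :: "('m, 'e) chart \<Rightarrow> 'm \<Rightarrow> 'e \<Rightarrow> 'e" where
  "to_preferred c x = frechet_derivative (snd (chart_at A x) \<circ> chart_inv c) (at (snd c x))"

lemma linear_to_preferred: "c \<in> A \<Longrightarrow> x \<in> fst c \<Longrightarrow> linear (to_preferred c x)"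
  unfolding to_preferred_def
  by (intro linear_frechet_derivative_at transition_differentiable chart_at_in chart_at_mem)

lemma to_preferred_chart_at: "to_preferred (chart_at A x) x v = v"
proof -
  let ?c = "chart_at A x"
  have "((\<lambda>y. y) has_derivative (\<lambda>v. v)) (at (snd ?c x))" by (rule has_derivative_ident)
  then have "((snd ?c \<circ> chart_inv ?c) has_derivative (\<lambda>v. v)) (at (snd ?c x))"
    by (rule has_derivative_transform_within_open[OF _ chart_homeomorphism(2)[OF chart_at_in[of x]]])
      (use chart_at_mem chart_inv(4)[OF chart_at_in[of x]] in auto)
  then have "frechet_derivative (snd ?c \<circ> chart_inv ?c) (at (snd ?c x)) = (\<lambda>v. v)"
    by (rule frechet_derivative_at[symmetric])
  then show ?thesis by (simp add: to_preferred_def)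
qed

lemma velocity_via_chart:
  assumes "c \<in> A" "\<gamma> t \<in> fst c" "t \<in> I" "continuous_on I \<gamma>" "at t within I \<noteq> bot"
    and "((snd c \<circ> \<gamma>) has_vector_derivative D) (at t within I)"
  shows "velocity A I \<gamma> t = to_preferred c (\<gamma> t) D"
  unfolding to_preferred_def using assms
  by (intro velocity_eq has_vector_derivative_via_chart transition_differentiable chart_at_in chart_at_mem)

end

section \<open>The metric in coordinates\<close>

locale riemannian = atlas A for A :: "('m::t2_space, 'e::euclidean_space) chart set" +
  fixes g :: "'m \<Rightarrow> 'e \<Rightarrow> 'e \<Rightarrow> real"
  assumes metric: "riemannian_metric A g"
begin

lemma g_bilinear: "bilinear (g x)" and g_sym: "g x v w = g x w v" and g_pos: "v \<noteq> 0 \<Longrightarrow> 0 < g x v v"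
  using metric by (auto simp: riemannian_metric_def)

lemma g_bounded_bilinear: "bounded_bilinear (g x)"
  using g_bilinear bilinear_conv_bounded_bilinear by blast

lemma g_nonneg: "0 \<le> g x v v"
  using g_pos[of v x] bounded_bilinear.zero_left[OF g_bounded_bilinear] by (cases "v = 0") auto

lemma rnorm_nonneg: "0 \<le> rnorm g x v" and rnorm_power2: "(rnorm g x v)\<^sup>2 = g x v v"
  using g_nonneg by (auto simp: rnorm_def)

lemma rnorm_pos: "v \<noteq> 0 \<Longrightarrow> 0 < rnorm g x v"
  using g_pos by (simp add: rnorm_def)

lemma rnorm_scaleR: "rnorm g x (a *\<^sub>R v) = \<bar>a\<bar> * rnorm g x v"
  by (simp add: rnorm_def bounded_bilinear.scaleR_left[OF g_bounded_bilinear]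
      bounded_bilinear.scaleR_right[OF g_bounded_bilinear] real_sqrt_mult flip: mult.assoc)

lemma g_Cauchy_Schwarz: "g x v w \<le> rnorm g x v * rnorm g x w"
proof (cases "w = 0")
  case True
  then show ?thesis using rnorm_nonneg bounded_bilinear.zero_right[OF g_bounded_bilinear] by simp
next
  case False
  interpret bounded_bilinear "g x" by (rule g_bounded_bilinear)
  let ?a = "rnorm g x v" and ?b = "rnorm g x w"
  have b: "?b > 0" using False by (rule rnorm_pos)
  \<comment> \<open>Positivity is tested on the combination of \<open>v\<close> and \<open>w\<close>
    whose two parts have equal length.\<close>
  have "0 \<le> g x (?b *\<^sub>R v - ?a *\<^sub>R w) (?b *\<^sub>R v - ?a *\<^sub>R w)" by (rule g_nonneg)
  also have "\<dots> = ?b\<^sup>2 * g x v v + ?a\<^sup>2 * g x w w - 2 * ?a * ?b * g x v w"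
    using g_sym[of x w v]
    by (simp add: diff_left diff_right scaleR_left scaleR_right power2_eq_square algebra_simps)
  also have "\<dots> = 2 * ?a * ?b * (?a * ?b - g x v w)"
    by (simp add: rnorm_power2[symmetric] power2_eq_square algebra_simps)
  finally have *: "0 \<le> 2 * ?a * ?b * (?a * ?b - g x v w)" .
  show ?thesis
  proof (cases "v = 0")
    case True
    then show ?thesis using b zero_left rnorm_nonneg by simp
  next
    case False
    then have "0 < 2 * ?a * ?b" using b rnorm_pos by simp
    then show ?thesis using * by (simp add: zero_le_mult_iff)
  qed
qed

text \<open>The preferred chart may jump from point to point, so for fixed \<open>v\<close>,
  \<open>w\<close> the number \<open>g x v w\<close> need not vary continuously with
  \<open>x\<close>. Read in one chart, it does.\<close>

definition coord_metric :: "('m, 'e) chart \<Rightarrow> 'e \<Rightarrow> 'e \<Rightarrow> 'e \<Rightarrow> real" where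
  "coord_metric c y v w = g (chart_inv c y) (to_preferred c (chart_inv c y) v) (to_preferred c (chart_inv c y) w)"

lemma coord_metric_chart_at: "coord_metric (chart_at A p) (snd (chart_at A p) p) v w = g p v w"
  by (simp add: coord_metric_def chart_inv(3)[OF chart_at_in chart_at_mem] to_preferred_chart_at)

lemma continuous_on_coord_metric:
  assumes "c \<in> A" shows "continuous_on (snd c ` fst c) (\<lambda>y. coord_metric c y v w)"
proof -
  have "\<forall>(U, \<phi>)\<in>A. \<forall>v w k. Ck_on k (\<phi> ` U)
        (\<lambda>y. let x = inv_into U \<phi> y;
                  J = frechet_derivative (snd (chart_at A x) \<circ> inv_into U \<phi>) (at y)
              in g x (J v) (J w))"
    using metric unfolding riemannian_metric_def by (rule conjunct2)
  then have "\<forall>v w k. Ck_on k (snd c ` fst c)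
        (\<lambda>y. let x = inv_into (fst c) (snd c) y;
                  J = frechet_derivative (snd (chart_at A x) \<circ> inv_into (fst c) (snd c)) (at y)
              in g x (J v) (J w))"
    using assms by (cases c) (simp only: fst_conv snd_conv, blast)
  then have "Ck_on 0 (snd c ` fst c)
        (\<lambda>y. let x = inv_into (fst c) (snd c) y;
                  J = frechet_derivative (snd (chart_at A x) \<circ> inv_into (fst c) (snd c)) (at y)
              in g x (J v) (J w))" by blast
  then have "continuous_on (snd c ` fst c) (\<lambda>y. g (chart_inv c y)
       (frechet_derivative (snd (chart_at A (chart_inv c y)) \<circ> chart_inv c) (at y) v)
       (frechet_derivative (snd (chart_at A (chart_inv c y)) \<circ> chart_inv c) (at y) w))"
    by (simp add: Let_def chart_inv_def)
  then show ?thesis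
    by (rule continuous_on_eq) (simp add: coord_metric_def to_preferred_def chart_inv[OF assms])
qed

lemma coord_metric_bilinear:
  assumes "c \<in> A" "y \<in> snd c ` fst c" shows "bounded_bilinear (coord_metric c y)"
proof -
  let ?x = "chart_inv c y"
  have "bounded_linear (to_preferred c ?x)"
    using linear_to_preferred[OF assms(1), of ?x] chart_inv(5)[OF assms] linear_conv_bounded_linear by blast
  from bounded_bilinear.comp[OF g_bounded_bilinear[of ?x] this this]
  show ?thesis by (simp add: coord_metric_def[abs_def])
qed

lemma coord_metric_expand:
  assumes "c \<in> A" "y \<in> snd c ` fst c"
  shows "coord_metric c y v w = (\<Sum>i\<in>Basis. \<Sum>j\<in>Basis. (v \<bullet> i) * (w \<bullet> j) * coord_metric c y i j)"
proof -
  interpret bounded_bilinear "coord_metric c y" by (rule coord_metric_bilinear[OF assms])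
  have "coord_metric c y v w = coord_metric c y (\<Sum>i\<in>Basis. (v \<bullet> i) *\<^sub>R i) (\<Sum>j\<in>Basis. (w \<bullet> j) *\<^sub>R j)"
    by (simp only: euclidean_representation)
  also have "\<dots> = (\<Sum>i\<in>Basis. \<Sum>j\<in>Basis. (v \<bullet> i) * (w \<bullet> j) * coord_metric c y i j)"
    unfolding sum_left unfolding sum_right scaleR_left scaleR_right by (simp add: mult.left_commute mult.assoc)
  finally show ?thesis .
qed

lemma continuous_on_coord_metric_apply:
  assumes c: "c \<in> A" and y: "continuous_on T y" "y ` T \<subseteq> snd c ` fst c" and v: "continuous_on T v"
  shows "continuous_on T (\<lambda>t. coord_metric c (y t) (v t) (v t))"
proof -
  have "continuous_on T (\<lambda>t. \<Sum>i\<in>Basis. \<Sum>j\<in>Basis. (v t \<bullet> i) * (v t \<bullet> j) * coord_metric c (y t) i j)"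
    by (intro continuous_intros v continuous_on_compose2[OF continuous_on_coord_metric[OF c] y])
  then show ?thesis
    by (rule continuous_on_eq) (rule coord_metric_expand[OF c, symmetric], use y(2) in auto)
qed

lemma speed_via_chart:
  assumes "c \<in> A" "\<gamma> t \<in> fst c" "t \<in> I" "continuous_on I \<gamma>" "at t within I \<noteq> bot"
    and "((snd c \<circ> \<gamma>) has_vector_derivative D) (at t within I)"
  shows "rnorm g (\<gamma> t) (velocity A I \<gamma> t) = sqrt (coord_metric c (snd c (\<gamma> t)) D D)"
  using velocity_via_chart[OF assms] assms(1,2)
  by (simp add: rnorm_def coord_metric_def chart_inv)

text \<open>The velocity may jump with the preferred chart; its length can be computed in one fixed
  chart near each time.\<close>

lemma continuous_on_speed:
  assumes \<gamma>: "C1_curve_on A I \<gamma>" and I: "\<And>t. t \<in> I \<Longrightarrow> at t within I \<noteq> bot"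
  shows "continuous_on I (\<lambda>t. rnorm g (\<gamma> t) (velocity A I \<gamma> t))"
proof (rule continuous_on_locally[OF C1_curve_on_continuous[OF \<gamma>]])
  fix t0 assume "t0 \<in> I"
  define c where "c = chart_at A (\<gamma> t0)"
  have c: "c \<in> A" "\<gamma> t0 \<in> fst c" by (auto simp: c_def chart_at_in chart_at_mem)
  obtain D where D: "continuous_on (I \<inter> \<gamma> -` fst c) D"
    "\<And>t. t \<in> I \<Longrightarrow> \<gamma> t \<in> fst c \<Longrightarrow> ((snd c \<circ> \<gamma>) has_vector_derivative D t) (at t within I)"
    using C1_curve_onD[OF \<gamma> c(1)] by blast
  have "continuous_on (I \<inter> \<gamma> -` fst c) (\<lambda>t. sqrt (coord_metric c (snd c (\<gamma> t)) (D t) (D t)))"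
  proof (intro continuous_intros continuous_on_coord_metric_apply[OF c(1)] D(1))
    show "continuous_on (I \<inter> \<gamma> -` fst c) (\<lambda>t. snd c (\<gamma> t))"
      by (rule continuous_on_compose2[OF chart_inv(1)[OF c(1)] continuous_on_subset[OF C1_curve_on_continuous[OF \<gamma>]]]) auto
  qed auto
  then have "continuous_on (I \<inter> \<gamma> -` fst c) (\<lambda>t. rnorm g (\<gamma> t) (velocity A I \<gamma> t))"
    by (rule continuous_on_eq)
      (use speed_via_chart[OF c(1) _ _ C1_curve_on_continuous[OF \<gamma>] I D(2)] in auto)
  then show "\<exists>U. open U \<and> \<gamma> t0 \<in> U \<and> continuous_on (I \<inter> \<gamma> -` U) (\<lambda>t. rnorm g (\<gamma> t) (velocity A I \<gamma> t))"
    using c chart_homeomorphism(1)[OF c(1)] by blast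
qed

end

section \<open>Riemannian arc length\<close>

lemma at_within_Icc_neq_bot: "a < b \<Longrightarrow> t \<in> {a..b} \<Longrightarrow> at t within {a..b} \<noteq> (bot :: real filter)"
  by (simp add: trivial_limit_within)

context riemannian
begin

definition piecewise_C1_on :: "real \<Rightarrow> real \<Rightarrow> (real \<Rightarrow> 'm) \<Rightarrow> bool" where
  "piecewise_C1_on a b \<gamma> \<longleftrightarrow> continuous_on {a..b} \<gamma> \<and> (\<exists>S. finite S \<and>
     (\<forall>c d. a \<le> c \<and> c < d \<and> d \<le> b \<and> {c<..<d} \<inter> S = {} \<longrightarrow> C1_curve_on A {c..d} \<gamma>))"

text \<open>The two-sided velocity makes the integrand independent of the interval. At ends and
  break points its value may be meaningless, but these are finitely many points and do not affect
  integrals.\<close>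

definition speed :: "(real \<Rightarrow> 'm) \<Rightarrow> real \<Rightarrow> real" where
  "speed \<gamma> t = rnorm g (\<gamma> t) (velocity A UNIV \<gamma> t)"

definition arc_length :: "real \<Rightarrow> real \<Rightarrow> (real \<Rightarrow> 'm) \<Rightarrow> real" where
  "arc_length a b \<gamma> = integral {a..b} (speed \<gamma>)"

lemma piecewise_C1_path_eq: "piecewise_C1_path A \<gamma> \<longleftrightarrow> piecewise_C1_on 0 1 \<gamma>"
  by (simp add: piecewise_C1_path_def piecewise_C1_on_def path_def)

lemma speed_nonneg: "0 \<le> speed \<gamma> t"
  by (simp add: speed_def rnorm_nonneg)

lemma velocity_interior: "t \<in> interior I \<Longrightarrow> velocity A I \<gamma> t = velocity A UNIV \<gamma> t"
  by (simp add: velocity_def at_within_interior[of t I])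

lemma speed_interior: "t \<in> {a<..<b} \<Longrightarrow> speed \<gamma> t = rnorm g (\<gamma> t) (velocity A {a..b} \<gamma> t)"
  by (simp add: speed_def velocity_interior[of t "{a..b}"])

lemma speed_integrable_C1:
  assumes "C1_curve_on A {a..b} \<gamma>" shows "speed \<gamma> integrable_on {a..b}"
proof (cases "a < b")
  case True
  have "continuous_on {a..b} (\<lambda>t. rnorm g (\<gamma> t) (velocity A {a..b} \<gamma> t))"
    by (rule continuous_on_speed[OF assms]) (use True at_within_Icc_neq_bot in auto)
  then have "(\<lambda>t. rnorm g (\<gamma> t) (velocity A {a..b} \<gamma> t)) integrable_on {a..b}"
    by (rule integrable_continuous_real)
  then show ?thesis
    by (rule integrable_spike_finite[of "{a, b}", rotated 2]) (auto intro!: speed_interior)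
next
  case False
  then have "b < a \<or> b = a" by auto
  then show ?thesis using integrable_on_refl[of "speed \<gamma>" a] by auto
qed

lemma C1_imp_piecewise_C1:
  assumes "C1_curve_on A {a..b} \<gamma>" shows "piecewise_C1_on a b \<gamma>"
  unfolding piecewise_C1_on_def
  using C1_curve_on_continuous[OF assms] C1_curve_on_subset[OF assms] by auto

lemma piecewise_C1_on_subinterval:
  assumes "piecewise_C1_on a b \<gamma>" "a \<le> a'" "b' \<le> b" shows "piecewise_C1_on a' b' \<gamma>"
proof -
  obtain S where S: "continuous_on {a..b} \<gamma>" "finite S"
    "\<And>c d. a \<le> c \<Longrightarrow> c < d \<Longrightarrow> d \<le> b \<Longrightarrow> {c<..<d} \<inter> S = {} \<Longrightarrow> C1_curve_on A {c..d} \<gamma>"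
    using assms(1) unfolding piecewise_C1_on_def by blast
  have "C1_curve_on A {c..d} \<gamma>" if "a' \<le> c" "c < d" "d \<le> b'" "{c<..<d} \<inter> S = {}" for c d
    using that assms(2,3) by (intro S(3)) auto
  then show ?thesis
    unfolding piecewise_C1_on_def using S assms(2,3) by (auto intro: continuous_on_subset)
qed

lemma piecewise_C1_on_nice:
  assumes "piecewise_C1_on a b \<gamma>"
  obtains S where "finite S"
    "\<And>t. t \<in> {a<..<b} \<Longrightarrow> t \<notin> S \<Longrightarrow> \<exists>c d. a \<le> c \<and> c < t \<and> t < d \<and> d \<le> b \<and> C1_curve_on A {c..d} \<gamma>"
proof -
  obtain S where S: "finite S"
    "\<And>c d. a \<le> c \<Longrightarrow> c < d \<Longrightarrow> d \<le> b \<Longrightarrow> {c<..<d} \<inter> S = {} \<Longrightarrow> C1_curve_on A {c..d} \<gamma>"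
    using assms unfolding piecewise_C1_on_def by blast
  show ?thesis
  proof (rule that[OF S(1)])
    fix t assume t: "t \<in> {a<..<b}" "t \<notin> S"
    obtain \<delta> where \<delta>: "\<delta> > 0" "\<forall>x\<in>S. x \<noteq> t \<longrightarrow> \<delta> \<le> dist t x" using finite_set_avoid[OF S(1)] by blast
    let ?c = "max a (t - \<delta>)" and ?d = "min b (t + \<delta>)"
    have "{?c<..<?d} \<inter> S = {}"
      using \<delta>(2) t(2) by (force simp: dist_real_def)
    then have "C1_curve_on A {?c..?d} \<gamma>" using t \<delta>(1) by (intro S(2)) auto
    moreover have "a \<le> ?c" "?c < t" "t < ?d" "?d \<le> b" using t \<delta>(1) by auto
    ultimately show "\<exists>c d. a \<le> c \<and> c < t \<and> t < d \<and> d \<le> b \<and> C1_curve_on A {c..d} \<gamma>" by blast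
  qed
qed

text \<open>Bisection avoids ordering the break points: a short interval around \<open>x\<close>
  contains no break point except possibly \<open>x\<close>, so cutting it there leaves two smooth
  pieces.\<close>

lemma speed_integrable:
  assumes "piecewise_C1_on a b \<gamma>" "a \<le> b" shows "speed \<gamma> integrable_on {a..b}"
proof -
  obtain S where S: "finite S"
    "\<And>c d. a \<le> c \<Longrightarrow> c < d \<Longrightarrow> d \<le> b \<Longrightarrow> {c<..<d} \<inter> S = {} \<Longrightarrow> C1_curve_on A {c..d} \<gamma>"
    using assms unfolding piecewise_C1_on_def by blast
  have piece: "speed \<gamma> integrable_on {c..d}" if "a \<le> c" "c \<le> d" "d \<le> b" "{c<..<d} \<inter> S = {}" for c d
  proof (cases "c = d")
    case True
    then show ?thesis using integrable_on_refl[of "speed \<gamma>" c] by simp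
  next
    case False
    then show ?thesis using that by (intro speed_integrable_C1 S(2)) auto
  qed
  have "a \<le> a \<longrightarrow> b \<le> b \<longrightarrow> speed \<gamma> integrable_on {a..b}"
  proof (rule Bolzano[where P = "\<lambda>s t. a \<le> s \<longrightarrow> t \<le> b \<longrightarrow> speed \<gamma> integrable_on {s..t}", OF assms(2)])
    fix s t u assume "a \<le> s \<longrightarrow> t \<le> b \<longrightarrow> speed \<gamma> integrable_on {s..t}"
      "a \<le> t \<longrightarrow> u \<le> b \<longrightarrow> speed \<gamma> integrable_on {t..u}" "s \<le> t" "t \<le> u"
    then show "a \<le> s \<longrightarrow> u \<le> b \<longrightarrow> speed \<gamma> integrable_on {s..u}"
      using Henstock_Kurzweil_Integration.integrable_combine[where a = s and c = t and b = u and f = "speed \<gamma>"] by auto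
  next
    fix x assume x: "a \<le> x" "x \<le> b"
    obtain \<delta> where \<delta>: "\<delta> > 0" "\<forall>y\<in>S. y \<noteq> x \<longrightarrow> \<delta> \<le> dist x y" using finite_set_avoid[OF S(1)] by blast
    have "speed \<gamma> integrable_on {s..t}" if "s \<le> x" "x \<le> t" "t - s < \<delta>" "a \<le> s" "t \<le> b" for s t
    proof -
      have "{s<..<x} \<inter> S = {}" "{x<..<t} \<inter> S = {}" using \<delta>(2) that by (force simp: dist_real_def)+
      then have "speed \<gamma> integrable_on {s..x}" "speed \<gamma> integrable_on {x..t}"
        using that x by (auto intro!: piece)
      then show ?thesis using Henstock_Kurzweil_Integration.integrable_combine[where a = s and c = x and b = t and f = "speed \<gamma>"] that by auto
    qed
    then show "\<exists>\<delta>>0. \<forall>s t. s \<le> x \<and> x \<le> t \<and> t - s < \<delta> \<longrightarrow> a \<le> s \<longrightarrow> t \<le> b \<longrightarrow> speed \<gamma> integrable_on {s..t}"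
      using \<delta>(1) by blast
  qed
  then show ?thesis by simp
qed

lemma arc_length_nonneg: "piecewise_C1_on a b \<gamma> \<Longrightarrow> a \<le> b \<Longrightarrow> 0 \<le> arc_length a b \<gamma>"
  unfolding arc_length_def by (intro integral_nonneg speed_integrable speed_nonneg)

lemma arc_length_combine:
  assumes "piecewise_C1_on a c \<gamma>" "a \<le> b" "b \<le> c"
  shows "arc_length a c \<gamma> = arc_length a b \<gamma> + arc_length b c \<gamma>"
  unfolding arc_length_def using Henstock_Kurzweil_Integration.integral_combine[OF assms(2,3) speed_integrable[OF assms(1)]]
    assms(2,3) by simp

lemma piecewise_C1_on_cong:
  assumes \<gamma>: "piecewise_C1_on a b \<gamma>" and eq: "\<And>t. t \<in> {a..b} \<Longrightarrow> \<eta> t = \<gamma> t"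
  shows "piecewise_C1_on a b \<eta>" "arc_length a b \<eta> = arc_length a b \<gamma>"
proof -
  obtain S where S: "continuous_on {a..b} \<gamma>" "finite S"
    "\<And>c d. a \<le> c \<Longrightarrow> c < d \<Longrightarrow> d \<le> b \<Longrightarrow> {c<..<d} \<inter> S = {} \<Longrightarrow> C1_curve_on A {c..d} \<gamma>"
    using \<gamma> unfolding piecewise_C1_on_def by blast
  have "C1_curve_on A {c..d} \<eta>" if "a \<le> c" "c < d" "d \<le> b" "{c<..<d} \<inter> S = {}" for c d
    by (rule C1_curve_on_cong[OF S(3)[OF that]]) (use that eq in auto)
  then show "piecewise_C1_on a b \<eta>"
    unfolding piecewise_C1_on_def using S(2) continuous_on_eq[OF S(1), of \<eta>] eq by auto
  obtain S' where S': "finite S'"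
    "\<And>t. t \<in> {a<..<b} \<Longrightarrow> t \<notin> S' \<Longrightarrow> \<exists>c d. a \<le> c \<and> c < t \<and> t < d \<and> d \<le> b \<and> C1_curve_on A {c..d} \<gamma>"
    using piecewise_C1_on_nice[OF \<gamma>] by blast
  have "speed \<eta> t = speed \<gamma> t" if t: "t \<in> {a..b} - (S' \<union> {a, b})" for t
  proof -
    obtain c d where cd: "a \<le> c" "c < t" "t < d" "d \<le> b" "C1_curve_on A {c..d} \<gamma>"
      using S'(2)[of t] t by auto
    have "velocity A {c..d} \<eta> t = velocity A {c..d} \<gamma> t"
      by (rule velocity_cong[OF _ cd(5)]) (use cd eq at_within_Icc_neq_bot[of c d t] in auto)
    then show ?thesis using speed_interior[of t c d] cd eq[of t] by simp
  qed
  then show "arc_length a b \<eta> = arc_length a b \<gamma>"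
    unfolding arc_length_def using S'(1) by (intro integral_spike[of "S' \<union> {a, b}"] negligible_finite) auto
qed

lemma piecewise_C1_on_combine:
  assumes "piecewise_C1_on a b \<gamma>" "piecewise_C1_on b c \<gamma>" "a \<le> b" "b \<le> c"
  shows "piecewise_C1_on a c \<gamma>"
proof -
  obtain S where S: "continuous_on {a..b} \<gamma>" "finite S"
    "\<And>s t. a \<le> s \<Longrightarrow> s < t \<Longrightarrow> t \<le> b \<Longrightarrow> {s<..<t} \<inter> S = {} \<Longrightarrow> C1_curve_on A {s..t} \<gamma>"
    using assms(1) unfolding piecewise_C1_on_def by blast
  obtain S' where S': "continuous_on {b..c} \<gamma>" "finite S'"
    "\<And>s t. b \<le> s \<Longrightarrow> s < t \<Longrightarrow> t \<le> c \<Longrightarrow> {s<..<t} \<inter> S' = {} \<Longrightarrow> C1_curve_on A {s..t} \<gamma>"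
    using assms(2) unfolding piecewise_C1_on_def by blast
  have "C1_curve_on A {s..t} \<gamma>" if "a \<le> s" "s < t" "t \<le> c" "{s<..<t} \<inter> (insert b (S \<union> S')) = {}" for s t
  proof -
    have "b \<notin> {s<..<t}" "{s<..<t} \<inter> S = {}" "{s<..<t} \<inter> S' = {}" using that(4) by blast+
    moreover from this(1) have "t \<le> b \<or> b \<le> s" using that by auto
    ultimately show ?thesis using S(3)[OF that(1,2)] S'(3)[OF _ that(2,3)] by fastforce
  qed
  moreover have "continuous_on {a..c} \<gamma>"
    using continuous_on_closed_Un[OF _ _ S(1) S'(1)] assms(3,4) by (simp add: ivl_disj_un_two_touch)
  ultimately show ?thesis
    unfolding piecewise_C1_on_def using S(2) S'(2)
    by (intro conjI exI[of _ "insert b (S \<union> S')"]) (simp_all del: Int_insert_right)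
qed

lemma affine_image_Icc:
  fixes m k :: real assumes "m \<noteq> 0" "c \<le> d"
  shows "(\<lambda>x. m * x + k) ` {c..d} = {min (m * c + k) (m * d + k)..max (m * c + k) (m * d + k)}"
  using assms image_affinity_atLeastAtMost[of m k c d]
  by (cases "m \<ge> 0") (auto simp: min_def max_def mult_le_cancel_left)

text \<open>The factor \<open>m\<close> may be negative, so reversal of paths is included along with
  shifts and rescalings.\<close>

lemma piecewise_C1_on_affine:
  assumes \<gamma>: "piecewise_C1_on a' b' \<gamma>" and m: "m \<noteq> 0" and ab: "a \<le> b"
    and im: "(\<lambda>x. m * x + k) ` {a..b} = {a'..b'}"
  shows "piecewise_C1_on a b (\<lambda>x. \<gamma> (m * x + k))"
    "arc_length a b (\<lambda>x. \<gamma> (m * x + k)) = arc_length a' b' \<gamma>"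
proof -
  define h where "h x = m * x + k" for x
  have ab': "a' \<le> b'" using ab im by (metis atLeastatMost_empty_iff2 image_is_empty)
  have hd: "(h has_vector_derivative m) (at t within I)" for t I
    unfolding h_def has_real_derivative_iff_has_vector_derivative[symmetric]
    by (auto intro!: derivative_eq_intros)
  have eq: "(\<lambda>x. \<gamma> (m * x + k)) = \<gamma> \<circ> h" by (simp add: h_def o_def)
  have inj: "inj h" using m by (auto simp: inj_def h_def)
  obtain S where S: "continuous_on {a'..b'} \<gamma>" "finite S"
    "\<And>c d. a' \<le> c \<Longrightarrow> c < d \<Longrightarrow> d \<le> b' \<Longrightarrow> {c<..<d} \<inter> S = {} \<Longrightarrow> C1_curve_on A {c..d} \<gamma>"
    using \<gamma> unfolding piecewise_C1_on_def by blast
  have him: "h ` {a..b} = {a'..b'}" using im by (simp add: h_def)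
  have "C1_curve_on A {c..d} (\<gamma> \<circ> h)" if cd: "a \<le> c" "c < d" "d \<le> b" "{c<..<d} \<inter> h -` S = {}" for c d
  proof -
    let ?l = "min (h c) (h d)" and ?u = "max (h c) (h d)"
    have i: "h ` {c..d} = {?l..?u}" using affine_image_Icc[OF m, of c d k] cd by (simp add: h_def)
    have ne: "h c \<noteq> h d" using inj cd by (auto dest: injD)
    have "h ` {c..d} \<subseteq> {a'..b'}" using him cd by auto
    then have "a' \<le> ?l" "?u \<le> b'" unfolding i using ne by auto
    moreover have "?l < ?u" using ne by auto
    moreover have "{?l<..<?u} \<inter> S = {}"
    proof (rule ccontr)
      assume "{?l<..<?u} \<inter> S \<noteq> {}"
      then obtain y where y: "y \<in> S" "?l < y" "y < ?u" by auto
      then have "y \<in> h ` {c..d}" using i by auto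
      then obtain x where x: "x \<in> {c..d}" "y = h x" by blast
      then have "x \<noteq> c" "x \<noteq> d" using y by auto
      then have "x \<in> {c<..<d} \<inter> h -` S" using x y(1) by auto
      then show False using cd(4) by blast
    qed
    ultimately have "C1_curve_on A {?l..?u} \<gamma>" by (intro S(3)) auto
    then show ?thesis
      by (rule C1_curve_on_reparam) (use i hd in auto)
  qed
  moreover have "finite (h -` S)" using S(2) inj by (rule finite_vimageI)
  moreover have "continuous_on {a..b} (\<gamma> \<circ> h)"
    by (rule continuous_on_compose) (use S(1) him in \<open>auto simp: h_def intro!: continuous_intros\<close>)
  ultimately show "piecewise_C1_on a b (\<lambda>x. \<gamma> (m * x + k))"
    unfolding eq piecewise_C1_on_def by blast
  obtain S' where S': "finite S'"
    "\<And>t. t \<in> {a'<..<b'} \<Longrightarrow> t \<notin> S' \<Longrightarrow> \<exists>c d. a' \<le> c \<and> c < t \<and> t < d \<and> d \<le> b' \<and> C1_curve_on A {c..d} \<gamma>"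
    using piecewise_C1_on_nice[OF \<gamma>] by blast
  have sp: "speed (\<gamma> \<circ> h) t = \<bar>m\<bar> * speed \<gamma> (h t)" if t: "t \<in> {a..b} - h -` (S' \<union> {a', b'})" for t
  proof -
    have "h t \<in> {a'..b'}" using t him by auto
    then obtain c d where cd: "c < h t" "h t < d" "C1_curve_on A {c..d} \<gamma>"
      using S'(2)[of "h t"] t by force
    define J where "J = h -` {c<..<d}"
    have "open J" unfolding J_def h_def by (intro open_vimage continuous_intros open_greaterThanLessThan)
    then have J: "t \<in> interior J" using cd by (auto simp: J_def interior_open)
    have "velocity A J (\<gamma> \<circ> h) t = m *\<^sub>R velocity A {c..d} \<gamma> (h t)"
    proof (rule velocity_reparam[OF cd(3) _ hd])
      show tJ: "t \<in> J" using cd by (simp add: J_def)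
      show "at t within J \<noteq> bot" using at_within_open[OF tJ \<open>open J\<close>] by simp
      show "at (h t) within {c..d} \<noteq> bot" using cd by (intro at_within_Icc_neq_bot) auto
      show "h ` J \<subseteq> {c..d}" by (auto simp: J_def)
    qed
    then show ?thesis
      using velocity_interior[OF J] speed_interior[of "h t" c d] cd by (simp add: speed_def rnorm_scaleR)
  qed
  have "(speed \<gamma> has_integral arc_length a' b' \<gamma>) {a'..b'}"
    unfolding arc_length_def using speed_integrable[OF \<gamma> ab'] by (rule integrable_integral)
  from has_integral_affinity[OF this[unfolded interval_cbox] m, of k]
  have "((\<lambda>x. speed \<gamma> (h x)) has_integral (1 / \<bar>m\<bar>) * arc_length a' b' \<gamma>)
     ((\<lambda>x. (1 / m) *\<^sub>R x + -((1 / m) *\<^sub>R k)) ` {a'..b'})"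
    by (simp add: h_def)
  moreover have "(\<lambda>x. (1 / m) *\<^sub>R x + -((1 / m) *\<^sub>R k)) ` {a'..b'} = {a..b}"
    unfolding im[symmetric] image_image using m by (simp add: field_simps)
  ultimately have int: "((\<lambda>x. \<bar>m\<bar> * speed \<gamma> (h x)) has_integral \<bar>m\<bar> * ((1 / \<bar>m\<bar>) * arc_length a' b' \<gamma>)) {a..b}"
    by (intro has_integral_mult_right) simp
  have fin: "finite (h -` (S' \<union> {a', b'}))" using S'(1) by (intro finite_vimageI inj) simp
  have "((\<lambda>x. speed (\<gamma> \<circ> h) x) has_integral \<bar>m\<bar> * ((1 / \<bar>m\<bar>) * arc_length a' b' \<gamma>)) {a..b}"
    by (rule has_integral_spike_finite[OF fin sp int])
  then show "arc_length a b (\<lambda>x. \<gamma> (m * x + k)) = arc_length a' b' \<gamma>"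
    unfolding eq arc_length_def using m by (simp add: integral_unique)
qed

section \<open>Lengths of paths between two points\<close>

definition joining_lengths :: "'m \<Rightarrow> 'm \<Rightarrow> real set" where
  "joining_lengths x y = {arc_length 0 1 \<gamma> | \<gamma>. piecewise_C1_on 0 1 \<gamma> \<and> \<gamma> 0 = x \<and> \<gamma> 1 = y}"

lemma riem_dist_eq: "riem_dist A g x y = Inf (joining_lengths x y)"
proof -
  \<comment> \<open>One-sided and two-sided velocities can differ only at the two ends.\<close>
  have "integral {0..1} (\<lambda>t. rnorm g (\<gamma> t) (velocity A {0..1} \<gamma> t)) = arc_length 0 1 \<gamma>" for \<gamma>
    unfolding arc_length_def
    by (rule integral_spike[of "{0, 1}"]) (auto intro!: speed_interior)
  then show ?thesis
    unfolding riem_dist_def joining_lengths_def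
    by (simp add: piecewise_C1_path_eq pathstart_def pathfinish_def)
qed

lemma joining_lengths_nonneg: "l \<in> joining_lengths x y \<Longrightarrow> 0 \<le> l"
  unfolding joining_lengths_def using arc_length_nonneg[of 0 1] by fastforce

lemma arc_length_in_joining_lengths:
  assumes "piecewise_C1_on a b \<gamma>" "a < b"
  shows "arc_length a b \<gamma> \<in> joining_lengths (\<gamma> a) (\<gamma> b)"
proof -
  have "(\<lambda>x. (b - a) * x + a) ` {0..1} = {a..b}"
    using image_affinity_atLeastAtMost[of "b - a" a 0 1] assms(2) by simp
  from piecewise_C1_on_affine[OF assms(1) _ _ this]
  show ?thesis using assms(2) unfolding joining_lengths_def
    by (intro CollectI exI[of _ "\<lambda>x. \<gamma> ((b - a) * x + a)"]) auto
qed

lemma riem_dist_le: "l \<in> joining_lengths x y \<Longrightarrow> riem_dist A g x y \<le> l"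
  unfolding riem_dist_eq by (rule cInf_lower) (auto intro!: bdd_belowI[of _ 0] joining_lengths_nonneg)

lemma C1_curve_on_const: "C1_curve_on A I (\<lambda>_. x)"
  by (intro C1_curve_onI exI[of _ "\<lambda>_. 0"]) (auto simp: o_def)

lemma joining_lengths_refl: "0 \<in> joining_lengths x x"
proof -
  have "velocity A UNIV (\<lambda>_. x) t = 0" for t by (simp add: velocity_def o_def vector_derivative_const_at)
  then have "speed (\<lambda>_. x) t = 0" for t
    using rnorm_scaleR[of x 0 0] by (simp add: speed_def)
  then have "speed (\<lambda>_. x) = (\<lambda>_. 0)" by (rule ext)
  then have "arc_length 0 1 (\<lambda>_. x) = 0" by (simp add: arc_length_def)
  then show ?thesis
    using arc_length_in_joining_lengths[OF C1_imp_piecewise_C1[OF C1_curve_on_const], of 0 1 x] by simp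
qed

lemma riem_dist_le_arc_length:
  assumes "piecewise_C1_on a b \<gamma>" "a \<le> b" shows "riem_dist A g (\<gamma> a) (\<gamma> b) \<le> arc_length a b \<gamma>"
proof (cases "a = b")
  case True
  then show ?thesis using riem_dist_le[OF joining_lengths_refl] by (simp add: arc_length_def)
next
  case False
  then show ?thesis using assms by (intro riem_dist_le arc_length_in_joining_lengths) auto
qed

lemma joining_lengths_sym: assumes "l \<in> joining_lengths x y" shows "l \<in> joining_lengths y x"
proof -
  obtain \<gamma> where \<gamma>: "l = arc_length 0 1 \<gamma>" "piecewise_C1_on 0 1 \<gamma>" "\<gamma> 0 = x" "\<gamma> 1 = y"
    using assms by (auto simp: joining_lengths_def)
  have "(\<lambda>x. (-1) * x + 1) ` {0..1} = {0..1 :: real}"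
    using image_affinity_atLeastAtMost[of "-1 :: real" 1 0 1] by simp
  from piecewise_C1_on_affine[OF \<gamma>(2) _ _ this]
  have "piecewise_C1_on 0 1 (\<lambda>x. \<gamma> ((-1) * x + 1))" "arc_length 0 1 (\<lambda>x. \<gamma> ((-1) * x + 1)) = l"
    using \<gamma>(1) by auto
  then show ?thesis unfolding joining_lengths_def
    by (intro CollectI exI[of _ "\<lambda>x. \<gamma> ((-1) * x + 1)"]) (auto simp: \<gamma>)
qed

lemma joining_lengths_add:
  assumes "l \<in> joining_lengths x y" "k \<in> joining_lengths y z" shows "l + k \<in> joining_lengths x z"
proof -
  obtain \<gamma> where \<gamma>: "l = arc_length 0 1 \<gamma>" "piecewise_C1_on 0 1 \<gamma>" "\<gamma> 0 = x" "\<gamma> 1 = y"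
    using assms by (auto simp: joining_lengths_def)
  obtain \<eta> where \<eta>: "k = arc_length 0 1 \<eta>" "piecewise_C1_on 0 1 \<eta>" "\<eta> 0 = y" "\<eta> 1 = z"
    using assms by (auto simp: joining_lengths_def)
  \<comment> \<open>The joined path lives on \<open>[0,2]\<close>. The shift is written as
    \<open>1 * t + (-1)\<close> to match the affine substitution.\<close>
  define \<zeta> where "\<zeta> t = (if t \<le> 1 then \<gamma> t else \<eta> (1 * t + (-1)))" for t
  have 1: "piecewise_C1_on 0 1 \<zeta>" "arc_length 0 1 \<zeta> = l"
    using piecewise_C1_on_cong[OF \<gamma>(2), of \<zeta>] \<gamma>(1) by (auto simp: \<zeta>_def)
  have im: "(\<lambda>x. 1 * x + (-1)) ` {1..2} = {0..1 :: real}"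
    using image_affinity_atLeastAtMost[of "1 :: real" "-1" 1 2] by simp
  note s = piecewise_C1_on_affine[OF \<eta>(2) _ _ im]
  have "\<zeta> t = \<eta> (1 * t + (-1))" if "t \<in> {1..2}" for t
    using that \<gamma>(4) \<eta>(3) by (cases "t = 1") (auto simp: \<zeta>_def)
  then have 2: "piecewise_C1_on 1 2 \<zeta>" "arc_length 1 2 \<zeta> = k"
    using piecewise_C1_on_cong[OF s(1), of \<zeta>] s(2) \<eta>(1) by auto
  have "piecewise_C1_on 0 2 \<zeta>" by (rule piecewise_C1_on_combine[OF 1(1) 2(1)]) auto
  then have "arc_length 0 2 \<zeta> \<in> joining_lengths (\<zeta> 0) (\<zeta> 2)" "arc_length 0 2 \<zeta> = l + k"
    using arc_length_combine[of 0 2 \<zeta> 1] 1(2) 2(2) arc_length_in_joining_lengths[of 0 2 \<zeta>] by simp_all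
  then show ?thesis using \<gamma>(3) \<eta>(4) by (simp add: \<zeta>_def)
qed

end

section \<open>The Riemannian distance\<close>

context riemannian
begin

definition chart_ball :: "'m \<Rightarrow> real \<Rightarrow> 'm set" where
  "chart_ball p \<rho> = {x \<in> fst (chart_at A p). snd (chart_at A p) x \<in> ball (snd (chart_at A p) p) \<rho>}"

definition chart_diff :: "'m \<Rightarrow> 'm \<Rightarrow> 'e" where
  "chart_diff p q = snd (chart_at A p) q - snd (chart_at A p) p"

text \<open>On the ball the metric is within a factor 2 of the constant scalar product
  \<open>g p\<close>, and \<open>\<kappa>\<close> compares the latter with the Euclidean norm. The
  closed ball must lie in the chart image so that its preimage is compact.\<close>

definition comparison_ball :: "'m \<Rightarrow> real \<Rightarrow> real \<Rightarrow> bool" where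
  "comparison_ball p \<rho> \<kappa> \<longleftrightarrow> 0 < \<rho> \<and> 0 < \<kappa> \<and>
     cball (snd (chart_at A p) p) \<rho> \<subseteq> snd (chart_at A p) ` fst (chart_at A p) \<and>
     (\<forall>v. \<kappa> * norm v \<le> rnorm g p v) \<and>
     (\<forall>y \<in> cball (snd (chart_at A p) p) \<rho>. \<forall>v.
        rnorm g p v \<le> 2 * sqrt (coord_metric (chart_at A p) y v v) \<and>
        sqrt (coord_metric (chart_at A p) y v v) \<le> 2 * rnorm g p v)"

lemma open_chart_ball: "open (chart_ball p \<rho>)"
proof -
  have "chart_ball p \<rho> = fst (chart_at A p) \<inter> snd (chart_at A p) -` ball (snd (chart_at A p) p) \<rho>"
    by (auto simp: chart_ball_def)
  then show ?thesis
    using continuous_open_preimage[OF chart_inv(1) chart_homeomorphism(1) open_ball] chart_at_in by metis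
qed

lemma chart_ball_centre: "0 < \<rho> \<Longrightarrow> p \<in> chart_ball p \<rho>"
  by (simp add: chart_ball_def chart_at_mem)

lemma rnorm_lower_bound: "\<exists>\<kappa>>0. \<forall>v. \<kappa> * norm v \<le> rnorm g p v"
proof -
  interpret bounded_bilinear "g p" by (rule g_bounded_bilinear)
  obtain b :: 'e where b: "b \<in> Basis" using nonempty_Basis by blast
  have "continuous_on (sphere 0 1) (\<lambda>v. rnorm g p v)"
    unfolding rnorm_def by (intro continuous_on continuous_on_id continuous_on_real_sqrt)
  moreover have "sphere (0::'e) 1 \<noteq> {}" using b norm_Basis[OF b] by auto
  ultimately obtain v0 where "v0 \<in> sphere 0 1" "\<And>v. v \<in> sphere 0 1 \<Longrightarrow> rnorm g p v0 \<le> rnorm g p v"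
    using continuous_attains_inf[of "sphere (0::'e) 1" "\<lambda>v. rnorm g p v"] compact_sphere by metis
  then have v0: "norm v0 = 1" "\<And>v. norm v = 1 \<Longrightarrow> rnorm g p v0 \<le> rnorm g p v" by auto
  have "rnorm g p v0 * norm v \<le> rnorm g p v" for v
  proof (cases "v = 0")
    case False
    then have "rnorm g p v0 \<le> rnorm g p ((1 / norm v) *\<^sub>R v)" by (intro v0(2)) simp
    then show ?thesis using False by (simp add: rnorm_scaleR field_simps)
  qed (simp add: rnorm_nonneg)
  moreover have "0 < rnorm g p v0" using v0(1) by (intro rnorm_pos) auto
  ultimately show ?thesis by blast
qed

lemma ex_comparison_ball: "\<exists>\<rho> \<kappa>. comparison_ball p \<rho> \<kappa>"
proof -
  define c where "c = chart_at A p"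
  define y0 where "y0 = snd c p"
  have c: "c \<in> A" "p \<in> fst c" by (auto simp: c_def chart_at_in chart_at_mem)
  have y0: "y0 \<in> snd c ` fst c" using c by (auto simp: y0_def)
  obtain \<kappa> where \<kappa>: "\<kappa> > 0" "\<And>v. \<kappa> * norm v \<le> rnorm g p v" using rnorm_lower_bound by blast
  have \<kappa>2: "\<kappa>\<^sup>2 * (norm v)\<^sup>2 \<le> g p v v" for v
    using power_mono[OF \<kappa>(2)[of v], of 2] \<kappa>(1) by (simp add: rnorm_power2 power_mult_distrib)
  let ?n = "real DIM('e)"
  have n0: "?n > 0" by simp
  \<comment> \<open>The \<open>?n * ?n\<close> coefficient errors, each weighted by at most the
    square of \<open>norm v\<close>, then add up to at most half of \<open>g p v v\<close>.\<close>
  define \<epsilon> where "\<epsilon> = \<kappa>\<^sup>2 / (2 * ?n * ?n)"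
  have \<epsilon>: "\<epsilon> > 0" using \<kappa>(1) n0 by (simp add: \<epsilon>_def)
  have ev: "\<forall>\<^sub>F y in nhds y0. \<bar>coord_metric c y i j - coord_metric c y0 i j\<bar> < \<epsilon>" for i j
  proof -
    have "isCont (\<lambda>y. coord_metric c y i j) y0"
      using continuous_on_coord_metric[OF c(1), of i j] continuous_on_eq_continuous_at[OF chart_homeomorphism(2)[OF c(1)]]
        y0 by blast
    then have "((\<lambda>y. coord_metric c y i j) \<longlongrightarrow> coord_metric c y0 i j) (nhds y0)"
      by (simp add: continuous_at tendsto_nhds_iff)
    from tendstoD[OF this \<epsilon>] show ?thesis by (simp add: dist_real_def)
  qed
  have "\<forall>\<^sub>F y in nhds y0. y \<in> snd c ` fst c \<and>
     (\<forall>i\<in>Basis. \<forall>j\<in>Basis. \<bar>coord_metric c y i j - coord_metric c y0 i j\<bar> < \<epsilon>)"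
    by (intro eventually_conj eventually_nhds_in_open chart_homeomorphism(2) c y0
        eventually_ball_finite finite_Basis ballI ev)
  then obtain \<rho> where \<rho>: "\<rho> > 0" "\<And>y. dist y y0 < \<rho> \<Longrightarrow> y \<in> snd c ` fst c \<and>
     (\<forall>i\<in>Basis. \<forall>j\<in>Basis. \<bar>coord_metric c y i j - coord_metric c y0 i j\<bar> < \<epsilon>)"
    unfolding eventually_nhds_metric by blast
  have est: "\<bar>coord_metric c y v v - g p v v\<bar> \<le> g p v v / 2" if y: "dist y y0 < \<rho>" for y v
  proof -
    have yc: "y \<in> snd c ` fst c" using \<rho>(2)[OF y] by blast
    have "coord_metric c y v v - g p v v = coord_metric c y v v - coord_metric c y0 v v"
      by (simp add: y0_def c_def coord_metric_chart_at)
    also have "\<dots> = (\<Sum>i\<in>Basis. \<Sum>j\<in>Basis. (v \<bullet> i) * (v \<bullet> j) * (coord_metric c y i j - coord_metric c y0 i j))"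
      unfolding coord_metric_expand[OF c(1) yc, of v] coord_metric_expand[OF c(1) y0, of v]
      by (simp add: sum_subtractf right_diff_distrib)
    also have "\<bar>\<dots>\<bar> \<le> (\<Sum>i\<in>(Basis::'e set). \<Sum>j\<in>(Basis::'e set). norm v * norm v * \<epsilon>)"
    proof (intro order_trans[OF sum_abs] sum_mono)
      fix i j :: 'e assume ij: "i \<in> Basis" "j \<in> Basis"
      have "\<bar>coord_metric c y i j - coord_metric c y0 i j\<bar> \<le> \<epsilon>" using \<rho>(2)[OF y] ij by (simp add: less_imp_le)
      then show "\<bar>(v \<bullet> i) * (v \<bullet> j) * (coord_metric c y i j - coord_metric c y0 i j)\<bar> \<le> norm v * norm v * \<epsilon>"
        unfolding abs_mult using Basis_le_norm[OF ij(1), of v] Basis_le_norm[OF ij(2), of v]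
        by (intro mult_mono mult_nonneg_nonneg) simp_all
    qed
    also have "\<dots> = \<kappa>\<^sup>2 * (norm v)\<^sup>2 / 2"
      using n0 by (simp add: \<epsilon>_def power2_eq_square)
    also have "\<dots> \<le> g p v v / 2" using \<kappa>2[of v] by simp
    finally show ?thesis .
  qed
  have "rnorm g p v \<le> 2 * sqrt (coord_metric c y v v) \<and> sqrt (coord_metric c y v v) \<le> 2 * rnorm g p v"
    if y: "dist y y0 < \<rho>" for y v
  proof -
    \<comment> \<open>A relative error of one half is within the factor 4, which the square root
      turns into 2.\<close>
    have "g p v v \<le> 4 * coord_metric c y v v" "coord_metric c y v v \<le> 4 * g p v v"
      using est[OF y, of v] g_nonneg[of p v] by linarith+
    from this[THEN real_sqrt_le_mono] show ?thesis by (simp add: rnorm_def real_sqrt_mult)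
  qed
  moreover have "y \<in> cball y0 (\<rho> / 2) \<Longrightarrow> dist y y0 < \<rho>" for y using \<rho>(1) by (simp add: dist_commute)
  ultimately have "comparison_ball p (\<rho> / 2) \<kappa>"
    unfolding comparison_ball_def c_def[symmetric] y0_def[symmetric] using \<rho> \<kappa>
    by (intro conjI subsetI allI ballI) auto
  then show ?thesis by blast
qed

text \<open>Pairing \<open>F\<close> with its own increment \<open>w\<close> under
  \<open>g p\<close> reduces the estimate to a scalar fundamental theorem of calculus;
  Cauchy-Schwarz follows, and then division by the length of \<open>w\<close>.\<close>

lemma rnorm_diff_le_integral:
  assumes ab: "a \<le> b" and F: "continuous_on {a..b} F" and S: "finite S"
    and D: "\<And>t. t \<in> {a<..<b} - S \<Longrightarrow> \<exists>D. (F has_vector_derivative D) (at t) \<and> rnorm g p D \<le> 2 * s t"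
    and s: "s integrable_on {a..b}" "\<And>t. 0 \<le> s t"
  shows "rnorm g p (F b - F a) \<le> 2 * integral {a..b} s"
proof -
  interpret bounded_bilinear "g p" by (rule g_bounded_bilinear)
  define w where "w = F b - F a"
  obtain D' where D': "\<And>t. t \<in> {a<..<b} - S \<Longrightarrow> (F has_vector_derivative D' t) (at t) \<and> rnorm g p (D' t) \<le> 2 * s t"
    using D by metis
  define h' where "h' t = (if t \<in> {a<..<b} - S then g p w (D' t) else 0)" for t
  have "(h' has_integral (g p w (F b) - g p w (F a))) {a..b}"
  proof (rule fundamental_theorem_of_calculus_interior_strong[OF S ab])
    fix t assume t: "t \<in> {a<..<b} - S"
    have "((\<lambda>t. g p w (F t)) has_vector_derivative g p w (D' t)) (at t)"
      using bounded_linear.has_vector_derivative[OF bounded_linear_right D'[OF t, THEN conjunct1], of w] .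
    then show "((\<lambda>t. g p w (F t)) has_vector_derivative h' t) (at t)" using t by (simp add: h'_def)
  next
    show "continuous_on {a..b} (\<lambda>t. g p w (F t))" by (intro continuous_on continuous_on_const F)
  qed
  moreover have "((\<lambda>t. (2 * rnorm g p w) * s t) has_integral (2 * rnorm g p w) * integral {a..b} s) {a..b}"
    using integrable_integral[OF s(1)] by (rule has_integral_mult_right)
  ultimately have "g p w (F b) - g p w (F a) \<le> (2 * rnorm g p w) * integral {a..b} s"
  proof (rule has_integral_le)
    fix t
    show "h' t \<le> 2 * rnorm g p w * s t"
    proof (cases "t \<in> {a<..<b} - S")
      case True
      have "g p w (D' t) \<le> rnorm g p w * rnorm g p (D' t)" by (rule g_Cauchy_Schwarz)
      also have "\<dots> \<le> rnorm g p w * (2 * s t)" using D'[OF True] rnorm_nonneg by (intro mult_left_mono) auto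
      finally show ?thesis unfolding h'_def if_P[OF True] by (simp add: mult_ac)
    next
      case False
      show ?thesis unfolding h'_def if_not_P[OF False] using s(2)[of t] rnorm_nonneg[of p w] by simp
    qed
  qed
  moreover have "g p w (F b) - g p w (F a) = (rnorm g p w)\<^sup>2"
    by (simp add: rnorm_power2 w_def diff_right)
  ultimately have *: "rnorm g p w * rnorm g p w \<le> rnorm g p w * (2 * integral {a..b} s)"
    by (simp add: power2_eq_square mult_ac)
  show ?thesis
  proof (cases "rnorm g p w = 0")
    case True
    then show ?thesis using integral_nonneg[OF s] by (simp add: w_def)
  next
    case False
    then have "0 < rnorm g p w" using rnorm_nonneg[of p w] by simp
    then show ?thesis using * by (simp add: w_def)
  qed
qed

text \<open>Until its first exit from the chart ball, the path is at least half as long as measured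
  by the constant scalar product \<open>g p\<close>.\<close>

lemma joining_length_lower:
  assumes cb: "comparison_ball p \<rho> \<kappa>" and l: "l \<in> joining_lengths p q"
  shows "(q \<in> chart_ball p \<rho> \<and> rnorm g p (chart_diff p q) \<le> 2 * l) \<or> \<kappa> * \<rho> \<le> 2 * l"
proof -
  obtain \<gamma> where \<gamma>: "l = arc_length 0 1 \<gamma>" "piecewise_C1_on 0 1 \<gamma>" "\<gamma> 0 = p" "\<gamma> 1 = q"
    using l by (auto simp: joining_lengths_def)
  define c where "c = chart_at A p"
  define y0 where "y0 = snd c p"
  have c: "c \<in> A" "p \<in> fst c" by (auto simp: c_def chart_at_in chart_at_mem)
  have cb': "0 < \<rho>" "0 < \<kappa>" "cball y0 \<rho> \<subseteq> snd c ` fst c" "\<And>v. \<kappa> * norm v \<le> rnorm g p v"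
    "\<And>y v. y \<in> cball y0 \<rho> \<Longrightarrow> rnorm g p v \<le> 2 * sqrt (coord_metric c y v v)"
    using cb unfolding comparison_ball_def c_def[symmetric] y0_def[symmetric] by auto
  define K where "K = {x \<in> fst c. snd c x \<in> cball y0 \<rho>}"
  have cont: "continuous_on {0..1} \<gamma>" using \<gamma>(2) by (simp add: piecewise_C1_on_def)
  have "K = chart_inv c ` cball y0 \<rho>"
  proof
    show "K \<subseteq> chart_inv c ` cball y0 \<rho>" using chart_inv(3)[OF c(1)] by (force simp: K_def)
    show "chart_inv c ` cball y0 \<rho> \<subseteq> K"
    proof
      fix x assume "x \<in> chart_inv c ` cball y0 \<rho>"
      then obtain y where y: "x = chart_inv c y" "y \<in> cball y0 \<rho>" by blast
      then have "y \<in> snd c ` fst c" using cb'(3) by blast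
      then show "x \<in> K" using chart_inv(4,5)[OF c(1)] y by (simp add: K_def)
    qed
  qed
  then have "compact K"
    using compact_continuous_image[OF continuous_on_subset[OF chart_inv(2)[OF c(1)] cb'(3)] compact_cball] by simp
  \<comment> \<open>Closedness in the manifold keeps the exit point in \<open>K\<close>, although it
    is outside the open ball.\<close>
  then have Kcl: "closed K" by (rule compact_imp_closed)
  have main: "rnorm g p (snd c (\<gamma> \<tau>) - y0) \<le> 2 * l" if \<tau>: "\<tau> \<in> {0..1}" and K: "\<And>t. t \<in> {0..\<tau>} \<Longrightarrow> \<gamma> t \<in> K" for \<tau>
  proof -
    have pw: "piecewise_C1_on 0 \<tau> \<gamma>" using piecewise_C1_on_subinterval[OF \<gamma>(2), of 0 \<tau>] \<tau> by simp
    obtain S where S: "finite S"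
      "\<And>t. t \<in> {0<..<\<tau>} \<Longrightarrow> t \<notin> S \<Longrightarrow> \<exists>a b. 0 \<le> a \<and> a < t \<and> t < b \<and> b \<le> \<tau> \<and> C1_curve_on A {a..b} \<gamma>"
      using piecewise_C1_on_nice[OF pw] by blast
    have "rnorm g p (snd c (\<gamma> \<tau>) - snd c (\<gamma> 0)) \<le> 2 * integral {0..\<tau>} (speed \<gamma>)"
    proof (rule rnorm_diff_le_integral[OF _ _ S(1)])
      show "continuous_on {0..\<tau>} (\<lambda>t. snd c (\<gamma> t))"
        by (rule continuous_on_compose2[OF chart_inv(1)[OF c(1)] continuous_on_subset[OF cont]])
          (use K \<tau> in \<open>auto simp: K_def\<close>)
      fix t assume t: "t \<in> {0<..<\<tau>} - S"
      then obtain a b where ab: "0 \<le> a" "a < t" "t < b" "b \<le> \<tau>" "C1_curve_on A {a..b} \<gamma>" using S(2)[of t] by auto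
      have gt: "\<gamma> t \<in> fst c" "snd c (\<gamma> t) \<in> cball y0 \<rho>" using K[of t] t by (auto simp: K_def)
      have tab: "t \<in> {a..b}" using ab by simp
      obtain D where D: "((snd c \<circ> \<gamma>) has_vector_derivative D) (at t within {a..b})"
        using C1_curve_onD[OF ab(5) c(1)] gt(1) tab by metis
      have "speed \<gamma> t = sqrt (coord_metric c (snd c (\<gamma> t)) D D)"
        using speed_via_chart[OF c(1) gt(1) tab C1_curve_on_continuous[OF ab(5)] _ D] at_within_Icc_neq_bot[of a b t]
          speed_interior[of t a b \<gamma>] ab by simp
      moreover have "((\<lambda>t. snd c (\<gamma> t)) has_vector_derivative D) (at t)"
        using D ab by (simp add: at_within_Icc_at o_def)
      ultimately show "\<exists>D. ((\<lambda>t. snd c (\<gamma> t)) has_vector_derivative D) (at t) \<and> rnorm g p D \<le> 2 * speed \<gamma> t"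
        using cb'(5)[OF gt(2), of D] by auto
    qed (use \<tau> speed_nonneg speed_integrable[OF pw] in auto)
    also have "integral {0..\<tau>} (speed \<gamma>) \<le> l"
      using arc_length_combine[OF \<gamma>(2), of \<tau>] arc_length_nonneg[of \<tau> 1 \<gamma>]
        piecewise_C1_on_subinterval[OF \<gamma>(2), of \<tau> 1] \<tau> \<gamma>(1) by (simp add: arc_length_def)
    finally show ?thesis by (simp add: \<gamma>(3) y0_def)
  qed
  have ball_K: "chart_ball p \<rho> \<subseteq> K" by (auto simp: chart_ball_def K_def c_def y0_def)
  show ?thesis
  proof (cases "\<forall>t\<in>{0..1}. \<gamma> t \<in> chart_ball p \<rho>")
    case True
    then have "rnorm g p (snd c (\<gamma> 1) - y0) \<le> 2 * l" using ball_K by (intro main) auto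
    then show ?thesis using True \<gamma>(4) by (auto simp: chart_diff_def c_def y0_def)
  next
    case False
    \<comment> \<open>Its minimum is the first exit time \<open>\<tau>\<close>. The limit from the
      left lies in \<open>K\<close>, so there the coordinates are defined and at distance at least
      \<open>\<rho>\<close> from the centre.\<close>
    define S where "S = {0..1} \<inter> \<gamma> -` (- chart_ball p \<rho>)"
    have "closed S" unfolding S_def
      by (rule continuous_closed_preimage[OF cont]) (use open_chart_ball in auto)
    moreover have "bounded S" unfolding S_def by (rule bounded_subset[of "{0..1}"]) auto
    moreover have "S \<noteq> {}" using False by (auto simp: S_def)
    ultimately obtain \<tau> where \<tau>: "\<tau> \<in> S" "\<And>t. t \<in> S \<Longrightarrow> \<tau> \<le> t"
      using compact_attains_inf[of S] compact_eq_bounded_closed by blast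
    have \<tau>01: "\<tau> \<in> {0..1}" "\<gamma> \<tau> \<notin> chart_ball p \<rho>" using \<tau>(1) by (auto simp: S_def)
    have before: "\<gamma> t \<in> K" if "t \<in> {0..<\<tau>}" for t
    proof (rule subsetD[OF ball_K], rule ccontr)
      assume "\<gamma> t \<notin> chart_ball p \<rho>"
      then have "t \<in> S" using that \<tau>01(1) by (auto simp: S_def)
      then show False using \<tau>(2)[of t] that by simp
    qed
    have \<tau>0: "0 < \<tau>" using \<tau>01 chart_ball_centre[OF cb'(1), of p] \<gamma>(3) by (cases "\<tau> = 0") auto
    have "(\<gamma> \<longlongrightarrow> \<gamma> \<tau>) (at \<tau> within {0..1})" using cont \<tau>01(1) by (auto simp: continuous_on_def)
    then have "(\<gamma> \<longlongrightarrow> \<gamma> \<tau>) (at \<tau> within {0..<\<tau>})" by (rule tendsto_within_subset) (use \<tau>01 in auto)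
    moreover have "\<forall>\<^sub>F t in at \<tau> within {0..<\<tau>}. \<gamma> t \<in> K" using before by (simp add: eventually_at_filter)
    moreover have "at \<tau> within {0..<\<tau>} \<noteq> bot" using \<tau>0 by (simp add: trivial_limit_within)
    ultimately have K\<tau>: "\<gamma> \<tau> \<in> K" using Lim_in_closed_set[OF Kcl] by blast
    have K: "\<gamma> t \<in> K" if "t \<in> {0..\<tau>}" for t using before[of t] K\<tau> that by (cases "t = \<tau>") auto
    have "\<rho> \<le> norm (snd c (\<gamma> \<tau>) - y0)"
      using K\<tau> \<tau>01(2) by (auto simp: K_def chart_ball_def c_def y0_def dist_norm norm_minus_commute)
    then have "\<kappa> * \<rho> \<le> \<kappa> * norm (snd c (\<gamma> \<tau>) - y0)" using cb'(2) by simp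
    also have "\<dots> \<le> rnorm g p (snd c (\<gamma> \<tau>) - y0)" by (rule cb'(4))
    also have "\<dots> \<le> 2 * l" by (rule main[OF \<tau>01(1) K])
    finally show ?thesis ..
  qed
qed

text \<open>The straight segment in coordinates is an admissible path: it stays in the ball, where
  the speed is at most twice the constant length of its direction.\<close>

lemma joining_length_upper:
  assumes cb: "comparison_ball p \<rho> \<kappa>" and q: "q \<in> chart_ball p \<rho>"
  shows "\<exists>l \<in> joining_lengths p q. l \<le> 2 * rnorm g p (chart_diff p q)"
proof -
  define c where "c = chart_at A p"
  define y0 where "y0 = snd c p"
  have c: "c \<in> A" "p \<in> fst c" by (auto simp: c_def chart_at_in chart_at_mem)
  have cb': "0 < \<rho>" "0 < \<kappa>" "cball y0 \<rho> \<subseteq> snd c ` fst c"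
    "\<And>y v. y \<in> cball y0 \<rho> \<Longrightarrow> sqrt (coord_metric c y v v) \<le> 2 * rnorm g p v"
    using cb unfolding comparison_ball_def c_def[symmetric] y0_def[symmetric] by auto
  define w where "w = chart_diff p q"
  have w: "snd c q = y0 + w" by (simp add: w_def chart_diff_def c_def y0_def)
  have qc: "q \<in> fst c" "norm w \<le> \<rho>"
    using q w by (auto simp: chart_ball_def c_def[symmetric] y0_def[symmetric] dist_norm)
  define \<gamma> where "\<gamma> t = chart_inv c (y0 + t *\<^sub>R w)" for t :: real
  have inball: "y0 + t *\<^sub>R w \<in> cball y0 \<rho>" if "t \<in> {0..1}" for t
  proof -
    have "t * norm w \<le> norm w" using that by (intro mult_left_le_one_le) auto
    then show ?thesis using that qc(2) by (auto simp: dist_norm)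
  qed
  then have im: "y0 + t *\<^sub>R w \<in> snd c ` fst c" if "t \<in> {0..1}" for t using cb'(3) that by blast
  have cont: "continuous_on {0..1} \<gamma>"
    unfolding \<gamma>_def by (rule continuous_on_compose2[OF chart_inv(2)[OF c(1)]]) (use im in \<open>auto intro!: continuous_intros\<close>)
  have \<gamma>c: "\<gamma> t \<in> fst c" "snd c (\<gamma> t) = y0 + t *\<^sub>R w" if "t \<in> {0..1}" for t
    using chart_inv(4,5)[OF c(1) im[OF that]] by (auto simp: \<gamma>_def)
  have D: "((snd c \<circ> \<gamma>) has_vector_derivative w) (at t within {0..1})" if t: "t \<in> {0..1}" for t
  proof (rule has_vector_derivative_transform[OF t])
    show "((\<lambda>t. y0 + t *\<^sub>R w) has_vector_derivative w) (at t within {0..1})"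
      by (auto intro!: derivative_eq_intros)
  qed (simp add: \<gamma>c)
  have C1: "C1_curve_on A {0..1} \<gamma>"
    by (rule C1_curve_on_single_chart[OF c(1) _ cont _ D]) (use \<gamma>c in auto)
  have sp: "speed \<gamma> t \<le> 2 * rnorm g p w" if t: "t \<in> {0..1} - {0, 1}" for t
  proof -
    have t': "t \<in> {0..1}" "t \<in> {0<..<1}" using t by auto
    have "speed \<gamma> t = sqrt (coord_metric c (snd c (\<gamma> t)) w w)"
      using speed_via_chart[OF c(1) \<gamma>c(1)[OF t'(1)] t'(1) cont _ D[OF t'(1)]] at_within_Icc_neq_bot[of 0 1 t]
        speed_interior[OF t'(2)] t'(1) by simp
    then show ?thesis using cb'(4)[OF inball[OF t'(1)], of w] \<gamma>c(2)[OF t'(1)] by simp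
  qed
  define s where "s t = (if t \<in> {0..1} - {0, 1} then speed \<gamma> t else 0)" for t
  have int: "speed \<gamma> integrable_on {0..1}" by (rule speed_integrable[OF C1_imp_piecewise_C1[OF C1]]) simp
  have "arc_length 0 1 \<gamma> = integral {0..1} s"
    unfolding arc_length_def by (rule integral_spike[of "{0, 1}"]) (auto simp: s_def)
  also have "\<dots> \<le> integral {0..1} (\<lambda>_::real. 2 * rnorm g p w)"
  proof (rule integral_le)
    show "s integrable_on {0..1}" by (rule integrable_spike_finite[of "{0, 1}", OF _ _ int]) (auto simp: s_def)
  qed (use sp rnorm_nonneg[of p w] in \<open>auto simp: s_def\<close>)
  finally have "arc_length 0 1 \<gamma> \<le> 2 * rnorm g p w" by simp
  moreover have "\<gamma> 0 = p" "\<gamma> 1 = q"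
    using chart_inv(3)[OF c(1)] c(2) qc(1) w[symmetric] by (auto simp: \<gamma>_def y0_def)
  then have "arc_length 0 1 \<gamma> \<in> joining_lengths p q"
    using arc_length_in_joining_lengths[OF C1_imp_piecewise_C1[OF C1]] by simp
  ultimately show ?thesis by (auto simp: w_def)
qed

end

section \<open>The Riemannian distance is a metric that induces the topology\<close>

locale compact_riemannian = riemannian +
  assumes compact_M: "compact (UNIV :: 'a set)" and connected_M: "connected (UNIV :: 'a set)"
begin

abbreviation dist_M :: "'a \<Rightarrow> 'a \<Rightarrow> real" where "dist_M \<equiv> riem_dist A g"

text \<open>Being joined by a piecewise smooth path is an equivalence relation whose classes are
  open, so connectedness leaves one class. This is what makes the infimum in the distance
  meaningful.\<close>

lemma joining_lengths_nonempty: "joining_lengths x y \<noteq> {}"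
proof (rule connected_equivalence_relation[OF connected_M, of x y "\<lambda>x y. joining_lengths x y \<noteq> {}"])
  fix x :: 'a
  obtain \<rho> \<kappa> where cb: "comparison_ball x \<rho> \<kappa>" using ex_comparison_ball by blast
  then have "0 < \<rho>" by (simp add: comparison_ball_def)
  moreover have "joining_lengths x y \<noteq> {}" if "y \<in> chart_ball x \<rho>" for y
    using joining_length_upper[OF cb that] by blast
  ultimately show "\<exists>T. openin (top_of_set UNIV) T \<and> x \<in> T \<and> (\<forall>y\<in>T. joining_lengths x y \<noteq> {})"
    using open_chart_ball[of x \<rho>] chart_ball_centre[of \<rho> x]
    by (intro exI[of _ "chart_ball x \<rho>"]) (auto simp: open_openin[symmetric])
next
  fix x y assume "joining_lengths x y \<noteq> {}"
  then show "joining_lengths y x \<noteq> {}" using joining_lengths_sym by blast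
next
  fix x y z assume "joining_lengths x y \<noteq> {}" "joining_lengths y z \<noteq> {}"
  then show "joining_lengths x z \<noteq> {}" using joining_lengths_add by blast
qed auto

lemma dist_M_nonneg: "0 \<le> dist_M x y"
  unfolding riem_dist_eq by (rule cInf_greatest[OF joining_lengths_nonempty]) (rule joining_lengths_nonneg)

lemma dist_M_less:
  assumes "dist_M x y < e" shows "\<exists>l\<in>joining_lengths x y. l < e"
  using cInf_lessD[OF joining_lengths_nonempty] assms unfolding riem_dist_eq by blast

lemma dist_M_refl: "dist_M x x = 0"
  using riem_dist_le[OF joining_lengths_refl] dist_M_nonneg by (metis antisym)

lemma dist_M_sym: "dist_M x y = dist_M y x"
proof -
  have "joining_lengths x y = joining_lengths y x" using joining_lengths_sym by blast
  then show ?thesis by (simp add: riem_dist_eq)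
qed

lemma dist_M_triangle: "dist_M x z \<le> dist_M x y + dist_M y z"
proof (rule field_le_epsilon)
  fix e :: real assume e: "0 < e"
  obtain l where l: "l \<in> joining_lengths x y" "l < dist_M x y + e / 2"
    using dist_M_less[of x y "dist_M x y + e / 2"] e by auto
  obtain k where k: "k \<in> joining_lengths y z" "k < dist_M y z + e / 2"
    using dist_M_less[of y z "dist_M y z + e / 2"] e by auto
  show "dist_M x z \<le> dist_M x y + dist_M y z + e"
    using riem_dist_le[OF joining_lengths_add[OF l(1) k(1)]] l(2) k(2) by linarith
qed

lemma dist_M_lower:
  assumes cb: "comparison_ball p \<rho> \<kappa>"
  shows "(q \<in> chart_ball p \<rho> \<and> rnorm g p (chart_diff p q) \<le> 2 * dist_M p q) \<or> \<kappa> * \<rho> \<le> 2 * dist_M p q"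
proof (rule ccontr)
  assume neg: "\<not> ?thesis"
  show False
  proof (cases "q \<in> chart_ball p \<rho>")
    case True
    then have "dist_M p q < min (rnorm g p (chart_diff p q)) (\<kappa> * \<rho>) / 2" using neg by auto
    then obtain l where "l \<in> joining_lengths p q" "l < min (rnorm g p (chart_diff p q)) (\<kappa> * \<rho>) / 2"
      using dist_M_less by blast
    then show False using joining_length_lower[OF cb, of l q] by auto
  next
    case False
    then have "dist_M p q < \<kappa> * \<rho> / 2" using neg by auto
    then obtain l where "l \<in> joining_lengths p q" "l < \<kappa> * \<rho> / 2"
      using dist_M_less by blast
    then show False using joining_length_lower[OF cb, of l q] False by auto
  qed
qed

lemma dist_M_upper:
  assumes "comparison_ball p \<rho> \<kappa>" "q \<in> chart_ball p \<rho>"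
  shows "dist_M p q \<le> 2 * rnorm g p (chart_diff p q)"
  using joining_length_upper[OF assms] riem_dist_le by (meson order_trans)

lemma continuous_on_rnorm_chart_diff:
  "continuous_on (fst (chart_at A p)) (\<lambda>q. rnorm g p (chart_diff p q))"
proof -
  interpret bounded_bilinear "g p" by (rule g_bounded_bilinear)
  show ?thesis
    unfolding rnorm_def chart_diff_def
    by (intro continuous_on_real_sqrt continuous_on continuous_on_diff continuous_on_const chart_inv(1) chart_at_in)
qed

lemma rnorm_chart_diff_nbhd:
  assumes "0 < e" shows "\<exists>U. open U \<and> p \<in> U \<and> U \<subseteq> fst (chart_at A p) \<and> (\<forall>q\<in>U. rnorm g p (chart_diff p q) < e)"
proof -
  let ?U = "fst (chart_at A p) \<inter> (\<lambda>q. rnorm g p (chart_diff p q)) -` {..<e}"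
  have "open ?U"
    by (rule continuous_open_preimage[OF continuous_on_rnorm_chart_diff chart_homeomorphism(1)[OF chart_at_in]]) auto
  moreover have "rnorm g p (chart_diff p p) = 0"
    using rnorm_scaleR[of p 0 0] by (simp add: chart_diff_def)
  ultimately show ?thesis using assms chart_at_mem by (intro exI[of _ ?U]) auto
qed

text \<open>The neighbourhood is so small that the second alternative of \<open>dist_M_lower\<close>
  yields the same bound: the coordinate difference is then below
  \<open>\<kappa> * \<rho>\<close>.\<close>

lemma dist_M_local_comparison:
  "\<exists>U. open U \<and> p \<in> U \<and> U \<subseteq> fst (chart_at A p) \<and>
     (\<forall>q\<in>U. rnorm g p (chart_diff p q) \<le> 2 * dist_M p q \<and> dist_M p q \<le> 2 * rnorm g p (chart_diff p q))"
proof -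
  obtain \<rho> \<kappa> where cb: "comparison_ball p \<rho> \<kappa>" using ex_comparison_ball by blast
  then have pos: "0 < \<rho>" "0 < \<kappa> * \<rho>" by (auto simp: comparison_ball_def)
  obtain U where U: "open U" "p \<in> U" "U \<subseteq> fst (chart_at A p)" "\<And>q. q \<in> U \<Longrightarrow> rnorm g p (chart_diff p q) < \<kappa> * \<rho>"
    using rnorm_chart_diff_nbhd[OF pos(2), of p] by blast
  have "rnorm g p (chart_diff p q) \<le> 2 * dist_M p q \<and> dist_M p q \<le> 2 * rnorm g p (chart_diff p q)"
    if "q \<in> U" "q \<in> chart_ball p \<rho>" for q
    using dist_M_lower[OF cb, of q] dist_M_upper[OF cb that(2)] U(4)[OF that(1)] by auto
  then show ?thesis
    using U open_chart_ball[of p \<rho>] chart_ball_centre[OF pos(1)] by (intro exI[of _ "U \<inter> chart_ball p \<rho>"]) auto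
qed

lemma dist_M_ball_nbhd:
  assumes "0 < e" shows "\<exists>U. open U \<and> x \<in> U \<and> (\<forall>y\<in>U. dist_M x y < e)"
proof -
  obtain U where U: "open U" "x \<in> U" "\<And>q. q \<in> U \<Longrightarrow> dist_M x q \<le> 2 * rnorm g x (chart_diff x q)"
    using dist_M_local_comparison[of x] by blast
  obtain V where V: "open V" "x \<in> V" "\<And>q. q \<in> V \<Longrightarrow> rnorm g x (chart_diff x q) < e / 2"
    using rnorm_chart_diff_nbhd[of "e / 2" x] assms by auto
  have "dist_M x y < e" if "y \<in> U \<inter> V" for y using U(3)[of y] V(3)[of y] that by auto
  then show ?thesis using U V by (intro exI[of _ "U \<inter> V"]) auto
qed

lemma dist_M_small_ball_subset:
  assumes "open W" "x \<in> W" shows "\<exists>e>0. \<forall>y. dist_M x y < e \<longrightarrow> y \<in> W"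
proof -
  obtain \<rho> \<kappa> where cb: "comparison_ball x \<rho> \<kappa>" using ex_comparison_ball by blast
  then have pos: "0 < \<rho>" "0 < \<kappa>" and \<kappa>: "\<And>v. \<kappa> * norm v \<le> rnorm g x v" by (auto simp: comparison_ball_def)
  define c where "c = chart_at A x"
  have c: "c \<in> A" "x \<in> fst c" by (auto simp: c_def chart_at_in chart_at_mem)
  have "open (snd c ` (fst c \<inter> W))" "snd c x \<in> snd c ` (fst c \<inter> W)"
    using open_chart_image[OF c(1) assms(1)] c(2) assms(2) by auto
  then obtain r where r: "r > 0" "ball (snd c x) r \<subseteq> snd c ` (fst c \<inter> W)"
    using openE by blast
  \<comment> \<open>The minimum serves two purposes: \<open>\<kappa> * \<rho>\<close> forbids
    leaving the chart ball, and \<open>\<kappa> * r\<close> confines the coordinates to the ball of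
    radius \<open>r\<close>.\<close>
  have "y \<in> W" if y: "dist_M x y < \<kappa> * min \<rho> r / 2" for y
  proof -
    have "\<kappa> * min \<rho> r \<le> \<kappa> * \<rho>" "\<kappa> * min \<rho> r \<le> \<kappa> * r" using pos by auto
    then have yb: "y \<in> chart_ball x \<rho>" "rnorm g x (chart_diff x y) < \<kappa> * r"
      using dist_M_lower[OF cb, of y] y by linarith+
    then have "\<kappa> * norm (chart_diff x y) < \<kappa> * r" using \<kappa>[of "chart_diff x y"] by linarith
    then have "snd c y \<in> ball (snd c x) r"
      using pos by (simp add: chart_diff_def c_def dist_norm norm_minus_commute)
    then obtain z where z: "z \<in> fst c" "z \<in> W" "snd c y = snd c z" using r(2) by blast
    moreover have "y \<in> fst c" using yb(1) by (simp add: chart_ball_def c_def)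
    ultimately have "y = z" using chart_inv(3)[OF c(1)] by metis
    then show ?thesis using z by simp
  qed
  moreover have "0 < \<kappa> * min \<rho> r / 2" using pos r(1) by simp
  ultimately show ?thesis by blast
qed

text \<open>A nearly shortest path is traversed proportionally to its arc length \<open>S\<close>.
  As \<open>S\<close> may be constant on intervals, \<open>T\<close> is merely a selected right
  inverse and possibly discontinuous; the composite is Lipschitz all the same, because distances
  along the path are bounded by differences of \<open>S\<close>.\<close>

lemma dist_M_almost_geodesic:
  assumes e: "0 < e"
  shows "\<exists>b :: real \<Rightarrow> 'a. b 0 = x \<and> b 1 = y \<and>
        (\<forall>s\<in>{0..1}. \<forall>t\<in>{0..1}. dist_M (b s) (b t) \<le> (dist_M x y + e) * \<bar>s - t\<bar>)"
proof -
  obtain l where "l \<in> joining_lengths x y" and le: "l < dist_M x y + e"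
    using dist_M_less[of x y "dist_M x y + e"] e by auto
  then obtain \<gamma> where \<gamma>: "l = arc_length 0 1 \<gamma>" "piecewise_C1_on 0 1 \<gamma>" "\<gamma> 0 = x" "\<gamma> 1 = y"
    by (auto simp: joining_lengths_def)
  define S where "S t = arc_length 0 t \<gamma>" for t
  have S: "continuous_on {0..1} S"
    unfolding S_def arc_length_def
    by (rule indefinite_integral_continuous_1[OF speed_integrable[OF \<gamma>(2)]]) simp
  have S01: "S 0 = 0" "S 1 = l" by (simp_all add: S_def arc_length_def \<gamma>(1))
  have l0: "0 \<le> l" using arc_length_nonneg[OF \<gamma>(2)] \<gamma>(1) by simp
  \<comment> \<open>The extra clauses force exact end points, which the equation for
    \<open>S\<close> alone would not.\<close>
  have "\<exists>t\<in>{0..1}. S t = \<tau> * l \<and> (\<tau> = 0 \<longrightarrow> t = 0) \<and> (\<tau> = 1 \<longrightarrow> t = 1)" if \<tau>: "\<tau> \<in> {0..1}" for \<tau>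
  proof (cases "\<tau> = 0 \<or> \<tau> = 1")
    case True
    then show ?thesis using S01 by (intro bexI[of _ \<tau>]) auto
  next
    case False
    have "\<exists>t\<ge>0. t \<le> 1 \<and> S t = \<tau> * l"
      by (rule IVT') (use S S01 l0 \<tau> in \<open>auto intro: mult_left_le_one_le\<close>)
    then show ?thesis using False by auto
  qed
  then obtain T where T: "\<And>\<tau>. \<tau> \<in> {0..1} \<Longrightarrow> T \<tau> \<in> {0..1} \<and> S (T \<tau>) = \<tau> * l \<and> (\<tau> = 0 \<longrightarrow> T \<tau> = 0) \<and> (\<tau> = 1 \<longrightarrow> T \<tau> = 1)"
    by metis
  have SS: "dist_M (\<gamma> s) (\<gamma> t) \<le> \<bar>S s - S t\<bar>" if "s \<in> {0..1}" "t \<in> {0..1}" "s \<le> t" for s t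
  proof -
    have "S t = S s + arc_length s t \<gamma>"
      using arc_length_combine[of 0 t \<gamma> s] piecewise_C1_on_subinterval[OF \<gamma>(2), of 0 t] that by (simp add: S_def)
    moreover have "dist_M (\<gamma> s) (\<gamma> t) \<le> arc_length s t \<gamma>"
      using that by (intro riem_dist_le_arc_length piecewise_C1_on_subinterval[OF \<gamma>(2)]) auto
    ultimately show ?thesis by simp
  qed
  have "dist_M (\<gamma> (T s)) (\<gamma> (T t)) \<le> (dist_M x y + e) * \<bar>s - t\<bar>" if st: "s \<in> {0..1}" "t \<in> {0..1}" for s t
  proof -
    have "dist_M (\<gamma> (T s)) (\<gamma> (T t)) \<le> \<bar>S (T s) - S (T t)\<bar>"
    proof (cases "T s \<le> T t")
      case True
      then show ?thesis using SS T[OF st(1)] T[OF st(2)] by blast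
    next
      case False
      then have "dist_M (\<gamma> (T t)) (\<gamma> (T s)) \<le> \<bar>S (T t) - S (T s)\<bar>"
        using SS[of "T t" "T s"] T[OF st(1)] T[OF st(2)] by linarith
      then show ?thesis using dist_M_sym[of "\<gamma> (T s)" "\<gamma> (T t)"] abs_minus_commute[of "S (T s)" "S (T t)"] by linarith
    qed
    also have "\<dots> = l * \<bar>s - t\<bar>"
      using T[OF st(1)] T[OF st(2)] l0 by (simp add: abs_mult flip: left_diff_distrib)
    also have "\<dots> \<le> (dist_M x y + e) * \<bar>s - t\<bar>" using le by (intro mult_right_mono) auto
    finally show ?thesis .
  qed
  then show ?thesis using T[of 0] T[of 1] \<gamma>(3,4) by (intro exI[of _ "\<lambda>\<tau>. \<gamma> (T \<tau>)"]) auto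
qed

sublocale compact_length_space "riem_dist A g"
  by unfold_locales (fact compact_M dist_M_nonneg dist_M_refl dist_M_sym dist_M_triangle
      dist_M_small_ball_subset dist_M_ball_nbhd dist_M_almost_geodesic)+

text \<open>The potential at \<open>q\<close> is the straight coordinate path from \<open>x\<close>
  to \<open>q\<close>. By convexity of the coordinate ball, the path to \<open>\<gamma> 0\<close>
  followed by \<open>\<gamma>\<close> is homotopic to the path to \<open>\<gamma> 1\<close>.\<close>

lemma small_paths_homologous:
  fixes x :: 'a
  shows "\<exists>U \<kappa>. open U \<and> x \<in> U \<and> (\<forall>\<gamma>. path \<gamma> \<and> path_image \<gamma> \<subseteq> U \<longrightarrow>
     real_1boundary (path_chain \<gamma> - (\<kappa> (\<gamma> 1) - \<kappa> (\<gamma> 0))))"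
proof -
  obtain \<rho> \<kappa> where cb: "comparison_ball x \<rho> \<kappa>" using ex_comparison_ball by blast
  define c where "c = chart_at A x"
  have c: "c \<in> A" "x \<in> fst c" by (auto simp: c_def chart_at_in chart_at_mem)
  let ?y = "snd c x"
  have \<rho>: "0 < \<rho>" "ball ?y \<rho> \<subseteq> snd c ` fst c"
    using cb ball_subset_cball[of ?y \<rho>] unfolding comparison_ball_def c_def by auto
  define \<sigma> where "\<sigma> q = chart_inv c \<circ> linepath ?y (snd c q)" for q
  have cinv: "continuous_on (ball ?y \<rho>) (chart_inv c)"
    using chart_inv(2)[OF c(1)] \<rho>(2) by (rule continuous_on_subset)
  have "real_1boundary (path_chain \<gamma> - (path_chain (\<sigma> (\<gamma> 1)) - path_chain (\<sigma> (\<gamma> 0))))"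
    if \<gamma>: "path \<gamma>" "path_image \<gamma> \<subseteq> chart_ball x \<rho>" for \<gamma>
  proof -
    have in_ball: "\<gamma> t \<in> fst c" "snd c (\<gamma> t) \<in> ball ?y \<rho>" if "t \<in> {0..1}" for t
      using \<gamma>(2) that by (auto simp: path_image_def chart_ball_def c_def image_subset_iff)
    have y: "?y \<in> ball ?y \<rho>" using \<rho>(1) by simp
    have pc: "path (snd c \<circ> \<gamma>)"
      using \<gamma>(1) in_ball unfolding path_def
      by (intro continuous_on_compose continuous_on_subset[OF chart_inv(1)[OF c(1)]]) auto
    have seg: "path_image (linepath ?y (snd c (\<gamma> t))) \<subseteq> ball ?y \<rho>" if "t \<in> {0..1}" for t
      using closed_segment_subset[OF y in_ball(2)[OF that] convex_ball] by simp
    let ?p = "linepath ?y (snd c (\<gamma> 0)) +++ (snd c \<circ> \<gamma>)"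
    have im: "path_image ?p \<subseteq> ball ?y \<rho>"
      using seg[of 0] in_ball by (intro subset_path_image_join) (auto simp: path_image_def)
    have pp: "path ?p" using pc by (intro path_join_imp) (auto simp: pathstart_def)
    have "homotopic_paths (ball ?y \<rho>) ?p (linepath ?y (snd c (\<gamma> 1)))"
    proof (rule homotopic_paths_linear)
      fix t :: real assume t: "t \<in> {0..1}"
      have "?p t \<in> ball ?y \<rho>" "linepath ?y (snd c (\<gamma> 1)) t \<in> ball ?y \<rho>"
        using im seg[of 1] t unfolding path_image_def by (blast, force)
      then show "closed_segment (?p t) (linepath ?y (snd c (\<gamma> 1)) t) \<subseteq> ball ?y \<rho>"
        by (intro closed_segment_subset convex_ball)
    qed (use pp in \<open>auto simp: pathfinish_def[of "_ \<circ> _"]\<close>)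
    from homotopic_paths_continuous_image[OF this cinv, of UNIV]
    have 1: "real_1boundary (path_chain (chart_inv c \<circ> ?p) - path_chain (\<sigma> (\<gamma> 1)))"
      unfolding \<sigma>_def by (rule real_1boundary_homotopic_paths[rotated]) simp
    have 2: "path_chain (chart_inv c \<circ> ?p) = path_chain (\<sigma> (\<gamma> 0) +++ \<gamma>)"
      unfolding path_compose_join \<sigma>_def
      by (rule path_chain_cong) (use in_ball(1) chart_inv(3)[OF c(1)] in \<open>auto simp: joinpaths_def\<close>)
    have 3: "real_1boundary (path_chain (\<sigma> (\<gamma> 0)) + path_chain \<gamma> - path_chain (\<sigma> (\<gamma> 0) +++ \<gamma>))"
    proof (rule real_1boundary_join[OF _ \<gamma>(1)])
      show "path (\<sigma> (\<gamma> 0))"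
        unfolding \<sigma>_def by (rule path_continuous_image[OF path_linepath continuous_on_subset[OF cinv seg]]) simp
      show "pathfinish (\<sigma> (\<gamma> 0)) = pathstart \<gamma>"
        using chart_inv(3)[OF c(1) in_ball(1)[of 0]] by (simp add: \<sigma>_def pathfinish_def pathstart_def linepath_def)
    qed
    show ?thesis using real_1boundary_add[OF 3 1[unfolded 2]] by (simp add: algebra_simps)
  qed
  then show ?thesis
    using open_chart_ball[of x \<rho>] chart_ball_centre[OF \<rho>(1)]
    by (intro exI[of _ "chart_ball x \<rho>"] exI[of _ "\<lambda>q. path_chain (\<sigma> q)"]) auto
qed

end

section \<open>Curves under the dynamics and arc length on leaves\<close>

context riemannian
begin

lemma rnorm_triangle: "rnorm g x (v + w) \<le> rnorm g x v + rnorm g x w"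
proof (rule power2_le_imp_le)
  interpret bounded_bilinear "g x" by (rule g_bounded_bilinear)
  have "(rnorm g x (v + w))\<^sup>2 = g x v v + g x w w + 2 * g x v w"
    using g_sym[of x w v] by (simp add: rnorm_power2 add_left add_right)
  also have "\<dots> \<le> g x v v + g x w w + 2 * (rnorm g x v * rnorm g x w)"
    using g_Cauchy_Schwarz[of x v w] by simp
  also have "\<dots> = (rnorm g x v + rnorm g x w)\<^sup>2"
    by (simp add: power2_sum rnorm_power2)
  finally show "(rnorm g x (v + w))\<^sup>2 \<le> (rnorm g x v + rnorm g x w)\<^sup>2" .
qed (simp add: rnorm_nonneg)

end

context compact_riemannian
begin

lemma C1_curve_Lipschitz:
  assumes \<gamma>: "C1_curve_on A {0..1} \<gamma>"
  obtains K where "0 \<le> K" "\<And>s t. s \<in> {0..1} \<Longrightarrow> t \<in> {0..1} \<Longrightarrow> dist_M (\<gamma> s) (\<gamma> t) \<le> K * \<bar>s - t\<bar>"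
proof -
  let ?v = "\<lambda>t. rnorm g (\<gamma> t) (velocity A {0..1} \<gamma> t)"
  have "continuous_on {0..1} ?v"
    by (rule continuous_on_speed[OF \<gamma>]) (rule at_within_Icc_neq_bot, auto)
  then have "\<exists>t0\<in>{0..1}. \<forall>t\<in>{0..1}. ?v t \<le> ?v t0"
    by (intro continuous_attains_sup) auto
  then obtain t0 where t0: "\<And>t. t \<in> {0..1} \<Longrightarrow> ?v t \<le> ?v t0" by blast
  define K where "K = ?v t0"
  have K: "0 \<le> K" by (simp add: K_def rnorm_nonneg)
  have le: "dist_M (\<gamma> s) (\<gamma> t) \<le> K * (t - s)" if st: "0 \<le> s" "s \<le> t" "t \<le> 1" for s t
  proof -
    have pw: "piecewise_C1_on s t \<gamma>"
      using piecewise_C1_on_subinterval[OF C1_imp_piecewise_C1[OF \<gamma>]] st by simp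
    \<comment> \<open>At the ends of the curve the two-sided \<open>speed\<close> is not controlled
      by the one-sided velocity; \<open>w\<close> is 0 there.\<close>
    define w where "w u = (if u \<in> {s<..<t} then speed \<gamma> u else 0)" for u
    have "arc_length s t \<gamma> = integral {s..t} w"
      unfolding arc_length_def by (rule integral_spike[of "{s, t}"]) (auto simp: w_def)
    also have "\<dots> \<le> integral {s..t} (\<lambda>_. K)"
    proof (rule integral_le)
      show "w integrable_on {s..t}"
        by (rule integrable_spike_finite[of "{s, t}", OF _ _ speed_integrable[OF pw st(2)]]) (auto simp: w_def)
      show "w u \<le> K" if "u \<in> {s..t}" for u
        using speed_interior[of u 0 1 \<gamma>] t0[of u] that st K by (auto simp: w_def K_def)
    qed auto
    also have "\<dots> = K * (t - s)" using st by simp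
    finally show ?thesis using riem_dist_le_arc_length[OF pw st(2)] by linarith
  qed
  have "dist_M (\<gamma> s) (\<gamma> t) \<le> K * \<bar>s - t\<bar>" if "s \<in> {0..1}" "t \<in> {0..1}" for s t
  proof (cases "s \<le> t")
    case True
    then show ?thesis using le[of s t] that by simp
  next
    case False
    then show ?thesis using le[of t s] that dist_M_sym[of "\<gamma> s" "\<gamma> t"] by simp
  qed
  with K show ?thesis by (rule that)
qed

text \<open>Of the factor 4, one half is lost to the error of linear approximation and one half to
  comparing distance with coordinates.\<close>

lemma C1_curve_dist_lower:
  assumes \<gamma>: "C1_curve_on A {0..1} \<gamma>" and x: "x \<in> {0..1}" and a: "0 < a"
    and v: "a \<le> rnorm g (\<gamma> x) (velocity A {0..1} \<gamma> x)"
  shows "\<exists>\<delta>>0. \<forall>t\<in>{0..1}. \<bar>t - x\<bar> < \<delta> \<longrightarrow> a / 4 * \<bar>t - x\<bar> \<le> dist_M (\<gamma> x) (\<gamma> t)"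
proof -
  define p where "p = \<gamma> x"
  define v where "v = velocity A {0..1} \<gamma> x"
  define F where "F = snd (chart_at A p) \<circ> \<gamma>"
  define e where "e t = (1 / norm (t - x)) *\<^sub>R (F t - (F x + (t - x) *\<^sub>R v))" for t
  interpret g: bounded_bilinear "g p" by (rule g_bounded_bilinear)
  obtain U where U: "open U" "p \<in> U" "\<And>q. q \<in> U \<Longrightarrow> rnorm g p (chart_diff p q) \<le> 2 * dist_M p q"
    using dist_M_local_comparison[of p] by blast
  have "(F has_vector_derivative v) (at x within {0..1})"
    unfolding F_def v_def p_def using velocity_works[OF \<gamma> x at_within_Icc_neq_bot] x by auto
  then have e0: "(e \<longlongrightarrow> 0) (at x within {0..1})"
    unfolding has_vector_derivative_def has_derivative_within e_def by blast
  have "((\<lambda>t. rnorm g p (e t)) \<longlongrightarrow> sqrt (g p 0 0)) (at x within {0..1})"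
    unfolding rnorm_def by (intro tendsto_real_sqrt g.tendsto e0)
  then have "((\<lambda>t. rnorm g p (e t)) \<longlongrightarrow> 0) (at x within {0..1})" by (simp add: g.zero_left)
  then have "\<forall>\<^sub>F t in at x within {0..1}. rnorm g p (e t) < a / 2"
    using a by (intro order_tendstoD(2)) auto
  moreover have "(\<gamma> \<longlongrightarrow> p) (at x within {0..1})"
    using C1_curve_on_continuous[OF \<gamma>] x unfolding p_def continuous_on_def by blast
  then have "\<forall>\<^sub>F t in at x within {0..1}. \<gamma> t \<in> U"
    using U(1,2) by (rule topological_tendstoD)
  ultimately have "\<forall>\<^sub>F t in at x within {0..1}. rnorm g p (e t) < a / 2 \<and> \<gamma> t \<in> U"
    by (rule eventually_conj)
  then obtain \<delta> where \<delta>: "\<delta> > 0"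
    "\<And>t. t \<in> {0..1} \<Longrightarrow> t \<noteq> x \<Longrightarrow> dist t x < \<delta> \<Longrightarrow> rnorm g p (e t) < a / 2 \<and> \<gamma> t \<in> U"
    unfolding eventually_at by blast
  have "a / 4 * \<bar>t - x\<bar> \<le> dist_M p (\<gamma> t)" if t: "t \<in> {0..1}" "\<bar>t - x\<bar> < \<delta>" for t
  proof (cases "t = x")
    case True
    then show ?thesis by (simp add: dist_M_nonneg)
  next
    case False
    then have d: "rnorm g p (e t) < a / 2" "\<gamma> t \<in> U" using \<delta>(2)[of t] t by (auto simp: dist_real_def)
    have "(t - x) *\<^sub>R v = (F t - F x) + (- \<bar>t - x\<bar>) *\<^sub>R e t"
      using False by (simp add: e_def)
    then have "\<bar>t - x\<bar> * rnorm g p v \<le> rnorm g p (F t - F x) + \<bar>t - x\<bar> * rnorm g p (e t)"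
      using rnorm_triangle[of p "F t - F x" "(- \<bar>t - x\<bar>) *\<^sub>R e t"] rnorm_scaleR[of p "t - x" v]
        rnorm_scaleR[of p "- \<bar>t - x\<bar>" "e t"] by simp
    moreover have "\<bar>t - x\<bar> * a \<le> \<bar>t - x\<bar> * rnorm g p v"
      using assms(4) by (intro mult_left_mono) (auto simp: v_def p_def)
    moreover have "\<bar>t - x\<bar> * rnorm g p (e t) \<le> \<bar>t - x\<bar> * (a / 2)"
      using d(1) by (intro mult_left_mono) auto
    moreover have "rnorm g p (F t - F x) \<le> 2 * dist_M p (\<gamma> t)"
      using U(3)[OF d(2)] by (simp add: chart_diff_def F_def p_def)
    moreover have "\<bar>t - x\<bar> * (a / 2) = \<bar>t - x\<bar> * a / 2" "a / 4 * \<bar>t - x\<bar> = \<bar>t - x\<bar> * a / 4" by auto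
    ultimately show ?thesis by linarith
  qed
  then show ?thesis using \<delta>(1) by (auto simp: p_def)
qed

text \<open>The local bounds are added up by bisection, concatenating polygons. This bounds the
  polygonal length from below without identifying it with the integral of the speed; a constant
  factor does not matter for growth.\<close>

lemma polygon_sum_lower:
  assumes \<gamma>: "C1_curve_on A {0..1} \<gamma>" and a: "0 < a"
    and v: "\<And>t. t \<in> {0..1} \<Longrightarrow> a \<le> rnorm g (\<gamma> t) (velocity A {0..1} \<gamma> t)"
  shows "\<exists>x\<in>polygon_sums dist_M 0 1 \<gamma>. a / 4 \<le> x"
proof -
  have "0 \<le> (0::real) \<longrightarrow> 1 \<le> (1::real) \<longrightarrow> (\<exists>x\<in>polygon_sums dist_M 0 1 \<gamma>. a / 4 * (1 - 0) \<le> x)"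
  proof (rule Bolzano[where P = "\<lambda>s t. 0 \<le> s \<longrightarrow> t \<le> 1 \<longrightarrow> (\<exists>x\<in>polygon_sums dist_M s t \<gamma>. a / 4 * (t - s) \<le> x)"])
    fix s t u :: real
    assume 1: "0 \<le> s \<longrightarrow> t \<le> 1 \<longrightarrow> (\<exists>x\<in>polygon_sums dist_M s t \<gamma>. a / 4 * (t - s) \<le> x)"
      and 2: "0 \<le> t \<longrightarrow> u \<le> 1 \<longrightarrow> (\<exists>x\<in>polygon_sums dist_M t u \<gamma>. a / 4 * (u - t) \<le> x)"
      and st: "s \<le> t" "t \<le> u"
    show "0 \<le> s \<longrightarrow> u \<le> 1 \<longrightarrow> (\<exists>x\<in>polygon_sums dist_M s u \<gamma>. a / 4 * (u - s) \<le> x)"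
    proof (intro impI)
      assume "0 \<le> s" "u \<le> 1"
      then obtain x y where x: "x \<in> polygon_sums dist_M s t \<gamma>" "a / 4 * (t - s) \<le> x"
        and y: "y \<in> polygon_sums dist_M t u \<gamma>" "a / 4 * (u - t) \<le> y"
        using 1 2 st by (meson order_trans)
      obtain z where z: "z \<in> polygon_sums dist_M s u \<gamma>" "x + y \<le> z"
        using polygon_sums_concat[OF dist_M_nonneg x(1) y(1) st] by blast
      have "a / 4 * (u - s) = a / 4 * (t - s) + a / 4 * (u - t)" by (simp only: distrib_left[symmetric]) simp
      then show "\<exists>x\<in>polygon_sums dist_M s u \<gamma>. a / 4 * (u - s) \<le> x"
        using x(2) y(2) z by (intro bexI[OF _ z(1)]) linarith
    qed
  next
    fix x :: real assume x: "0 \<le> x" "x \<le> 1"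
    then have x01: "x \<in> {0..1}" by simp
    obtain \<delta> where \<delta>: "\<delta> > 0" "\<And>t. t \<in> {0..1} \<Longrightarrow> \<bar>t - x\<bar> < \<delta> \<Longrightarrow> a / 4 * \<bar>t - x\<bar> \<le> dist_M (\<gamma> x) (\<gamma> t)"
      using C1_curve_dist_lower[OF \<gamma> x01 a v[OF x01]] by blast
    have "\<exists>y\<in>polygon_sums dist_M s t \<gamma>. a / 4 * (t - s) \<le> y" if st: "s \<le> x" "x \<le> t" "t - s < \<delta>" "0 \<le> s" "t \<le> 1" for s t
    proof -
      have "a / 4 * (x - s) \<le> dist_M (\<gamma> s) (\<gamma> x)"
        using \<delta>(2)[of s] st dist_M_sym[of "\<gamma> s" "\<gamma> x"] by simp
      moreover have "a / 4 * (t - x) \<le> dist_M (\<gamma> x) (\<gamma> t)" using \<delta>(2)[of t] st by simp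
      moreover obtain z where z: "z \<in> polygon_sums dist_M s t \<gamma>" "dist_M (\<gamma> s) (\<gamma> x) + dist_M (\<gamma> x) (\<gamma> t) \<le> z"
        using polygon_sums_concat[OF dist_M_nonneg polygon_sums_2[of s s x x dist_M \<gamma>] polygon_sums_2[of x x t t dist_M \<gamma>]]
          st by auto
      moreover have "a / 4 * (t - s) = a / 4 * (x - s) + a / 4 * (t - x)" by (simp only: distrib_left[symmetric]) simp
      ultimately show ?thesis by (intro bexI[OF _ z(1)]) linarith
    qed
    then show "\<exists>\<delta>>0. \<forall>s t. s \<le> x \<and> x \<le> t \<and> t - s < \<delta> \<longrightarrow> 0 \<le> s \<longrightarrow> t \<le> 1 \<longrightarrow>
        (\<exists>x\<in>polygon_sums dist_M s t \<gamma>. a / 4 * (t - s) \<le> x)"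
      using \<delta>(1) by blast
  qed simp
  then show ?thesis by simp
qed

end

section \<open>Differentiable maps, their action on curves, and the ends of leaves\<close>

context atlas
begin

text \<open>Pointwise differentiability is what passes to iterates and determines the velocity of an
  image curve. Continuity of derivatives is treated separately, one application of \<open>f\<close>
  at a time.\<close>

definition differentiable_map_at :: "('m \<Rightarrow> 'm) \<Rightarrow> 'm \<Rightarrow> bool" where
  "differentiable_map_at f x \<longleftrightarrow> (\<forall>c\<in>A. \<forall>c'\<in>A. x \<in> fst c \<longrightarrow> f x \<in> fst c' \<longrightarrow>
     (snd c' \<circ> f \<circ> chart_inv c) differentiable (at (snd c x)))"

lemma C1_mapD:
  assumes "C1_map A f"
  shows "continuous_on UNIV f"
    "c \<in> A \<Longrightarrow> c' \<in> A \<Longrightarrow> Ck_on 1 (snd c ` (fst c \<inter> f -` fst c')) (snd c' \<circ> f \<circ> chart_inv c)"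
  using assms unfolding C1_map_def chart_inv_def by (blast, cases c, cases c', fastforce)

lemma open_chart_image_vimage:
  assumes "continuous_on UNIV f" "c \<in> A" "open V" shows "open (snd c ` (fst c \<inter> f -` V))"
  using open_vimage[OF assms(3,1)] by (rule open_chart_image[OF assms(2)])

lemma C1_map_differentiable:
  assumes "C1_map A f" shows "differentiable_map_at f x"
  unfolding differentiable_map_at_def
proof (intro ballI impI)
  fix c c' assume c: "c \<in> A" "c' \<in> A" "x \<in> fst c" "f x \<in> fst c'"
  show "(snd c' \<circ> f \<circ> chart_inv c) differentiable (at (snd c x))"
    by (rule Ck_on_1_differentiable[OF C1_mapD(2)[OF assms c(1,2)]
          open_chart_image_vimage[OF C1_mapD(1)[OF assms] c(1) chart_homeomorphism(1)[OF c(2)]]])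
      (use c in auto)
qed

lemma differentiable_map_at_compose:
  assumes h: "differentiable_map_at h x" "continuous_on UNIV h" and f: "differentiable_map_at f (h x)"
  shows "differentiable_map_at (f \<circ> h) x"
  unfolding differentiable_map_at_def
proof (intro ballI impI)
  fix c c' assume c: "c \<in> A" "c' \<in> A" "x \<in> fst c" "(f \<circ> h) x \<in> fst c'"
  define b where "b = chart_at A (h x)"
  have b: "b \<in> A" "h x \<in> fst b" by (auto simp: b_def chart_at_in chart_at_mem)
  have "(snd b \<circ> h \<circ> chart_inv c) differentiable (at (snd c x))"
    using h(1) c b by (auto simp: differentiable_map_at_def)
  moreover have "(snd c' \<circ> f \<circ> chart_inv b) differentiable (at ((snd b \<circ> h \<circ> chart_inv c) (snd c x)))"
    using f c b chart_inv(3)[OF c(1,3)] by (auto simp: differentiable_map_at_def)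
  ultimately have "((snd c' \<circ> f \<circ> chart_inv b) \<circ> (snd b \<circ> h \<circ> chart_inv c)) differentiable (at (snd c x))"
    by (rule differentiable_chain_at)
  then obtain D where "(((snd c' \<circ> f \<circ> chart_inv b) \<circ> (snd b \<circ> h \<circ> chart_inv c)) has_derivative D) (at (snd c x))"
    by (auto simp: differentiable_def)
  then have "((snd c' \<circ> (f \<circ> h) \<circ> chart_inv c) has_derivative D) (at (snd c x))"
  proof (rule has_derivative_transform_within_open[OF _ open_chart_image_vimage[OF h(2) c(1) chart_homeomorphism(1)[OF b(1)]]])
    show "snd c x \<in> snd c ` (fst c \<inter> h -` fst b)" using c b by auto
    fix y assume "y \<in> snd c ` (fst c \<inter> h -` fst b)"
    then show "((snd c' \<circ> f \<circ> chart_inv b) \<circ> (snd b \<circ> h \<circ> chart_inv c)) y = (snd c' \<circ> (f \<circ> h) \<circ> chart_inv c) y"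
      using chart_inv(3)[OF c(1)] chart_inv(3)[OF b(1)] by auto
  qed
  then show "(snd c' \<circ> (f \<circ> h) \<circ> chart_inv c) differentiable (at (snd c x))" by (auto simp: differentiable_def)
qed

lemma continuous_on_funpow: "continuous_on UNIV f \<Longrightarrow> continuous_on UNIV (f ^^ n)"
  for f :: "'x::topological_space \<Rightarrow> 'x"
proof (induction n)
  case (Suc n)
  then have "continuous_on UNIV (f \<circ> f ^^ n)"
    by (intro continuous_on_compose) (auto intro: continuous_on_subset)
  then show ?case by simp
qed (simp add: id_def)

lemma differentiable_map_at_funpow:
  assumes f: "C1_map A f" shows "differentiable_map_at (f ^^ n) x"
proof (induction n)
  case 0
  have "differentiable_map_at id x"
    unfolding differentiable_map_at_def comp_id by (auto intro: transition_differentiable)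
  then show ?case by (simp add: id_def)
next
  case (Suc n)
  have "differentiable_map_at (f \<circ> f ^^ n) x"
    by (rule differentiable_map_at_compose[OF Suc continuous_on_funpow[OF C1_mapD(1)[OF f]] C1_map_differentiable[OF f]])
  then show ?case by (simp add: o_def)
qed

lemma velocity_map:
  assumes h: "differentiable_map_at h (\<gamma> t)" and \<gamma>: "C1_curve_on A I \<gamma>" and t: "t \<in> I" "at t within I \<noteq> bot"
  shows "velocity A I (h \<circ> \<gamma>) t = tangent_map A h (\<gamma> t) (velocity A I \<gamma> t)"
proof (rule velocity_eq[OF _ t(2)])
  let ?c = "chart_at A (\<gamma> t)" and ?c' = "chart_at A (h (\<gamma> t))"
  have "(snd ?c' \<circ> h \<circ> chart_inv ?c) differentiable (at (snd ?c (\<gamma> t)))"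
    using h chart_at_in chart_at_mem by (auto simp: differentiable_map_at_def)
  from has_vector_derivative_via_chart[OF chart_at_in chart_at_mem t(1) C1_curve_on_continuous[OF \<gamma>]
      velocity_works[OF \<gamma> t] this]
  show "((snd (chart_at A ((h \<circ> \<gamma>) t)) \<circ> (h \<circ> \<gamma>)) has_vector_derivative
      tangent_map A h (\<gamma> t) (velocity A I \<gamma> t)) (at t within I)"
    by (simp add: tangent_map_def chart_inv_def o_def)
qed

text \<open>Taking \<open>vector_derivative\<close> itself as the candidate avoids gluing local
  choices; its continuity is a local matter, settled by the chain rule in a chart at the
  source.\<close>

lemma C1_curve_on_map:
  assumes f: "C1_map A f" and \<gamma>: "C1_curve_on A I \<gamma>" and I: "\<And>t. t \<in> I \<Longrightarrow> at t within I \<noteq> bot"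
  shows "C1_curve_on A I (f \<circ> \<gamma>)"
proof (rule C1_curve_onI)
  note \<gamma>c = C1_curve_on_continuous[OF \<gamma>] and fc = C1_mapD(1)[OF f]
  show fg: "continuous_on I (f \<circ> \<gamma>)"
    by (intro continuous_on_compose \<gamma>c continuous_on_subset[OF fc]) auto
  fix c' assume c': "c' \<in> A"
  let ?J = "I \<inter> (f \<circ> \<gamma>) -` fst c'"
  let ?D = "\<lambda>t. vector_derivative (snd c' \<circ> (f \<circ> \<gamma>)) (at t within I)"
  have *: "((snd c' \<circ> (f \<circ> \<gamma>)) has_vector_derivative
       frechet_derivative (snd c' \<circ> f \<circ> chart_inv c) (at (snd c (\<gamma> t))) D) (at t within I)"
    if "c \<in> A" "\<gamma> t \<in> fst c" "t \<in> ?J" "((snd c \<circ> \<gamma>) has_vector_derivative D) (at t within I)" for c t D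
    using has_vector_derivative_via_chart[OF that(1,2) _ \<gamma>c that(4), of "snd c' \<circ> f"]
      C1_map_differentiable[OF f, of "\<gamma> t"] that c' by (auto simp: differentiable_map_at_def o_assoc)
  have "continuous_on ?J ?D"
  proof (rule continuous_on_locally)
    show "continuous_on ?J \<gamma>" using \<gamma>c by (rule continuous_on_subset) auto
    fix t0 assume t0: "t0 \<in> ?J"
    define c where "c = chart_at A (\<gamma> t0)"
    have c: "c \<in> A" "\<gamma> t0 \<in> fst c" by (auto simp: c_def chart_at_in chart_at_mem)
    obtain D where D: "continuous_on (I \<inter> \<gamma> -` fst c) D"
      "\<And>t. t \<in> I \<Longrightarrow> \<gamma> t \<in> fst c \<Longrightarrow> ((snd c \<circ> \<gamma>) has_vector_derivative D t) (at t within I)"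
      using C1_curve_onD[OF \<gamma> c(1)] by blast
    have "continuous_on (?J \<inter> \<gamma> -` fst c)
       (\<lambda>t. frechet_derivative (snd c' \<circ> f \<circ> chart_inv c) (at (snd c (\<gamma> t))) (D t))"
    proof (rule continuous_on_frechet_derivative_apply[OF C1_mapD(2)[OF f c(1) c']])
      show "open (snd c ` (fst c \<inter> f -` fst c'))"
        by (rule open_chart_image_vimage[OF fc c(1) chart_homeomorphism(1)[OF c']])
      show "continuous_on (?J \<inter> \<gamma> -` fst c) (\<lambda>t. snd c (\<gamma> t))"
        by (rule continuous_on_compose2[OF chart_inv(1)[OF c(1)] continuous_on_subset[OF \<gamma>c]]) auto
      show "continuous_on (?J \<inter> \<gamma> -` fst c) D" using D(1) by (rule continuous_on_subset) auto
    qed auto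
    then have "continuous_on (?J \<inter> \<gamma> -` fst c) ?D"
    proof (rule continuous_on_eq)
      fix t assume t: "t \<in> ?J \<inter> \<gamma> -` fst c"
      then show "frechet_derivative (snd c' \<circ> f \<circ> chart_inv c) (at (snd c (\<gamma> t))) (D t) = ?D t"
        using vector_derivative_within[OF I *[OF c(1) _ _ D(2)]] by auto
    qed
    then show "\<exists>U. open U \<and> \<gamma> t0 \<in> U \<and> continuous_on (?J \<inter> \<gamma> -` U) ?D"
      using c chart_homeomorphism(1)[OF c(1)] by blast
  qed
  moreover have "((snd c' \<circ> (f \<circ> \<gamma>)) has_vector_derivative ?D t) (at t within I)" if t: "t \<in> ?J" for t
  proof -
    have "\<exists>D. ((snd c' \<circ> (f \<circ> \<gamma>)) has_vector_derivative D) (at t within I)"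
      using *[OF chart_at_in chart_at_mem t velocity_works[OF \<gamma>]] t I by blast
    then show ?thesis using vector_derivative_works differentiableI_vector by blast
  qed
  ultimately show "\<exists>D. continuous_on ?J D \<and> (\<forall>t\<in>?J. ((snd c' \<circ> (f \<circ> \<gamma>)) has_vector_derivative D t) (at t within I))"
    by blast
qed

lemma C1_curve_on_funpow:
  assumes f: "C1_map A f" and \<gamma>: "C1_curve_on A I \<gamma>" and I: "\<And>t. t \<in> I \<Longrightarrow> at t within I \<noteq> bot"
  shows "C1_curve_on A I ((f ^^ n) \<circ> \<gamma>)"
proof (induction n)
  case (Suc n)
  have "C1_curve_on A I (f \<circ> ((f ^^ n) \<circ> \<gamma>))" by (rule C1_curve_on_map[OF f Suc I])
  then show ?case by (simp add: o_def)
qed (simp add: \<gamma> id_def[symmetric])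

text \<open>For an injective parametrization the limit would lie on the plaque that contains the
  tail, hence be \<open>c t0\<close> for some \<open>t0\<close>; but the coordinate along the plaque
  is strictly monotone and moves away from its value at \<open>t0\<close>. A periodic
  parametrization that converges is constant.\<close>

lemma leaf_param_not_convergent:
  assumes W: "foliation_1d A W" and c: "leaf_param A (W x) c"
  shows "\<not> (c \<longlongrightarrow> p) at_top"
proof
  assume lim: "(c \<longlongrightarrow> p) at_top"
  have cont: "continuous_on UNIV c" using c by (simp add: leaf_param_def C1_curve_on_def)
  from c consider "inj c" | T where "T > 0" "\<forall>s t. c s = c t \<longleftrightarrow> (\<exists>k::int. t = s + of_int k * T)"
    unfolding leaf_param_def by blast
  then show False
  proof cases
    case 1
    obtain U \<psi> \<psi>' e where U: "open U" "p \<in> U" "e \<in> (Basis :: 'e set)"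
        and hom: "homeomorphism U (box (- One) One :: 'e set) \<psi> \<psi>'"
        and plaque: "\<And>J. J \<in> components (c -` U) \<Longrightarrow>
           \<exists>z \<in> box (- One) One. c ` J = {q \<in> U. \<forall>i \<in> Basis - {e}. \<psi> q \<bullet> i = z \<bullet> i}"
      using W c unfolding foliation_1d_def by meson
    have \<psi>: "continuous_on U \<psi>" "inj_on \<psi> U"
      using hom by (auto simp: homeomorphism_def intro: inj_on_inverseI)
    \<comment> \<open>From \<open>T0\<close> on the leaf stays in the box, so its tail belongs to
      one component and thus to one plaque.\<close>
    obtain T0 where T0: "\<And>t. t \<ge> T0 \<Longrightarrow> c t \<in> U"
      using topological_tendstoD[OF lim U(1,2)] by (auto simp: eventually_at_top_linorder)
    define J where "J = connected_component_set (c -` U) T0"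
    have J: "J \<in> components (c -` U)" unfolding J_def using T0[of T0] by (intro componentsI) auto
    then obtain z where z: "c ` J = {q \<in> U. \<forall>i \<in> Basis - {e}. \<psi> q \<bullet> i = z \<bullet> i}" using plaque by blast
    have JT0: "{T0..} \<subseteq> J" unfolding J_def by (rule connected_component_maximal) (use T0 in auto)
    have \<psi>lim: "((\<lambda>t. \<psi> (c t)) \<longlongrightarrow> \<psi> p) at_top"
      by (rule continuous_on_tendsto_compose[OF \<psi>(1) lim U(2)])
        (use T0 in \<open>auto simp: eventually_at_top_linorder\<close>)
    have "\<psi> p \<bullet> i = z \<bullet> i" if i: "i \<in> Basis - {e}" for i
    proof (rule tendsto_unique)
      show "((\<lambda>t. \<psi> (c t) \<bullet> i) \<longlongrightarrow> \<psi> p \<bullet> i) at_top" by (intro tendsto_intros \<psi>lim)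
      have "\<psi> (c t) \<bullet> i = z \<bullet> i" if "t \<ge> T0" for t using z JT0 i that by blast
      then show "((\<lambda>t. \<psi> (c t) \<bullet> i) \<longlongrightarrow> z \<bullet> i) at_top"
        by (intro tendsto_eventually) (auto simp: eventually_at_top_linorder)
    qed simp
    \<comment> \<open>A plaque is given by equations that pass to the limit, so the limit point
      belongs to the same plaque.\<close>
    then have "p \<in> c ` J" using z U(2) by blast
    then obtain t0 where t0: "t0 \<in> J" "p = c t0" by blast
    have "is_interval J" unfolding J_def by (simp add: is_interval_connected_1)
    then have Jt: "t \<in> J" if "t \<ge> t0" for t
    proof -
      have "max t T0 \<in> J" using JT0 by (auto simp: subset_iff)
      then show ?thesis using mem_is_interval_1_I[OF \<open>is_interval J\<close> t0(1), of "max t T0" t] that by simp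
    qed
    define k where "k t = \<psi> (c t) \<bullet> e" for t
    have JU: "c t \<in> U" if "t \<in> J" for t using z that by blast
    have kinj: "s = t" if "s \<in> J" "t \<in> J" "k s = k t" for s t
    proof -
      have "\<psi> (c s) = \<psi> (c t)"
      proof (rule euclidean_eqI)
        fix i :: 'e assume i: "i \<in> Basis"
        show "\<psi> (c s) \<bullet> i = \<psi> (c t) \<bullet> i"
        proof (cases "i = e")
          case True
          then show ?thesis using that(3) by (simp add: k_def)
        next
          case False
          then have "i \<in> Basis - {e}" using i by simp
          then have "\<psi> (c s) \<bullet> i = z \<bullet> i" "\<psi> (c t) \<bullet> i = z \<bullet> i" using z that(1,2) by blast+
          then show ?thesis by simp
        qed
      qed
      then have "c s = c t" using \<psi>(2) JU that(1,2) by (auto dest: inj_onD)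
      then show ?thesis using 1 by (auto dest: injD)
    qed
    have kcont: "continuous_on {t0..t} k" for t
      unfolding k_def by (intro continuous_intros continuous_on_compose2[OF \<psi>(1)] continuous_on_subset[OF cont])
        (use Jt JU in auto)
    \<comment> \<open>The gap reached one unit after \<open>t0\<close>; monotonicity keeps the later
      values even farther away.\<close>
    define \<epsilon> where "\<epsilon> = \<bar>k (t0 + 1) - k t0\<bar>"
    have "k (t0 + 1) \<noteq> k t0" using kinj[of "t0 + 1" t0] Jt[of "t0 + 1"] t0(1) by auto
    then have \<epsilon>: "\<epsilon> > 0" by (simp add: \<epsilon>_def)
    have far: "\<epsilon> < \<bar>k t - k t0\<bar>" if t: "t > t0 + 1" for t
    proof -
      have "inj_on k {t0..t}" using kinj Jt by (auto intro!: inj_onI)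
      from continuous_inj_imp_mono[OF _ t kcont this]
      show ?thesis by (auto simp: \<epsilon>_def)
    qed
    have "(k \<longlongrightarrow> k t0) at_top"
      using tendsto_inner[OF \<psi>lim tendsto_const, of e] by (simp add: k_def[abs_def] t0(2))
    from tendstoD[OF this \<epsilon>] obtain T1 where "\<And>t. t \<ge> T1 \<Longrightarrow> \<bar>k t - k t0\<bar> < \<epsilon>"
      by (auto simp: eventually_at_top_linorder dist_real_def)
    moreover have "t0 + 1 < max T1 (t0 + 2)" by (simp add: less_max_iff_disj)
    ultimately show False using far[of "max T1 (t0 + 2)"] by (metis less_asym max.cobounded1)
  next
    case (2 T)
    have per: "c (s + real n * T) = c s" for s n
      using 2(2)[rule_format, of s "s + real n * T"] by (metis of_int_of_nat_eq)
    \<comment> \<open>Along the times \<open>s + n T\<close> the curve is constantly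
      \<open>c s\<close>. Comparing 0 with half a period then contradicts the minimality built into
      \<open>T\<close>.\<close>
    have "p = c s" for s
    proof -
      have "filterlim (\<lambda>n. s + real n * T) at_top sequentially"
        by (rule filterlim_tendsto_add_at_top[OF tendsto_const])
          (rule filterlim_at_top_mult_tendsto_pos[OF tendsto_const 2(1) filterlim_real_sequentially])
      from filterlim_compose[OF lim this] have "(\<lambda>n::nat. c s) \<longlonglongrightarrow> p" by (simp add: per)
      then show ?thesis using LIMSEQ_unique tendsto_const by blast
    qed
    then have "c 0 = c (T / 2)" by metis
    then obtain k :: int where "T / 2 = of_int k * T" using 2(2)[rule_format, of 0 "T / 2"] by auto
    then have "real_of_int k = 1 / 2" using 2(1) by (simp add: field_simps)
    then have "2 * real_of_int k = 1" by simp
    then have "real_of_int (2 * k) = real_of_int 1" by simp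
    then have "2 * k = 1" using of_int_eq_iff by blast
    then show False by presburger
  qed
qed

text \<open>It transfers statements about the forward end of a leaf to the backward end.\<close>

lemma leaf_param_reverse:
  assumes c: "leaf_param A L c" shows "leaf_param A L (\<lambda>t. c (- t))"
proof -
  have C1: "C1_curve_on A UNIV c" using c by (simp add: leaf_param_def)
  have d: "(uminus has_vector_derivative (-1)) (at t)" for t :: real
    unfolding has_real_derivative_iff_has_vector_derivative[symmetric] by (auto intro!: derivative_eq_intros)
  have eq: "(\<lambda>t. c (- t)) = c \<circ> uminus" by (simp add: o_def)
  have 1: "C1_curve_on A UNIV (c \<circ> uminus)"
    by (rule C1_curve_on_reparam[OF C1, where h' = "\<lambda>_. -1"]) (use d in auto)
  have 2: "velocity A UNIV (c \<circ> uminus) t = (-1) *\<^sub>R velocity A UNIV c (- t)" for t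
    by (rule velocity_reparam[OF C1 _ d]) auto
  have 3: "range (c \<circ> uminus) = range c"
    by (metis image_comp surj_uminus)
  have 4: "inj (c \<circ> uminus) \<or> (\<exists>T>0. \<forall>s t. (c \<circ> uminus) s = (c \<circ> uminus) t \<longleftrightarrow> (\<exists>k::int. t = s + of_int k * T))"
  proof (cases "inj c")
    case True
    then show ?thesis by (intro disjI1 inj_compose) auto
  next
    case False
    then obtain T where T: "T > 0" "\<And>s t. c s = c t \<longleftrightarrow> (\<exists>k::int. t = s + of_int k * T)"
      using c unfolding leaf_param_def by blast
    have "(\<exists>k::int. - t = - s + of_int k * T) \<longleftrightarrow> (\<exists>k::int. t = s + of_int k * T)" for s t :: real
    proof
      assume "\<exists>k::int. - t = - s + of_int k * T"
      then obtain k :: int where "- t = - s + of_int k * T" by blast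
      then show "\<exists>k::int. t = s + of_int k * T" by (intro exI[of _ "- k"]) simp
    next
      assume "\<exists>k::int. t = s + of_int k * T"
      then obtain k :: int where "t = s + of_int k * T" by blast
      then show "\<exists>k::int. - t = - s + of_int k * T" by (intro exI[of _ "- k"]) simp
    qed
    then show ?thesis using T by (intro disjI2 exI[of _ T]) simp
  qed
  show ?thesis unfolding eq leaf_param_def using c 1 2 3 4 by (auto simp: leaf_param_def)
qed

end

section \<open>Completeness of leaves and expansion of segments\<close>

context compact_riemannian
begin

text \<open>Otherwise every point has a ball that the curve eventually avoids, while finitely many
  of these balls cover the manifold.\<close>

lemma not_bounded_cluster:
  fixes c :: "real \<Rightarrow> 'a"
  obtains p where "\<And>e T. 0 < e \<Longrightarrow> \<exists>t\<ge>T. dist_M p (c t) < e"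
proof -
  have "\<exists>p. \<forall>e>0. \<forall>T. \<exists>t\<ge>T. dist_M p (c t) < e"
  proof (rule ccontr)
    assume "\<not> ?thesis"
    then have "\<forall>p. \<exists>e T. 0 < e \<and> (\<forall>t\<ge>T. e \<le> dist_M p (c t))" by (meson not_less)
    then obtain e T where e: "\<And>p. 0 < e p" "\<And>p t. t \<ge> T p \<Longrightarrow> e p \<le> dist_M p (c t)" by metis
    have "\<exists>V. open V \<and> p \<in> V \<and> (\<forall>y\<in>V. dist_M p y < e p)" for p by (rule dist_M_ball_nbhd[OF e(1)])
    then obtain V where V: "\<And>p. open (V p)" "\<And>p. p \<in> V p" "\<And>p y. y \<in> V p \<Longrightarrow> dist_M p y < e p" by metis
    have cover: "UNIV \<subseteq> (\<Union>x\<in>UNIV. V x)" using V(2) by blast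
    obtain P where P: "finite P" "UNIV \<subseteq> (\<Union>x\<in>P. V x)"
      by (rule compactE_image[OF compact_M V(1) cover]) blast
    define t where "t = Max (insert 0 (T ` P))"
    obtain p where p: "p \<in> P" "c t \<in> V p" using P(2) by blast
    have "T p \<le> t" unfolding t_def using P(1) p(1) by (intro Max_ge) auto
    then show False using e(2)[of p t] V(3)[OF p(2)] by simp
  qed
  then show ?thesis using that by blast
qed

text \<open>A bounded monotone \<open>S\<close> would make the curve converge to its cluster point.
  So the parametrized leaf has infinite length towards its end.\<close>

lemma leaf_speed_primitive_unbounded:
  assumes W: "foliation_1d A W" and c: "leaf_param A (W x) c"
    and S: "\<And>s t. s \<le> t \<Longrightarrow> dist_M (c s) (c t) \<le> S t - S s" and mono: "mono S"
  shows "\<exists>t. S t > M"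
proof (rule ccontr)
  assume "\<not> ?thesis"
  then have bdd: "bdd_above (range S)" by (auto intro!: bdd_aboveI[of _ M] simp: not_less)
  obtain p where p: "\<And>e T. 0 < e \<Longrightarrow> \<exists>t\<ge>T. dist_M p (c t) < e" by (rule not_bounded_cluster[of c]) blast
  have "((\<lambda>t. dist_M p (c t)) \<longlongrightarrow> 0) at_top"
  proof (rule tendstoI)
    fix e :: real assume e: "0 < e"
    have "\<exists>T. Sup (range S) - e / 2 < S T"
      using less_cSup_iff[of "range S" "Sup (range S) - e / 2"] bdd e by auto
    then obtain T where T: "Sup (range S) - e / 2 < S T" by blast
    obtain t1 where t1: "t1 \<ge> T" "dist_M p (c t1) < e / 2" using p[of "e / 2" T] e by auto
    have "dist_M p (c t) < e" if t: "t \<ge> t1" for t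
    proof -
      have "S t \<le> Sup (range S)" using bdd by (intro cSup_upper) auto
      moreover have "S T \<le> S t1" using mono t1(1) by (rule monoD)
      ultimately show ?thesis using S[OF t] T t1(2) dist_M_triangle[of p "c t" "c t1"] by linarith
    qed
    then show "\<forall>\<^sub>F t in at_top. dist (dist_M p (c t)) 0 < e"
      using dist_M_nonneg by (auto simp: eventually_at_top_linorder dist_real_def)
  qed
  then have "(c \<longlongrightarrow> p) at_top" by (simp add: tendsto_iff_d)
  then show False using leaf_param_not_convergent[OF W c] by blast
qed

text \<open>The arc-length parameter is the inverse of a primitive \<open>F\<close> of the speed.
  That \<open>F\<close> is onto, and hence that every radius is possible, is the completeness of the
  leaf in both directions.\<close>

lemma ex_arclength_segment:
  assumes W: "foliation_1d A W" and E: "leaf_orientation A g W E" and r: "0 < r"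
  shows "\<exists>\<gamma>. arclength_segment A W E x r \<gamma>"
proof -
  obtain c where c: "leaf_param A (W x) c" and "\<forall>t. \<exists>a>0. velocity A UNIV c t = a *\<^sub>R E (c t)"
    using E unfolding leaf_orientation_def by blast
  then obtain a where a: "\<And>t. 0 < a t" "\<And>t. velocity A UNIV c t = a t *\<^sub>R E (c t)" by metis
  have C1: "C1_curve_on A UNIV c" using c by (simp add: leaf_param_def)
  have En: "rnorm g y (E y) = 1" for y using E by (simp add: leaf_orientation_def)
  have sp: "speed c t = a t" for t
    using a[of t] by (simp add: speed_def rnorm_scaleR En)
  have spc: "continuous_on UNIV (speed c)"
    using continuous_on_speed[OF C1] by (simp add: speed_def[abs_def])
  have "\<exists>F. \<forall>x :: real. - \<infinity> < ereal x \<longrightarrow> ereal x < \<infinity> \<longrightarrow> (F has_vector_derivative speed c x) (at x)"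
    by (rule einterval_antiderivative) (use spc in \<open>auto simp: continuous_on_eq_continuous_at\<close>)
  then obtain F where F: "\<And>t. (F has_vector_derivative speed c t) (at t)" by auto
  then have FD: "(F has_real_derivative a t) (at t)" for t
    by (simp add: has_real_derivative_iff_has_vector_derivative sp)
  have Fmono: "strict_mono F"
    by (rule strict_monoI) (use FD a(1) in \<open>blast intro: DERIV_pos_imp_increasing\<close>)
  have Fcont: "isCont F t" for t using FD by (rule DERIV_isCont)
  have FS: "dist_M (c s) (c t) \<le> F t - F s" if "s \<le> t" for s t
  proof -
    have "(speed c has_integral (F t - F s)) {s..t}"
      by (rule fundamental_theorem_of_calculus[OF that]) (use F has_vector_derivative_at_within in blast)
    then have "arc_length s t c = F t - F s" by (simp add: arc_length_def integral_unique)
    then show ?thesis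
      using riem_dist_le_arc_length[OF C1_imp_piecewise_C1[OF C1_curve_on_subset[OF C1]] that] by simp
  qed
  have above: "\<exists>t. F t > M" for M
    by (rule leaf_speed_primitive_unbounded[OF W c FS strict_mono_mono[OF Fmono]])
  have below: "\<exists>t. F t < M" for M
  proof -
    have "\<exists>t. - F (- t) > - M"
    proof (rule leaf_speed_primitive_unbounded[OF W leaf_param_reverse[OF c]])
      fix s t :: real assume "s \<le> t"
      then show "dist_M (c (- s)) (c (- t)) \<le> - F (- t) - - F (- s)"
        using FS[of "- t" "- s"] dist_M_sym[of "c (- s)" "c (- t)"] by simp
    next
      show "mono (\<lambda>t. - F (- t))" using strict_mono_mono[OF Fmono] by (auto simp: mono_def)
    qed
    then show ?thesis by auto
  qed
  have "\<exists>t. F t = y" for y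
  proof -
    obtain s t where st: "F s < y" "y < F t" using above below by blast
    then have "s \<le> t" using Fmono by (meson less_trans linorder_not_le order_less_asym strict_monoD)
    then show ?thesis using IVT[of F s y t] st Fcont by (auto simp: less_imp_le)
  qed
  then have "bij F" using strict_mono_imp_inj_on[OF Fmono] by (metis bijI surjI)
  define G where "G = inv_into UNIV F"
  have FG: "F (G y) = y" and GF: "G (F t) = t" for y t
    using \<open>bij F\<close> by (simp_all add: G_def surj_f_inv_f bij_is_surj bij_is_inj)
  have Gcont: "isCont G y" for y
  proof -
    have "isCont G (F (G y))"
      by (rule isCont_inverse_function2[of "G y - 1" "G y" "G y + 1"]) (use GF Fcont in auto)
    then show ?thesis by (simp add: FG)
  qed
  have GD: "(G has_real_derivative inverse (a (G y))) (at y)" for y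
    by (rule DERIV_inverse_function[where f = F and a = "y - 1" and b = "y + 1"])
      (use FD FG Gcont a(1)[of "G y"] in auto)
  have ac: "continuous_on UNIV a" using spc by (simp add: sp[abs_def, symmetric] cong: continuous_on_cong)
  obtain t0 where t0: "c t0 = x"
  proof -
    have "x \<in> W x" using W by (simp add: foliation_1d_def)
    moreover have "range c = W x" using c by (simp add: leaf_param_def)
    ultimately have "x \<in> range c" by simp
    then show ?thesis by (rule rangeE) (rule that[OF sym])
  qed
  \<comment> \<open>The shift by \<open>F t0\<close> places \<open>x\<close> at parameter 0. The
    derivative of \<open>h\<close> is the reciprocal of the speed, so the velocity becomes the unit
    vector \<open>E\<close>.\<close>
  define h where "h s = G (F t0 + s)" for s
  have hD: "(h has_vector_derivative inverse (a (h s))) (at s within I)" for s I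
  proof -
    have "(h has_real_derivative inverse (a (h s)) * 1) (at s)"
      unfolding h_def by (rule DERIV_chain2[OF GD]) (auto intro!: derivative_eq_intros)
    then show ?thesis
      by (simp add: has_real_derivative_iff_has_vector_derivative has_vector_derivative_at_within)
  qed
  have hc: "continuous_on I h" for I
    unfolding continuous_on_eq_continuous_within
    by (rule ballI) (rule has_vector_derivative_continuous[OF hD])
  have hac: "continuous_on I (\<lambda>s. inverse (a (h s)))" for I
    using a(1) by (intro continuous_intros continuous_on_compose2[OF ac hc]) (auto simp: less_imp_neq[THEN not_sym])
  have "arclength_segment A W E x r (c \<circ> h)"
    unfolding arclength_segment_def
  proof (intro conjI ballI)
    show "C1_curve_on A {- r..r} (c \<circ> h)"
      by (rule C1_curve_on_reparam[OF C1 _ hD hac]) auto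
    show "(c \<circ> h) 0 = x" by (simp add: h_def GF t0)
    show "(c \<circ> h) ` {- r..r} \<subseteq> W x" using c by (auto simp: leaf_param_def)
    fix t assume t: "t \<in> {- r..r}"
    have "velocity A {- r..r} (c \<circ> h) t = inverse (a (h t)) *\<^sub>R velocity A UNIV c (h t)"
      by (rule velocity_reparam[OF C1 _ hD t]) (use r t at_within_Icc_neq_bot[of "- r" r t] in auto)
    then show "velocity A {- r..r} (c \<circ> h) t = E ((c \<circ> h) t)" using a[of "h t"] by simp
  qed
  then show ?thesis by (intro exI[of _ "c \<circ> h"])
qed

lemma leaf_segment_C1:
  assumes W: "foliation_1d A W" and E: "leaf_orientation A g W E" and r: "0 < r"
  shows "C1_curve_on A {0..1} (leaf_segment A W E x r)"
    "s \<in> {0..1} \<Longrightarrow> velocity A {0..1} (leaf_segment A W E x r) s = (2 * r) *\<^sub>R E (leaf_segment A W E x r s)"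
proof -
  define \<gamma> where "\<gamma> = (SOME \<gamma>. arclength_segment A W E x r \<gamma>)"
  \<comment> \<open>Existence turns the choice in \<open>leaf_segment\<close> into an actual
    segment.\<close>
  have "arclength_segment A W E x r \<gamma>" unfolding \<gamma>_def using ex_arclength_segment[OF assms] by (rule someI_ex)
  then have \<gamma>: "C1_curve_on A {-r..r} \<gamma>" "\<And>t. t \<in> {-r..r} \<Longrightarrow> velocity A {-r..r} \<gamma> t = E (\<gamma> t)"
    by (auto simp: arclength_segment_def)
  define h where "h s = r * (2 * s - 1)" for s :: real
  have eq: "leaf_segment A W E x r = \<gamma> \<circ> h" by (simp add: leaf_segment_def \<gamma>_def h_def o_def)
  have hD: "(h has_vector_derivative (2 * r)) (at t within I)" for t I
    unfolding h_def has_real_derivative_iff_has_vector_derivative[symmetric]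
    by (auto intro!: derivative_eq_intros)
  have him: "h s \<in> {-r..r}" if "s \<in> {0..1}" for s
  proof -
    have "r * (2 * s - 1) \<le> r * 1" "r * (- 1) \<le> r * (2 * s - 1)"
      using that r by (intro mult_left_mono; simp)+
    then show ?thesis by (simp add: h_def)
  qed
  show "C1_curve_on A {0..1} (leaf_segment A W E x r)"
    unfolding eq by (rule C1_curve_on_reparam[OF \<gamma>(1) _ hD]) (use him in auto)
  assume s: "s \<in> {0..1}"
  have "velocity A {0..1} (\<gamma> \<circ> h) s = (2 * r) *\<^sub>R velocity A {-r..r} \<gamma> (h s)"
    by (rule velocity_reparam[OF \<gamma>(1) _ hD s])
      (use him s r at_within_Icc_neq_bot[of 0 1 s] at_within_Icc_neq_bot[of "-r" r "h s"] in auto)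
  then show "velocity A {0..1} (leaf_segment A W E x r) s = (2 * r) *\<^sub>R E (leaf_segment A W E x r s)"
    using \<gamma>(2)[OF him[OF s]] by (simp add: eq)
qed

text \<open>The velocity of the segment is tangent to the leaf at every time, so expansion bounds
  the speed of each image from below, and the polygon bound converts this into length. The constants
  serve all iterates at once.\<close>

lemma iterated_leaf_segment:
  assumes W: "foliation_1d A W" and E: "leaf_orientation A g W E" and f: "C1_map A f"
    and U: "uniformly_expanding A g W f" and r: "0 < r"
  shows "C1_curve_on A {0..1} ((f ^^ i) \<circ> leaf_segment A W E x r)"
    "\<exists>\<mu> C. \<mu> > 1 \<and> C > 0 \<and> (\<forall>i. \<exists>l\<in>polygon_sums dist_M 0 1 ((f ^^ i) \<circ> leaf_segment A W E x r). C * \<mu> ^ i \<le> l)"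
proof -
  let ?\<sigma> = "leaf_segment A W E x r"
  note \<sigma> = leaf_segment_C1[OF W E r, where x = x]
  have nb: "t \<in> {0..1} \<Longrightarrow> at t within {0..1} \<noteq> bot" for t :: real by (rule at_within_Icc_neq_bot) auto
  show C1: "C1_curve_on A {0..1} ((f ^^ i) \<circ> ?\<sigma>)" for i
    by (rule C1_curve_on_funpow[OF f \<sigma>(1) nb])
  obtain \<mu> C where \<mu>: "\<mu> > 1" "C > 0" and
    exp: "\<And>x v m. v \<in> leaf_tangent A W x \<Longrightarrow>
      rnorm g ((f ^^ m) x) (tangent_map A (f ^^ m) x v) \<ge> C * \<mu> ^ m * rnorm g x v"
    using U unfolding uniformly_expanding_def by blast
  have "\<exists>l\<in>polygon_sums dist_M 0 1 ((f ^^ i) \<circ> ?\<sigma>). C * r / 2 * \<mu> ^ i \<le> l" for i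
  proof -
    have v: "C * \<mu> ^ i * (2 * r) \<le> rnorm g (((f ^^ i) \<circ> ?\<sigma>) t) (velocity A {0..1} ((f ^^ i) \<circ> ?\<sigma>) t)"
      if t: "t \<in> {0..1}" for t
    proof -
      let ?p = "?\<sigma> t"
      have Ep: "E ?p \<in> leaf_tangent A W ?p" "rnorm g ?p (E ?p) = 1"
        using E by (auto simp: leaf_orientation_def)
      then obtain b c s where "E ?p = b *\<^sub>R velocity A UNIV c s" "leaf_param A (W ?p) c" "c s = ?p"
        unfolding leaf_tangent_def by blast
      then have "(2 * r) *\<^sub>R E ?p \<in> leaf_tangent A W ?p"
        unfolding leaf_tangent_def by (intro CollectI exI[of _ "2 * r * b"] exI[of _ c] exI[of _ s]) simp
      from exp[OF this, of i] have "C * \<mu> ^ i * (2 * r) \<le>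
          rnorm g ((f ^^ i) ?p) (tangent_map A (f ^^ i) ?p ((2 * r) *\<^sub>R E ?p))"
        using Ep(2) r by (simp add: rnorm_scaleR)
      also have "tangent_map A (f ^^ i) ?p ((2 * r) *\<^sub>R E ?p) = velocity A {0..1} ((f ^^ i) \<circ> ?\<sigma>) t"
        using velocity_map[OF differentiable_map_at_funpow[OF f] \<sigma>(1) t nb[OF t]] \<sigma>(2)[OF t] by simp
      finally show ?thesis by simp
    qed
    have pos: "0 < C * \<mu> ^ i * (2 * r)" using \<mu> r by simp
    \<comment> \<open>The factor \<open>2 * r\<close> is the speed of the segment on
      \<open>[0,1]\<close>; the 4 comes from the polygon bound.\<close>
    have e: "C * \<mu> ^ i * (2 * r) / 4 = C * r / 2 * \<mu> ^ i" by simp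
    show ?thesis unfolding e[symmetric] by (rule polygon_sum_lower[OF C1 pos v])
  qed
  then show "\<exists>\<mu> C. \<mu> > 1 \<and> C > 0 \<and> (\<forall>i. \<exists>l\<in>polygon_sums dist_M 0 1 ((f ^^ i) \<circ> ?\<sigma>). C * \<mu> ^ i \<le> l)"
    using \<mu> r by (intro exI[of _ \<mu>] exI[of _ "C * r / 2"]) simp
qed

end

section \<open>Homology of long leaf segments\<close>

context compact_length_space
begin

text \<open>These inequalities suffice to compare a loop with its segment. Polygons are transported
  by the affine maps onto the halves of \<open>[0,1]\<close> and cut at 1/2.\<close>

lemma Sup_polygon_sums_join:
  assumes p: "bdd_above (polygon_sums d 0 1 p)" and q: "bdd_above (polygon_sums d 0 1 q)"
    and pq: "pathfinish p = pathstart q"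
  shows "bdd_above (polygon_sums d 0 1 (p +++ q))"
    and "Sup (polygon_sums d 0 1 p) \<le> Sup (polygon_sums d 0 1 (p +++ q))"
    and "Sup (polygon_sums d 0 1 (p +++ q)) \<le> Sup (polygon_sums d 0 1 p) + Sup (polygon_sums d 0 1 q)"
proof -
  let ?P = "\<lambda>a b \<gamma>. polygon_sums d a b \<gamma>"
  have 1: "?P 0 1 p \<subseteq> ?P 0 (1/2) (p +++ q)"
    by (rule polygon_sums_reparam[where h = "\<lambda>t. t / 2"])
      (auto simp: mono_on_def joinpaths_def)
  have 2: "?P 0 (1/2) (p +++ q) \<subseteq> ?P 0 1 p"
    by (rule polygon_sums_reparam[where h = "\<lambda>t. 2 * t"])
      (auto simp: mono_on_def joinpaths_def)
  have 3: "?P (1/2) 1 (p +++ q) \<subseteq> ?P 0 1 q"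
  proof (rule polygon_sums_reparam[where h = "\<lambda>t. 2 * t - 1"])
    fix s :: real assume s: "s \<in> {1/2..1}"
    show "(p +++ q) s = q (2 * s - 1)"
    proof (cases "s = 1/2")
      case True
      show ?thesis unfolding True using pq by (simp add: joinpaths_def pathstart_def pathfinish_def)
    next
      case False
      then show ?thesis using s by (simp add: joinpaths_def)
    qed
  qed (auto simp: mono_on_def)
  have ub: "x \<le> Sup (?P 0 1 p) + Sup (?P 0 1 q)" if x: "x \<in> ?P 0 1 (p +++ q)" for x
  proof -
    obtain y z where "y \<in> ?P 0 (1/2) (p +++ q)" "z \<in> ?P (1/2) 1 (p +++ q)" "x \<le> y + z"
      using polygon_sums_split[OF x, of "1/2"] by auto
    then show ?thesis
      using cSup_upper[OF _ p, of y] cSup_upper[OF _ q, of z] 2 3 by fastforce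
  qed
  show bdd: "bdd_above (?P 0 1 (p +++ q))" using ub by (rule bdd_aboveI)
  have ne: "?P 0 1 \<gamma> \<noteq> {}" for \<gamma> using polygon_sums_0[of 0 1 d \<gamma>] by auto
  show "Sup (?P 0 1 p) \<le> Sup (?P 0 1 (p +++ q))"
    by (rule cSup_subset_mono[OF ne bdd]) (use 1 polygon_sums_mono[of 0 0 "1/2" 1 d "p +++ q"] in auto)
  show "Sup (?P 0 1 (p +++ q)) \<le> Sup (?P 0 1 p) + Sup (?P 0 1 q)"
    by (rule cSup_least[OF ne ub])
qed

end

section \<open>Rectifiable curves, their homology, and growth along leaves\<close>

context compact_riemannian
begin

lemma curve_length_eq: "curve_length A g \<gamma> = Sup (polygon_sums dist_M 0 1 \<gamma>)"
  and rectifiable_iff: "rectifiable A g \<gamma> \<longleftrightarrow> path \<gamma> \<and> bdd_above (polygon_sums dist_M 0 1 \<gamma>)"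
  by (simp_all add: curve_length_def rectifiable_def polygon_lengths_eq)

lemma rectifiableD:
  assumes "rectifiable A g \<gamma>"
  shows "path \<gamma>" "x \<in> polygon_sums dist_M 0 1 \<gamma> \<Longrightarrow> x \<le> curve_length A g \<gamma>"
  using assms by (auto simp: rectifiable_iff curve_length_eq intro: cSup_upper)

lemma dist_M_le_diameter: "dist_M x y \<le> riem_diameter A g"
proof -
  obtain D where "\<And>x y. dist_M x y \<le> D" using bounded_d by blast
  then have "bdd_above {dist_M x y | x y. True}" by (auto intro!: bdd_aboveI[of _ D])
  then show ?thesis unfolding riem_diameter_def by (rule cSup_upper[rotated]) blast
qed

lemma Lipschitz_imp_rectifiable:
  assumes "path \<gamma>" "0 \<le> K" "\<And>s t. s \<in> {0..1} \<Longrightarrow> t \<in> {0..1} \<Longrightarrow> dist_M (\<gamma> s) (\<gamma> t) \<le> K * \<bar>s - t\<bar>"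
  shows "rectifiable A g \<gamma>" "curve_length A g \<gamma> \<le> K"
proof -
  have "x \<le> K" if "x \<in> polygon_sums dist_M 0 1 \<gamma>" for x
    using polygon_sums_Lipschitz[OF assms(3) assms(2) _ that] by simp
  then show "rectifiable A g \<gamma>" "curve_length A g \<gamma> \<le> K"
    using assms(1) polygon_sums_0[of 0 1 dist_M \<gamma>]
    by (auto simp: rectifiable_iff curve_length_eq intro!: bdd_aboveI[of _ K] cSup_least)
qed

text \<open>A true geodesic is taken: an almost shortest path could exceed the diameter when the end
  points are at maximal distance.\<close>

lemma ex_closing_curve: "\<exists>b. closing_curve A g \<sigma> b"
proof -
  let ?p = "pathfinish \<sigma>" and ?q = "pathstart \<sigma>"
  obtain b where b: "path b" "b 0 = ?p" "b 1 = ?q"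
    "\<And>s t. s \<in> {0..1} \<Longrightarrow> t \<in> {0..1} \<Longrightarrow> dist_M (b s) (b t) \<le> dist_M ?p ?q * \<bar>s - t\<bar>"
    by (rule geodesic[of ?p ?q]) blast
  have "closing_curve A g \<sigma> b"
    unfolding closing_curve_def
    using Lipschitz_imp_rectifiable[OF b(1) dist_M_nonneg b(4)] dist_M_le_diameter[of ?p ?q] b(2,3)
    by (auto simp: pathstart_def pathfinish_def)
  then show ?thesis by (intro exI[of _ b])
qed

lemma C1_curve_rectifiable:
  assumes "C1_curve_on A {0..1} \<gamma>" shows "rectifiable A g \<gamma>"
proof -
  obtain K where "0 \<le> K" "\<And>s t. s \<in> {0..1} \<Longrightarrow> t \<in> {0..1} \<Longrightarrow> dist_M (\<gamma> s) (\<gamma> t) \<le> K * \<bar>s - t\<bar>"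
    using C1_curve_Lipschitz[OF assms] by blast
  then show ?thesis
    using C1_curve_on_continuous[OF assms] by (intro Lipschitz_imp_rectifiable[of \<gamma> K]) (simp_all add: path_def)
qed

text \<open>The same \<open>F\<close> and \<open>\<delta>\<close> serve a curve and its image under
  \<open>f\<close>, because one mesh size makes both the pieces and their images short. In both
  bounds the length is that of the original curve.\<close>

lemma homology_of_rectifiable_curves:
  assumes f: "continuous_on UNIV f"
  obtains x0 \<rho> F \<delta> where "joining_chains x0 \<rho>" "finite F" "0 < \<delta>"
    "\<And>\<gamma>. rectifiable A g \<gamma> \<Longrightarrow> coeff_bounded F (curve_length A g \<gamma> / \<delta> + 2) (lasso_class \<rho> \<gamma>)"
    "\<And>\<gamma>. rectifiable A g \<gamma> \<Longrightarrow> coeff_bounded F (curve_length A g \<gamma> / \<delta> + 2) (lasso_class \<rho> (f \<circ> \<gamma>))"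
proof -
  obtain x0 \<rho> \<delta> where \<delta>: "0 < \<delta>" and \<rho>: "joining_chains x0 \<rho>" and
    fin: "finite {lasso_class \<rho> \<gamma> | \<gamma>. path \<gamma> \<and> (\<forall>s\<in>{0..1}. dist_M (\<gamma> 0) (\<gamma> s) \<le> \<delta>)}" (is "finite ?F")
    by (rule finite_small_lasso_classes[OF small_paths_homologous]) blast
  obtain \<epsilon> where \<epsilon>: "\<epsilon> > 0" "\<And>x y. dist_M x y < \<epsilon> \<Longrightarrow> dist_M (f x) (f y) < \<delta>"
    using uniformly_continuous[OF f \<delta>] by blast
  \<comment> \<open>Half of \<open>\<epsilon>\<close> is taken because pieces obey a weak inequality
    and uniform continuity asks for a strict one.\<close>
  define \<eta> where "\<eta> = min \<delta> (\<epsilon> / 2)"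
  have \<eta>: "0 < \<eta>" "\<eta> \<le> \<delta>" "\<eta> < \<epsilon>" using \<delta> \<epsilon>(1) by (auto simp: \<eta>_def)
  have *: "coeff_bounded ?F (curve_length A g \<gamma> / \<eta> + 2) (lasso_class \<rho> (h \<circ> \<gamma>))"
    if \<gamma>: "rectifiable A g \<gamma>" and h: "continuous_on UNIV h"
      and small: "\<And>x y. dist_M x y \<le> \<eta> \<Longrightarrow> dist_M (h x) (h y) \<le> \<delta>" for \<gamma> h
  proof -
    note p = rectifiableD[OF \<gamma>]
    have hp: "path (h \<circ> \<gamma>)"
      using p(1) by (rule path_continuous_image) (rule continuous_on_subset[OF h], simp)
    have "coeff_bounded ?F (curve_length A g \<gamma> / \<eta> + 2) (lasso_class \<rho> (subarc 0 1 (h \<circ> \<gamma>)))"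
    proof (rule coeff_bounded_additive_on_rectifiable'[where Z = "\<lambda>a b. lasso_class \<rho> (subarc a b (h \<circ> \<gamma>))",
          OF p(1) fin \<eta>(1) lasso_class_subarc[OF \<rho> hp] _ p(2)])
      fix a b :: real
      assume ab: "0 \<le> a" "a \<le> b" "b \<le> 1" and s: "\<And>s. s \<in> {a..b} \<Longrightarrow> dist_M (\<gamma> a) (\<gamma> s) \<le> \<eta>"
      have "dist_M (subarc a b (h \<circ> \<gamma>) 0) (subarc a b (h \<circ> \<gamma>) s) \<le> \<delta>" if "s \<in> {0..1}" for s
        using small[OF s[OF affine_01_mem[OF ab that]]] by (simp add: subarc_def)
      then show "lasso_class \<rho> (subarc a b (h \<circ> \<gamma>)) \<in> ?F"
        using path_subarc[OF hp ab] by blast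
    qed
    moreover have "subarc 0 1 (h \<circ> \<gamma>) = h \<circ> \<gamma>" by (simp add: subarc_def o_def)
    ultimately show ?thesis by (simp only:)
  qed
  show ?thesis
  proof (rule that[OF \<rho> fin \<eta>(1)])
    fix \<gamma> assume \<gamma>: "rectifiable A g \<gamma>"
    have "dist_M x y \<le> \<eta> \<Longrightarrow> dist_M (id x) (id y) \<le> \<delta>" for x y using \<eta>(2) by simp
    from *[OF \<gamma> continuous_on_id[folded id_def] this]
    show "coeff_bounded ?F (curve_length A g \<gamma> / \<eta> + 2) (lasso_class \<rho> \<gamma>)" by (simp only: id_comp)
    have "dist_M x y \<le> \<eta> \<Longrightarrow> dist_M (f x) (f y) \<le> \<delta>" for x y
      using \<epsilon>(2)[of x y] \<eta>(3) by (simp add: less_imp_le)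
    from *[OF \<gamma> f this]
    show "coeff_bounded ?F (curve_length A g \<gamma> / \<eta> + 2) (lasso_class \<rho> (f \<circ> \<gamma>))" .
  qed
qed

text \<open>The abstract growth lemma applied to the loops over the iterated segments. The loops
  exceed the segments by at most the diameter, which does not change the rate.\<close>

lemma leaf_growth_rate:
  assumes f: "C1_map A f" and W: "foliation_1d A W" and E: "leaf_orientation A g W E"
    and U: "uniformly_expanding A g W f" and N: "is_norm N" and r: "0 < r"
    and c: "0 < c1" "c1 \<le> c2" and u: "N u = 1"
    and lim: "homology_limits A g W E f N x r \<subseteq> {c *\<^sub>R u | c. c1 \<le> c \<and> c \<le> c2}"
  shows "\<exists>l>0. H1_map f u = l *\<^sub>R u \<and>
    (\<lambda>i. 1 / real i * ln (curve_length A g ((f ^^ i) \<circ> leaf_segment A W E x r))) \<longlonglongrightarrow> ln l"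
proof -
  define \<sigma> where "\<sigma> i = (f ^^ i) \<circ> leaf_segment A W E x r" for i
  define \<Lambda> where "\<Lambda> i = curve_length A g (\<sigma> i)" for i
  define D where "D = riem_diameter A g"
  have fc: "continuous_on UNIV f" using C1_mapD(1)[OF f] .
  have \<sigma>: "rectifiable A g (\<sigma> i)" for i
    unfolding \<sigma>_def by (rule C1_curve_rectifiable[OF iterated_leaf_segment(1)[OF W E f U r]])
  have "\<forall>i. \<exists>b. closing_curve A g (\<sigma> i) b" using ex_closing_curve by blast
  from choice[OF this] obtain b where b: "\<And>i. closing_curve A g (\<sigma> i) (b i)" by blast
  have brect: "rectifiable A g (b i)" and blen: "curve_length A g (b i) \<le> D"
    and b0: "pathstart (b i) = pathfinish (\<sigma> i)" and b1: "pathfinish (b i) = pathstart (\<sigma> i)" for i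
    using b[of i] by (auto simp: closing_curve_def D_def)
  define l where "l i = \<sigma> i +++ b i" for i
  define L where "L i = curve_length A g (l i)" for i
  have bdd: "bdd_above (polygon_sums dist_M 0 1 (\<sigma> i))" "bdd_above (polygon_sums dist_M 0 1 (b i))" for i
    using \<sigma>[of i] brect[of i] by (auto simp: rectifiable_iff)
  note join = Sup_polygon_sums_join[OF bdd b0[symmetric]]
  have lp: "path (l i)" and loop: "l i 1 = l i 0" for i
    using rectifiableD(1)[OF \<sigma>[of i]] rectifiableD(1)[OF brect[of i]] b0[of i] b1[of i]
    by (simp_all add: l_def) (simp add: joinpaths_def pathstart_def pathfinish_def)
  have lrect: "rectifiable A g (l i)" for i
    using lp[of i] join(1)[of i] by (simp add: rectifiable_iff l_def)
  have \<Lambda>L: "\<Lambda> i \<le> L i" and L\<Lambda>: "L i \<le> \<Lambda> i + D" for i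
    using join(2,3)[of i] blen[of i] by (simp_all add: \<Lambda>_def L_def curve_length_eq l_def)
  obtain \<mu> C where \<mu>: "\<mu> > 1" "C > 0"
    and exp: "\<And>i. \<exists>x\<in>polygon_sums dist_M 0 1 (\<sigma> i). C * \<mu> ^ i \<le> x"
    using iterated_leaf_segment(2)[OF W E f U r] unfolding \<sigma>_def by blast
  have grow: "C * \<mu> ^ i \<le> \<Lambda> i" for i
    using exp[of i] rectifiableD(2)[OF \<sigma>[of i]] unfolding \<Lambda>_def by (meson order_trans)
  \<comment> \<open>A positive lower bound for all lengths, the divisor in the estimates
    below.\<close>
  have "C * 1 \<le> C * \<mu> ^ i" for i using \<mu> by (intro mult_left_mono one_le_power) auto
  then have \<Lambda>C: "C \<le> \<Lambda> i" for i using grow[of i] by (metis mult.right_neutral order_trans)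
  have Lpos: "0 < L i" for i using \<Lambda>C[of i] \<Lambda>L[of i] \<mu>(2) by linarith
  have Ltop: "filterlim L at_top sequentially"
  proof (rule filterlim_at_top_mono[OF _ always_eventually])
    show "filterlim (\<lambda>i. C * \<mu> ^ i) at_top sequentially"
    proof (rule filterlim_tendsto_pos_mult_at_top[OF tendsto_const \<mu>(2)])
      have "1 < norm \<mu>" using \<mu>(1) by simp
      from filterlim_realpow_sequentially_gt1[OF this]
      show "filterlim (\<lambda>i. \<mu> ^ i) at_top sequentially"
        by (rule filterlim_at_infinity_imp_filterlim_at_top) (use \<mu>(1) in simp)
    qed
    show "\<forall>i. C * \<mu> ^ i \<le> L i" using grow \<Lambda>L order_trans by blast
  qed
  obtain x0 \<rho> F \<delta> where \<rho>: "joining_chains x0 \<rho>" and F: "finite F" and \<delta>: "0 < \<delta>"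
    and cb: "\<And>\<gamma>. rectifiable A g \<gamma> \<Longrightarrow> coeff_bounded F (curve_length A g \<gamma> / \<delta> + 2) (lasso_class \<rho> \<gamma>)"
    and cbf: "\<And>\<gamma>. rectifiable A g \<gamma> \<Longrightarrow> coeff_bounded F (curve_length A g \<gamma> / \<delta> + 2) (lasso_class \<rho> (f \<circ> \<gamma>))"
    by (rule homology_of_rectifiable_curves[OF fc]) blast
  define v where "v i = loop_class (l i)" for i
  have v: "v i = lasso_class \<rho> (\<sigma> i) + lasso_class \<rho> (b i)" for i
    unfolding v_def lasso_class_loop[OF \<rho> lp loop, symmetric] unfolding l_def
    by (rule lasso_class_join[OF \<rho> rectifiableD(1)[OF \<sigma>] rectifiableD(1)[OF brect] b0[symmetric]])
  have path_f: "path (f \<circ> \<gamma>)" if "path \<gamma>" for \<gamma>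
    using that by (rule path_continuous_image) (rule continuous_on_subset[OF fc], simp)
  have Tv: "H1_map f (v i) = lasso_class \<rho> (\<sigma> (Suc i)) + lasso_class \<rho> (f \<circ> b i)" for i
  proof -
    have "H1_map f (v i) = loop_class (f \<circ> l i)"
      unfolding v_def by (rule H1_map_loop_class[OF fc lp loop])
    also have "\<dots> = lasso_class \<rho> (f \<circ> l i)"
      by (rule lasso_class_loop[OF \<rho> path_f[OF lp], symmetric]) (simp add: loop)
    also have "\<dots> = lasso_class \<rho> ((f \<circ> \<sigma> i) +++ (f \<circ> b i))" by (simp add: l_def path_compose_join)
    also have "\<dots> = lasso_class \<rho> (f \<circ> \<sigma> i) + lasso_class \<rho> (f \<circ> b i)"
      by (rule lasso_class_join[OF \<rho> path_f[OF rectifiableD(1)[OF \<sigma>]] path_f[OF rectifiableD(1)[OF brect]]])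
        (simp add: pathfinish_compose pathstart_compose b0)
    also have "f \<circ> \<sigma> i = \<sigma> (Suc i)" by (simp add: \<sigma>_def o_def)
    finally show ?thesis .
  qed
  \<comment> \<open>Each of the two closing terms, from \<open>b (Suc i)\<close> and from
    \<open>f \<circ> b i\<close>, contributes at most half of \<open>B\<close>.\<close>
  define B where "B = 2 * ((D / \<delta> + 2) * (\<Sum>k\<in>F. N k))"
  have bound: "N h \<le> B / 2" if "coeff_bounded F (curve_length A g (b i) / \<delta> + 2) h" for i h
  proof -
    have "curve_length A g (b i) / \<delta> + 2 \<le> D / \<delta> + 2"
      using blen[of i] \<delta> by (simp add: divide_right_mono)
    from coeff_bounded_norm_bound[OF F N _ _ coeff_bounded_mono[OF that this], of "\<lambda>x. x"]
    show ?thesis by (simp add: B_def Modules.additive.intro)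
  qed
  have "N (v (Suc i) - H1_map f (v i)) \<le> B" for i
  proof -
    \<comment> \<open>The class of the segment at level \<open>Suc i\<close> occurs in both terms
      and cancels.\<close>
    have "v (Suc i) - H1_map f (v i) = lasso_class \<rho> (b (Suc i)) - lasso_class \<rho> (f \<circ> b i)"
      using Tv[of i] v[of "Suc i"] by simp
    then show ?thesis
      using is_norm_diff[OF N, of "lasso_class \<rho> (b (Suc i))" "lasso_class \<rho> (f \<circ> b i)"]
        bound[OF cb[OF brect]] bound[OF cbf[OF brect]] by (smt (verit) field_sum_of_halves)
  qed
  moreover have "coeff_bounded F ((1 / \<delta> + 2 / C) * L i) (v i)" for i
  proof -
    \<comment> \<open>The additive 2 from cutting is absorbed into a multiple of \<open>L i\<close>,
      which is at least \<open>C\<close>.\<close>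
    have "2 = 2 / C * C" using \<mu>(2) by simp
    also have "\<dots> \<le> 2 / C * L i"
      using \<Lambda>C[of i] \<Lambda>L[of i] \<mu>(2) by (intro mult_left_mono) auto
    finally have "L i / \<delta> + 2 \<le> (1 / \<delta> + 2 / C) * L i" by (simp add: algebra_simps)
    moreover have "coeff_bounded F (L i / \<delta> + 2) (v i)"
      using cb[OF lrect[of i]] lasso_class_loop[OF \<rho> lp[of i] loop[of i]] by (simp add: v_def L_def)
    ultimately show ?thesis by (rule coeff_bounded_mono[rotated])
  qed
  moreover have "\<exists>c\<in>{c1..c2}. h = c *\<^sub>R u"
    if "strict_mono (n :: nat \<Rightarrow> nat)" "(\<lambda>j. N ((1 / L (n j)) *\<^sub>R v (n j) - h)) \<longlonglongrightarrow> 0" for n h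
  proof -
    \<comment> \<open>One sequence of closing curves was fixed for all iterates, so any convergent
      subsequence yields an element of \<open>homology_limits\<close>.\<close>
    have "h \<in> homology_limits A g W E f N x r"
      unfolding homology_limits_def Let_def
      by (intro CollectI exI[of _ b] exI[of _ n])
        (use that b in \<open>simp add: L_def v_def l_def \<sigma>_def\<close>)
    then have "h \<in> {c *\<^sub>R u | c. c1 \<le> c \<and> c \<le> c2}" using lim by (rule subsetD[rotated])
    then show ?thesis by auto
  qed
  ultimately have "\<exists>l>0. H1_map f u = l *\<^sub>R u \<and> (\<lambda>i. 1 / real i * ln (L i)) \<longlonglongrightarrow> ln l"
    by (intro growth_rate_of_normalized_limits[where F = F and K = "1 / \<delta> + 2 / C" and B = B
          and v = v and T = "H1_map f" and N = N and ?c1.0 = c1 and ?c2.0 = c2, OF N _ _ F c u Lpos Ltop])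
      (auto intro!: Modules.additive.intro H1_map_add[OF fc] H1_map_scaleR[OF fc])
  then obtain \<kappa> where \<kappa>: "\<kappa> > 0" "H1_map f u = \<kappa> *\<^sub>R u" "(\<lambda>i. 1 / real i * ln (L i)) \<longlonglongrightarrow> ln \<kappa>" by blast
  \<comment> \<open>The logarithms of loop and segment lengths differ by at most
    \<open>D / C\<close>, uniformly in \<open>i\<close>.\<close>
  have diff: "(\<lambda>i. 1 / real i * ln (L i) - 1 / real i * ln (\<Lambda> i)) \<longlonglongrightarrow> 0"
  proof (rule Lim_null_comparison[OF always_eventually], rule allI)
    fix i
    have \<Lambda>pos: "0 < \<Lambda> i" using \<Lambda>C[of i] \<mu>(2) by linarith
    have D0: "0 \<le> D" using \<Lambda>L[of i] L\<Lambda>[of i] by linarith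
    have "ln (L i) - ln (\<Lambda> i) = ln (L i / \<Lambda> i)" using \<Lambda>pos Lpos[of i] by (simp add: ln_div)
    also have "\<dots> \<le> L i / \<Lambda> i - 1" using \<Lambda>pos Lpos[of i] by (intro ln_le_minus_one) simp
    also have "\<dots> = (L i - \<Lambda> i) / \<Lambda> i" using \<Lambda>pos by (simp add: diff_divide_distrib)
    also have "\<dots> \<le> D / \<Lambda> i" using \<Lambda>pos L\<Lambda>[of i] by (intro divide_right_mono) auto
    also have "\<dots> \<le> D / C" using \<Lambda>C[of i] \<mu>(2) D0 by (intro divide_left_mono) auto
    finally have "ln (L i) - ln (\<Lambda> i) \<le> D / C" .
    moreover have "ln (\<Lambda> i) \<le> ln (L i)" using \<Lambda>pos \<Lambda>L[of i] by simp
    ultimately have "\<bar>ln (L i) - ln (\<Lambda> i)\<bar> \<le> D / C" by simp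
    then have "1 / real i * \<bar>ln (L i) - ln (\<Lambda> i)\<bar> \<le> 1 / real i * (D / C)" by (rule mult_left_mono) simp
    then show "norm (1 / real i * ln (L i) - 1 / real i * ln (\<Lambda> i)) \<le> 1 / real i * (D / C)"
      by (simp add: abs_mult flip: right_diff_distrib diff_divide_distrib)
  qed (rule tendsto_mult_left_zero[OF lim_1_over_n])
  have "(\<lambda>i. 1 / real i * ln (\<Lambda> i)) \<longlonglongrightarrow> ln \<kappa>"
    using tendsto_diff[OF \<kappa>(3) diff] by simp
  then show ?thesis using \<kappa> by (auto simp: \<Lambda>_def \<sigma>_def)
qed

end

theorem theorem2p3:
  fixes A :: "('m::t2_space, 'e::euclidean_space) chart set"
    and g :: "'m \<Rightarrow> 'e \<Rightarrow> 'e \<Rightarrow> real"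
    and f :: "'m \<Rightarrow> 'm"
    and W :: "'m \<Rightarrow> 'm set"
    and E :: "'m \<Rightarrow> 'e"
    and N :: "'m real_H1 \<Rightarrow> real"
    and hW :: "'m real_H1"
  assumes "compact (UNIV :: 'm set)" and "connected (UNIV :: 'm set)"
    and "riemannian_manifold A g"
    and "C1_diffeomorphism A f"
    and "foliation_1d A W" and "leaf_orientation A g W E"
    and "invariant_foliation f W"
    and "uniformly_expanding A g W f"
    and "is_norm N"
    and "carries_unique_homology A g W E f N hW"
  shows "(\<forall>x y. \<forall>r>0. \<forall>s>0.
            geom_expansion_at A g W E f x r = geom_expansion_at A g W E f y s) \<and>
         (\<forall>lamW::real. H1_map f hW = lamW *\<^sub>R hW \<longrightarrow>
            lamW > 0 \<and>
            (\<forall>x. \<forall>r>0.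
               geom_expansion A g W E f r = geom_expansion_at A g W E f x r \<and>
               geom_expansion_at A g W E f x r = ereal (ln lamW) \<and>
               (\<lambda>i. 1 / real i * ln (curve_length A g ((f ^^ i) \<circ> leaf_segment A W E x r)))
                 \<longlonglongrightarrow> ln lamW))"
proof -
  interpret compact_riemannian A g
    by unfold_locales (use assms(1-3) in \<open>simp_all add: riemannian_manifold_def\<close>)
  have f: "C1_map A f" using assms(4) by (simp add: C1_diffeomorphism_def)
  obtain c1 c2 u where c: "0 < c1" "c1 < c2" and u: "N u = 1"
    and lim: "\<And>x r. 0 < r \<Longrightarrow> homology_limits A g W E f N x r \<subseteq> {c *\<^sub>R u | c. c1 \<le> c \<and> c \<le> c2}"
    and hW: "\<exists>x r. r > 0 \<and> hW \<in> homology_limits A g W E f N x r"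
    using assms(10) unfolding carries_unique_homology_def by blast
  have u0: "u \<noteq> 0" using u is_normD(1)[OF assms(9), of 0] by auto
  let ?\<Lambda> = "\<lambda>x r i. 1 / real i * ln (curve_length A g ((f ^^ i) \<circ> leaf_segment A W E x r))"
  have growth: "\<exists>l>0. H1_map f u = l *\<^sub>R u \<and> ?\<Lambda> x r \<longlonglongrightarrow> ln l" if "0 < r" for x r
    by (rule leaf_growth_rate[OF f assms(5,6,8,9) that c(1) less_imp_le[OF c(2)] u lim[OF that]])
  obtain l where l: "l > 0" "H1_map f u = l *\<^sub>R u" using growth[of 1] by auto
  \<comment> \<open>The rate found for \<open>x\<close> and \<open>r\<close> is the logarithm of the
    eigenvalue of \<open>u\<close>; as \<open>u\<close> is nonzero, this eigenvalue is the same for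
    all \<open>x\<close> and \<open>r\<close>.\<close>
  have conv: "?\<Lambda> x r \<longlonglongrightarrow> ln l" if "0 < r" for x r
    using growth[OF that, of x] l(2) u0 by auto
  have at: "geom_expansion_at A g W E f x r = ereal (ln l)" if "0 < r" for x r
    unfolding geom_expansion_at_def
    using lim_imp_Limsup[OF trivial_limit_sequentially tendsto_ereal[OF conv[OF that]]] by simp
  have sup: "geom_expansion A g W E f r = ereal (ln l)" if "0 < r" for r
    unfolding geom_expansion_def using at[OF that] by simp
  \<comment> \<open>\<open>hW\<close> is a multiple of \<open>u\<close> by a factor of at least
    \<open>c1\<close>, hence nonzero, so both have the same eigenvalue.\<close>
  have eigenvalue: "lamW = l" if "H1_map f hW = lamW *\<^sub>R hW" for lamW
  proof -
    obtain c where c': "hW = c *\<^sub>R u" "c1 \<le> c" using hW lim by blast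
    have "(c * l) *\<^sub>R u = (lamW * c) *\<^sub>R u"
      using that H1_map_scaleR[OF C1_mapD(1)[OF f], of c u] l(2) by (simp add: c'(1))
    then show ?thesis using u0 c' c(1) by simp
  qed
  show ?thesis
  proof (intro conjI allI impI)
    fix lamW assume "H1_map f hW = lamW *\<^sub>R hW"
    then have "lamW = l" by (rule eigenvalue)
    then show "0 < lamW" and "\<And>x r. 0 < r \<Longrightarrow> geom_expansion_at A g W E f x r = ereal (ln lamW)"
      and "\<And>x r. 0 < r \<Longrightarrow> ?\<Lambda> x r \<longlonglongrightarrow> ln lamW"
      using l(1) at conv by simp_all
  qed (simp_all add: at sup)
qed

end
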